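(* Let $(M,g)$ be a connected and complete $n$-dimensional Riemannian manifold with Riemannian distance $\rho$, let $f:[0,+\infty)\times M\times\mathbb R^m\to TM$ satisfy $f(t,x,u)\in T_xM$ for all $(t,x,u)$ (so the state domain is $D=M$), and let $x^*\in M$ be an equilibrium point, i.e. $f(t,x^*,0)=0$ for all $t\in[0,+\infty)$. Assume that $f$ satisfies Assumption (A) (stated in the context). Suppose that there exists an ISS-Lyapunov function $V:[0,+\infty)\times M\to\mathbb R$ for the system $\dot x(t)=f(t,x(t),u(t))$ with $\delta_V=+\infty$ and comparison functions $\alpha_1,\alpha_2,\alpha_3,\alpha_4$ (see the context), where $\alpha_1$ and $\alpha_2$ are $\mathcal K_\infty$-functions. Then the system is globally ISS.
   Context: Here $m,n\ge1$ are integers. $|\cdot|$ denotes the Euclidean norm on Euclidean spaces and the norm induced by $g$ on tangent vectors. For $u(\cdot)\in L^\infty([0,+\infty);\mathbb R^m)$ and $t_0\geq 0$, $\|u\|_{\infty,t_0}=\operatorname{ess\,sup}_{\tau\ge t_0}|u(\tau)|$. Comparison functions. $\alpha:[0,+\infty)\to[0,+\infty)$ is a $\mathcal K$-function if it is continuous, strictly increasing and $\alpha(0)=0$; it is a $\mathcal K_\infty$-function if in addition $\lim_{s\to+\infty}\alpha(s)=+\infty$. A continuous function $\beta:[0,+\infty)\times[0,+\infty)\to[0,+\infty)$ is a $\mathcal{KL}$-function if $\beta(\cdot,t)$ is a $\mathcal K$-function for each $t\ge0$, and for each $s\ge0$ the function $\beta(s,\cdot)$ is decreasing with $\lim_{t\to+\infty}\beta(s,t)=0$.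 Assumption (A) (with $D=M$). (1) For each $(x,u)\in M\times\mathbb R^m$, $t\mapsto f(t,x,u)$ is measurable. (2) For each $(t,u)\in[0,+\infty)\times\mathbb R^m$ and each coordinate chart $\varphi:U\to\mathbb R^n$ in $M$, the map $z\mapsto d\varphi_{\varphi^{-1}(z)}\bigl(f(t,\varphi^{-1}(z),u)\bigr)$ is locally Lipschitz continuous on $\varphi(U)$. (3) For each $(t,x)\in[0,+\infty)\times M$, $u\mapsto f(t,x,u)$ is continuous. (4) For every $R,r>0$ there exists $I_{R,r}\in L^1_{\mathrm{loc}}([0,+\infty))$ such that $|f(t,x,u)|\le I_{R,r}(t)$ for a.e. $t\in[0,+\infty)$ and all $(x,u)\in M\times\mathbb R^m$ with $\rho(x,x^* )\le R$, $|u|\le r$. Solutions. A map $x:[a,b]\to M$ is absolutely continuous if there is $m\in L^1(a,b)$ with $\rho(x(s),x(t))\le\int_s^t m(\tau)\,d\tau$ for $a\le s\le t\le b$; a curve on an open or half-open interval is locally absolutely continuous if its restriction to each compact subinterval is absolutely continuous. The velocity $\dot x(t)\in T_{x(t)}M$ is defined, at each $t$ where the coordinate representation $\varphi\circ x$ in a chart $\varphi$ about $x(t)$ is differentiable, by $\dot x(t)=d(\varphi^{-1})_{\varphi(x(t))}\bigl((\varphi\circ x)'(t)\bigr)$. For an input $u(\cdot)\in L^\infty([0,+\infty);\mathbb R^m)$, $t_0\ge0$ and $T\in(t_0,+\infty]$, a solution on $[t_0,T)$ is a locally absolutely continuous curve $x:[t_0,T)\to M$ with $\dot x(t)=f(t,x(t),u(t))$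 for a.e. $t\in(t_0,T)$. It is a maximal solution if there is no $\widetilde T>T$, $\widetilde T\in(t_0,+\infty]$, and solution $\widetilde x:[t_0,\widetilde T)\to M$ with $\widetilde x=x$ on $[t_0,T)$. Global ISS. The system is globally ISS if there exist a $\mathcal{KL}$-function $\beta:[0,+\infty)\times[0,+\infty)\to[0,+\infty)$ and a $\mathcal K$-function $\gamma:[0,+\infty)\to[0,+\infty)$ such that for every $t_0\ge0$, every initial state $x_u(t_0)\in M$ and every $u(\cdot)\in L^\infty([0,+\infty);\mathbb R^m)$, every corresponding maximal solution $x_u(\cdot)$ is defined on $[t_0,+\infty)$ and satisfies $\rho(x_u(t),x^* )\le\beta(\rho(x_u(t_0),x^* ),t-t_0)+\gamma(\|u\|_{\infty,t_0})$ for all $t\ge t_0$. ISS-Lyapunov function (with $D=M$ and $\delta_V=+\infty$). A $C^1$ function $V:[0,+\infty)\times M\to\mathbb R$, with time derivative $V_t$ and differential in $x$ denoted $d_xV$, for which there exist $\mathcal K$-functions $\alpha_1,\alpha_2,\alpha_3,\alpha_4:[0,+\infty)\to[0,+\infty)$ such that $\alpha_1(r)\le\alpha_2(r)$ for all $r\ge0$; $\alpha_1(\rho(x,x^* ))\le V(t,x)\le\alpha_2(\rho(x,x^* ))$ for all $(t,x)\in[0,+\infty)\times M$; and $V_t(t,x)+d_xV(t,x)(f(t,x,u))\le-\alpha_3(\rho(x,x^* ))$ for all $(t,x,u)\in[0,+\infty)\times M\times\mathbb R^m$ with $\rho(x,x^* )\ge\alpha_4(|u|)$. *)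

theory Defs
  imports "HOL-Analysis.Analysis" "HOL-Probability.Essential_Supremum"
begin

section \<open>Smooth manifolds\<close>

text \<open>
  The manifold is the whole of a Hausdorff, second countable type \<open>'a\<close>; its dimension is
  \<open>CARD('n)\<close>.  A chart is a pair (domain, coordinate map); the values of the coordinate map
  outside the domain are irrelevant.
\<close>

type_synonym ('a, 'n) chart = "'a set \<times> ('a \<Rightarrow> real ^ 'n)"

abbreviation chart_inv :: "('a, 'n::finite) chart \<Rightarrow> real ^ 'n \<Rightarrow> 'a"
  where "chart_inv c \<equiv> inv_into (fst c) (snd c)"

abbreviation chart_im :: "('a, 'n::finite) chart \<Rightarrow> (real ^ 'n) set"
  where "chart_im c \<equiv> snd c ` fst c"

text \<open>
  Continuity of all partial derivatives up to order \<open>k\<close>, together with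
  differentiability of those of order below \<open>k\<close>; intended for open \<open>S\<close>.
\<close>

primrec Ck_on :: "nat \<Rightarrow> ('a::euclidean_space \<Rightarrow> 'b::real_normed_vector) \<Rightarrow> 'a set \<Rightarrow> bool" where
  "Ck_on 0 h S \<longleftrightarrow> continuous_on S h"
| "Ck_on (Suc k) h S \<longleftrightarrow> (\<forall>x\<in>S. h differentiable (at x)) \<and>
     (\<forall>i\<in>Basis. Ck_on k (\<lambda>x. frechet_derivative h (at x) i) S)"

definition smooth_on :: "('a::euclidean_space \<Rightarrow> 'b::real_normed_vector) \<Rightarrow> 'a set \<Rightarrow> bool"
  where "smooth_on h S \<longleftrightarrow> (\<forall>k. Ck_on k h S)"

definition is_chart :: "('a::topological_space, 'n::finite) chart \<Rightarrow> bool"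
  where "is_chart c \<longleftrightarrow> open (fst c) \<and> open (chart_im c) \<and>
     homeomorphism (fst c) (chart_im c) (snd c) (chart_inv c)"

definition smooth_compatible :: "('a, 'n::finite) chart \<Rightarrow> ('a, 'n) chart \<Rightarrow> bool"
  where "smooth_compatible c d \<longleftrightarrow>
     smooth_on (snd d \<circ> chart_inv c) (snd c ` (fst c \<inter> fst d)) \<and>
     smooth_on (snd c \<circ> chart_inv d) (snd d ` (fst c \<inter> fst d))"

text \<open>A smooth structure is a maximal smooth atlas, so its elements are all the
  coordinate charts of the manifold.\<close>

definition smooth_structure :: "('a::topological_space, 'n::finite) chart set \<Rightarrow> bool"
  where "smooth_structure A \<longleftrightarrow>
     (\<forall>c\<in>A. is_chart c) \<and> (\<Union>c\<in>A. fst c) = UNIV \<and>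
     (\<forall>c\<in>A. \<forall>d\<in>A. smooth_compatible c d) \<and>
     (\<forall>c. is_chart c \<and> (\<forall>d\<in>A. smooth_compatible c d) \<longrightarrow> c \<in> A)"


section \<open>Tangent vectors\<close>

text \<open>
  A tangent vector at \<open>x\<close> is the family of its coordinate representations in the charts
  around \<open>x\<close>, which transform by the differentials of the coordinate changes (and it is \<open>0\<close> at
  all other indices).  Thus \<open>v c\<close> is the image of \<open>v\<close> under the differential at \<open>x\<close> of the
  chart \<open>c\<close>, and the vector space operations are pointwise.
\<close>

type_synonym ('a, 'n) tangent = "('a, 'n) chart \<Rightarrow> real ^ 'n"

definition tangent_space ::
  "('a, 'n::finite) chart set \<Rightarrow> 'a \<Rightarrow> ('a, 'n) tangent set"
  where "tangent_space A x = {v.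
     (\<forall>c\<in>A. \<forall>d\<in>A. x \<in> fst c \<inter> fst d \<longrightarrow>
        v d = frechet_derivative (snd d \<circ> chart_inv c) (at (snd c x)) (v c)) \<and>
     (\<forall>c. \<not> (c \<in> A \<and> x \<in> fst c) \<longrightarrow> v c = 0)}"

abbreviation tangent_zero :: "('a, 'n::finite) tangent"
  where "tangent_zero \<equiv> \<lambda>_. 0"

text \<open>The differential at \<open>snd c x\<close> of the inverse of the chart \<open>c\<close>, applied to \<open>w\<close>.\<close>

definition tangent_of_coords ::
  "('a, 'n::finite) chart set \<Rightarrow> ('a, 'n) chart \<Rightarrow> 'a \<Rightarrow> real ^ 'n \<Rightarrow> ('a, 'n) tangent"
  where "tangent_of_coords A c x w = (\<lambda>d.
     if d \<in> A \<and> x \<in> fst d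
     then frechet_derivative (snd d \<circ> chart_inv c) (at (snd c x)) w else 0)"

text \<open>The differential at \<open>x\<close> of a real function, computed in some chart around \<open>x\<close>
  (by the chain rule, the choice of the chart does not matter).\<close>

definition differential ::
  "('a, 'n::finite) chart set \<Rightarrow> ('a \<Rightarrow> real) \<Rightarrow> 'a \<Rightarrow> ('a, 'n) tangent \<Rightarrow> real"
  where "differential A h x v =
     (let c = (SOME c. c \<in> A \<and> x \<in> fst c)
      in frechet_derivative (h \<circ> chart_inv c) (at (snd c x)) (v c))"

text \<open>For curves that are continuous at \<open>t\<close>, the velocity is unique and does not depend
  on the chart.\<close>

definition has_velocity ::
  "('a, 'n::finite) chart set \<Rightarrow> (real \<Rightarrow> 'a) \<Rightarrow> real \<Rightarrow> ('a, 'n) tangent \<Rightarrow> bool"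
  where "has_velocity A x t v \<longleftrightarrow> (\<exists>c\<in>A. x t \<in> fst c \<and>
     (\<exists>w. ((snd c \<circ> x) has_vector_derivative w) (at t) \<and> v = tangent_of_coords A c (x t) w))"

definition velocity ::
  "('a, 'n::finite) chart set \<Rightarrow> (real \<Rightarrow> 'a) \<Rightarrow> real \<Rightarrow> ('a, 'n) tangent"
  where "velocity A x t = (THE v. has_velocity A x t v)"


section \<open>Riemannian metrics and the Riemannian distance\<close>

type_synonym ('a, 'n) metric = "'a \<Rightarrow> ('a, 'n) tangent \<Rightarrow> ('a, 'n) tangent \<Rightarrow> real"

definition riemannian_metric :: "('a, 'n::finite) chart set \<Rightarrow> ('a, 'n) metric \<Rightarrow> bool"
  where "riemannian_metric A g \<longleftrightarrow>
     (\<forall>x. \<forall>v\<in>tangent_space A x. \<forall>w\<in>tangent_space A x. g x v w = g x w v) \<and>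
     (\<forall>x. \<forall>v\<in>tangent_space A x. \<forall>w\<in>tangent_space A x. \<forall>z\<in>tangent_space A x. \<forall>a b.
        g x (\<lambda>c. a *\<^sub>R v c + b *\<^sub>R w c) z = a * g x v z + b * g x w z) \<and>
     (\<forall>x. \<forall>v\<in>tangent_space A x. v \<noteq> tangent_zero \<longrightarrow> g x v v > 0) \<and>
     (\<forall>c\<in>A. \<forall>i j. smooth_on
        (\<lambda>z. g (chart_inv c z)
           (tangent_of_coords A c (chart_inv c z) (axis i 1))
           (tangent_of_coords A c (chart_inv c z) (axis j 1))) (chart_im c))"

definition riemannian_manifold ::
  "('a::{t2_space, second_countable_topology}, 'n::finite) chart set \<Rightarrow> ('a, 'n) metric \<Rightarrow> bool"
  where "riemannian_manifold A g \<longleftrightarrow> smooth_structure A \<and> riemannian_metric A g"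

definition tangent_norm :: "('a, 'n::finite) metric \<Rightarrow> 'a \<Rightarrow> ('a, 'n) tangent \<Rightarrow> real"
  where "tangent_norm g x v = sqrt (g x v v)"

definition C1_curve_on ::
  "('a::topological_space, 'n::finite) chart set \<Rightarrow> (real \<Rightarrow> 'a) \<Rightarrow> real set \<Rightarrow> bool"
  where "C1_curve_on A \<gamma> I \<longleftrightarrow> continuous_on I \<gamma> \<and>
     (\<forall>c\<in>A. \<exists>D.
        (\<forall>t\<in>I \<inter> \<gamma> -` fst c. ((snd c \<circ> \<gamma>) has_vector_derivative D t) (at t within I)) \<and>
        continuous_on (I \<inter> \<gamma> -` fst c) D)"

text \<open>The curve is \<open>C\<^sup>1\<close>, with one-sided derivatives at the ends, on each closed piece
  between consecutive points of the finite set \<open>S\<close>.\<close>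

definition piecewise_C1_curve ::
  "('a::topological_space, 'n::finite) chart set \<Rightarrow> (real \<Rightarrow> 'a) \<Rightarrow> bool"
  where "piecewise_C1_curve A \<gamma> \<longleftrightarrow> path \<gamma> \<and>
     (\<exists>S. finite S \<and> (\<forall>a b. 0 \<le> a \<and> a < b \<and> b \<le> 1 \<and> {a<..<b} \<inter> S = {} \<longrightarrow>
        C1_curve_on A \<gamma> {a..b}))"

definition curve_length ::
  "('a, 'n::finite) chart set \<Rightarrow> ('a, 'n) metric \<Rightarrow> (real \<Rightarrow> 'a) \<Rightarrow> real"
  where "curve_length A g \<gamma> = integral {0..1} (\<lambda>t. tangent_norm g (\<gamma> t) (velocity A \<gamma> t))"

definition riemannian_dist ::
  "('a::topological_space, 'n::finite) chart set \<Rightarrow> ('a, 'n) metric \<Rightarrow> 'a \<Rightarrow> 'a \<Rightarrow> real"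
  where "riemannian_dist A g x y =
     Inf {curve_length A g \<gamma> |\<gamma>. piecewise_C1_curve A \<gamma> \<and> pathstart \<gamma> = x \<and> pathfinish \<gamma> = y}"

definition complete_riemannian ::
  "('a::topological_space, 'n::finite) chart set \<Rightarrow> ('a, 'n) metric \<Rightarrow> bool"
  where "complete_riemannian A g \<longleftrightarrow> Metric_space.mcomplete UNIV (riemannian_dist A g)"


section \<open>Comparison functions\<close>

text \<open>Functions on \<open>[0,\<infinity>)\<close> are represented by functions on \<^typ>\<open>real\<close>, of which only the
  values at nonnegative arguments matter.\<close>

definition class_K :: "(real \<Rightarrow> real) \<Rightarrow> bool"
  where "class_K \<alpha> \<longleftrightarrow> continuous_on {0..} \<alpha> \<and> strict_mono_on {0..} \<alpha> \<and> \<alpha> 0 = 0"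

definition class_K_inf :: "(real \<Rightarrow> real) \<Rightarrow> bool"
  where "class_K_inf \<alpha> \<longleftrightarrow> class_K \<alpha> \<and> filterlim \<alpha> at_top at_top"

text \<open>Since \<open>\<beta> 0 t = 0\<close> for all \<open>t\<close>, the monotonicity in \<open>t\<close> can only be non-strict.\<close>

definition class_KL :: "(real \<Rightarrow> real \<Rightarrow> real) \<Rightarrow> bool"
  where "class_KL \<beta> \<longleftrightarrow> continuous_on ({0..} \<times> {0..}) (\<lambda>(s, t). \<beta> s t) \<and>
     (\<forall>t\<ge>0. class_K (\<lambda>s. \<beta> s t)) \<and>
     (\<forall>s\<ge>0. antimono_on {0..} (\<beta> s) \<and> (\<beta> s \<longlongrightarrow> 0) at_top)"


section \<open>Control systems\<close>

type_synonym ('a, 'n, 'm) control_system = "real \<Rightarrow> 'a \<Rightarrow> real ^ 'm \<Rightarrow> ('a, 'n) tangent"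

definition assumption_A ::
  "('a::topological_space, 'n::finite) chart set \<Rightarrow> ('a, 'n) metric \<Rightarrow> 'a \<Rightarrow>
   ('a, 'n, 'm::finite) control_system \<Rightarrow> bool"
  where "assumption_A A g xs f \<longleftrightarrow>
     (\<forall>x u. \<forall>c\<in>A. x \<in> fst c \<longrightarrow> (\<lambda>t. f t x u c) \<in> borel_measurable (lebesgue_on {0..})) \<and>
     (\<forall>t\<ge>0. \<forall>u. \<forall>c\<in>A. \<forall>z\<in>chart_im c. \<exists>e>0. \<exists>L.
        L-lipschitz_on (cball z e \<inter> chart_im c) (\<lambda>y. f t (chart_inv c y) u c)) \<and>
     (\<forall>t\<ge>0. \<forall>x. \<forall>c\<in>A. x \<in> fst c \<longrightarrow> continuous_on UNIV (\<lambda>u. f t x u c)) \<and>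
     (\<forall>R>0. \<forall>r>0. \<exists>I. (\<forall>b\<ge>0. set_integrable lebesgue {0..b} I) \<and>
        (AE t in lebesgue_on {0..}. \<forall>x u. riemannian_dist A g x xs \<le> R \<and> norm u \<le> r \<longrightarrow>
           tangent_norm g x (f t x u) \<le> I t))"

definition Linf_norm_from :: "real \<Rightarrow> (real \<Rightarrow> real ^ 'm::finite) \<Rightarrow> ereal"
  where "Linf_norm_from t0 u = esssup (lebesgue_on {t0..}) (\<lambda>t. ereal (norm (u t)))"

definition Linf :: "(real \<Rightarrow> real ^ 'm::finite) set"
  where "Linf = {u. u \<in> borel_measurable (lebesgue_on {0..}) \<and> Linf_norm_from 0 u < \<infinity>}"

definition abs_continuous_curve ::
  "('a::topological_space, 'n::finite) chart set \<Rightarrow> ('a, 'n) metric \<Rightarrow> (real \<Rightarrow> 'a) \<Rightarrow>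
   real \<Rightarrow> real \<Rightarrow> bool"
  where "abs_continuous_curve A g x a b \<longleftrightarrow>
     (\<exists>m. set_integrable lebesgue {a..b} m \<and>
        (\<forall>s t. a \<le> s \<and> s \<le> t \<and> t \<le> b \<longrightarrow>
           riemannian_dist A g (x s) (x t) \<le> (LINT \<tau>:{s..t}|lebesgue. m \<tau>)))"

definition is_solution ::
  "('a::topological_space, 'n::finite) chart set \<Rightarrow> ('a, 'n) metric \<Rightarrow>
   ('a, 'n, 'm::finite) control_system \<Rightarrow> (real \<Rightarrow> real ^ 'm) \<Rightarrow> real \<Rightarrow> ereal \<Rightarrow>
   (real \<Rightarrow> 'a) \<Rightarrow> bool"
  where "is_solution A g f u t0 T x \<longleftrightarrow>
     (\<forall>a b. t0 \<le> a \<and> a \<le> b \<and> ereal b < T \<longrightarrow> abs_continuous_curve A g x a b) \<and>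
     (AE t in lebesgue. t0 < t \<and> ereal t < T \<longrightarrow> has_velocity A x t (f t (x t) (u t)))"

definition is_maximal_solution ::
  "('a::topological_space, 'n::finite) chart set \<Rightarrow> ('a, 'n) metric \<Rightarrow>
   ('a, 'n, 'm::finite) control_system \<Rightarrow> (real \<Rightarrow> real ^ 'm) \<Rightarrow> real \<Rightarrow> ereal \<Rightarrow>
   (real \<Rightarrow> 'a) \<Rightarrow> bool"
  where "is_maximal_solution A g f u t0 T x \<longleftrightarrow>
     ereal t0 < T \<and> is_solution A g f u t0 T x \<and>
     \<not> (\<exists>T' x'. T < T' \<and> is_solution A g f u t0 T' x' \<and>
          (\<forall>t. t0 \<le> t \<and> ereal t < T \<longrightarrow> x' t = x t))"

definition globally_ISS ::
  "('a::topological_space, 'n::finite) chart set \<Rightarrow> ('a, 'n) metric \<Rightarrow> 'a \<Rightarrow>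
   ('a, 'n, 'm::finite) control_system \<Rightarrow> bool"
  where "globally_ISS A g xs f \<longleftrightarrow>
     (\<exists>\<beta> \<gamma>. class_KL \<beta> \<and> class_K \<gamma> \<and>
        (\<forall>t0\<ge>0. \<forall>u\<in>Linf. \<forall>T x. is_maximal_solution A g f u t0 T x \<longrightarrow>
           T = \<infinity> \<and>
           (\<forall>t\<ge>t0. riemannian_dist A g (x t) xs \<le>
              \<beta> (riemannian_dist A g (x t0) xs) (t - t0) +
              \<gamma> (real_of_ereal (Linf_norm_from t0 u)))))"


section \<open>Lyapunov functions\<close>

text \<open>\<open>C\<^sup>1\<close> on \<open>[0,\<infinity>)\<close> times the manifold, with one-sided time derivatives at \<open>0\<close>.\<close>

definition C1_time_space ::
  "('a, 'n::finite) chart set \<Rightarrow> (real \<Rightarrow> 'a \<Rightarrow> real) \<Rightarrow> bool"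
  where "C1_time_space A V \<longleftrightarrow>
     (\<forall>c\<in>A. \<exists>D :: real \<times> (real ^ 'n) \<Rightarrow> (real \<times> (real ^ 'n)) \<Rightarrow>\<^sub>L real.
        (\<forall>p\<in>{0..} \<times> chart_im c. ((\<lambda>(t, z). V t (chart_inv c z)) has_derivative
           blinfun_apply (D p)) (at p within {0..} \<times> chart_im c)) \<and>
        continuous_on ({0..} \<times> chart_im c) D)"

definition ISS_Lyapunov ::
  "('a::topological_space, 'n::finite) chart set \<Rightarrow> ('a, 'n) metric \<Rightarrow> 'a \<Rightarrow>
   ('a, 'n, 'm::finite) control_system \<Rightarrow> (real \<Rightarrow> 'a \<Rightarrow> real) \<Rightarrow>
   (real \<Rightarrow> real) \<Rightarrow> (real \<Rightarrow> real) \<Rightarrow> (real \<Rightarrow> real) \<Rightarrow> (real \<Rightarrow> real) \<Rightarrow> bool"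
  where "ISS_Lyapunov A g xs f V \<alpha>1 \<alpha>2 \<alpha>3 \<alpha>4 \<longleftrightarrow>
     C1_time_space A V \<and>
     class_K \<alpha>1 \<and> class_K \<alpha>2 \<and> class_K \<alpha>3 \<and> class_K \<alpha>4 \<and>
     (\<forall>r\<ge>0. \<alpha>1 r \<le> \<alpha>2 r) \<and>
     (\<forall>t\<ge>0. \<forall>x. \<alpha>1 (riemannian_dist A g x xs) \<le> V t x \<and>
                 V t x \<le> \<alpha>2 (riemannian_dist A g x xs)) \<and>
     (\<forall>t\<ge>0. \<forall>x u. \<alpha>4 (norm u) \<le> riemannian_dist A g x xs \<longrightarrow>
        vector_derivative (\<lambda>s. V s x) (at t within {0..}) + differential A (V t) x (f t x u)
          \<le> - \<alpha>3 (riemannian_dist A g x xs))"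

end

theory Submission
  imports Defs "HOL-Complex_Analysis.Great_Picard"
begin

text \<open>
  Along a trajectory the Lyapunov function \<open>W t = V t (x t)\<close> is locally absolutely continuous, and
  \<open>W' \<le> - \<alpha>3 (\<rho> x xs)\<close> almost everywhere on the set where \<open>\<rho> x xs\<close> is at least \<open>\<alpha>4\<close> of the
  input bound.  If \<open>W t = \<alpha>2 q\<close> is still above \<open>\<alpha>2 \<circ> \<alpha>4\<close> of that bound, then
  \<open>W\<close> was at least \<open>W t\<close> on the whole of \<open>[t0, t]\<close>, hence \<open>\<rho> x xs \<ge> q\<close> there, and integrating
  gives \<open>\<alpha>2 q + (t - t0) * \<alpha>3 q \<le> \<alpha>2 (\<rho> (x t0) xs)\<close>.  Up to a change of variables \<open>\<beta>\<close> is
  therefore the root of a monotone equation; no comparison ODE has to be solved.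

  A trajectory on a bounded time interval is then bounded, so its speed is dominated by an integrable
  function of time and, by completeness, it converges to a point at the end of the interval.  A
  Caratheodory solution in a chart around that point extends it, so maximal solutions are global.
\<close>

section \<open>Absolutely continuous functions and Caratheodory equations\<close>

text \<open>The obstacle is that \<open>\<rho>\<close> is an infimum of lengths and absolute
  continuity of a curve is phrased through \<open>\<rho>\<close> alone: the integrand that bounds
  the increments of a solution bears no relation to the vector field, and no chart is mentioned. A
  local comparison of \<open>\<rho>\<close> with coordinate distance bridges the gap in both
  directions. The estimate of \<open>\<rho>\<close> from below makes \<open>V t (x t)\<close>
  absolutely continuous; the one from above makes a solution found in coordinates absolutely
  continuous on the manifold. The unrelated integrand is then traded for true derivative bounds by
  an inequality for absolutely continuous functions that asks for these bounds only almost
  everywhere. It serves twice: for the decay of the Lyapunov function, and for bounding the distance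
  travelled by the integral of the speed. At the end of a bounded interval any continuation
  contradicts maximality, so local existence suffices, and it is obtained from compactness and
  dominated convergence.\<close>

text \<open>On the null set \<open>N\<close> both integrands may be taken to be \<open>0\<close>; Henstock's lemma then makes the
  total increment of \<open>W\<close> over the intervals of a fine division tagged in \<open>N\<close> small.\<close>

lemma AC_increment_le_integral:
  fixes W :: "real \<Rightarrow> real"
  assumes ab: "a \<le> b"
    and m: "m integrable_on {a..b}"
    and Wm: "\<And>s t. a \<le> s \<Longrightarrow> s \<le> t \<Longrightarrow> t \<le> b \<Longrightarrow> W t - W s \<le> integral {s..t} m"
    and N: "negligible N"
    and h: "h integrable_on {a..b}"
    and straddle: "\<And>t e. t \<in> {a..b} - N \<Longrightarrow> 0 < e \<Longrightarrow>
      \<exists>d>0. \<forall>u v. a \<le> u \<and> u \<le> t \<and> t \<le> v \<and> v \<le> b \<and> t - u < d \<and> v - t < d \<longrightarrow>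
        W v - W u \<le> (h t + e) * (v - u)"
  shows "W b - W a \<le> integral {a..b} h"
proof (rule field_le_epsilon)
  let ?c = "measure lborel"
  fix e0 :: real assume "0 < e0"
  \<comment> \<open>Three errors add up: \<open>e\<close> per unit length from the difference
    quotients, and \<open>e\<close> each from the Henstock sum of \<open>m0\<close> and the Riemann
    sum of \<open>h0\<close>.\<close>
  define e where "e = e0 / (b - a + 2)"
  have e: "0 < e" using \<open>0 < e0\<close> ab by (simp add: e_def)
  define m0 where "m0 t = (if t \<in> N then 0 else m t)" for t
  define h0 where "h0 t = (if t \<in> N then 0 else h t)" for t
  have m0: "m0 integrable_on S \<longleftrightarrow> m integrable_on S" "integral S m0 = integral S m" for S
    using integrable_spike[OF _ N, of m S m0] integrable_spike[OF _ N, of m0 S m] integral_spike[OF N, of S m m0]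
    by (auto simp: m0_def)
  have h0: "h0 integrable_on S \<longleftrightarrow> h integrable_on S" "integral S h0 = integral S h" for S
    using integrable_spike[OF _ N, of h S h0] integrable_spike[OF _ N, of h0 S h] integral_spike[OF N, of S h h0]
    by (auto simp: h0_def)
  obtain g1 where g1: "gauge g1" and g1': "\<And>p. \<lbrakk>p tagged_partial_division_of (cbox a b); g1 fine p\<rbrakk> \<Longrightarrow>
             sum (\<lambda>(x,k). norm(?c k *\<^sub>R m0 x - integral k m0)) p < e"
    using Henstock_lemma[of m0 a b e] m m0(1) e by auto
  have "(h0 has_integral integral {a..b} h) (cbox a b)"
    using h h0 by (metis box_real(2) integrable_integral)
  then obtain g2 where g2: "gauge g2" and g2': "\<And>p. \<lbrakk>p tagged_division_of (cbox a b); g2 fine p\<rbrakk> \<Longrightarrow>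
      norm (sum (\<lambda>(x,k). ?c k *\<^sub>R h0 x) p - integral {a..b} h) < e"
    using has_integralD[OF _ e] by metis
  have "\<exists>d>0. t \<in> {a..b} - N \<longrightarrow> (\<forall>u v. a \<le> u \<and> u \<le> t \<and> t \<le> v \<and> v \<le> b \<and> t - u < d \<and> v - t < d \<longrightarrow>
        W v - W u \<le> (h t + e) * (v - u))" for t
    using straddle[OF _ e] by (cases "t \<in> {a..b} - N") (auto intro: exI[of _ 1])
  then obtain d where d: "\<And>t. d t > 0" and d': "\<And>t u v. t \<in> {a..b} - N \<Longrightarrow> a \<le> u \<Longrightarrow> u \<le> t \<Longrightarrow> t \<le> v \<Longrightarrow> v \<le> b
       \<Longrightarrow> t - u < d t \<Longrightarrow> v - t < d t \<Longrightarrow> W v - W u \<le> (h t + e) * (v - u)"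
    by metis
  have g3: "gauge (\<lambda>t. ball t (d t))" using d by (simp add: gauge_ball_dependent)
  obtain p where p: "p tagged_division_of (cbox a b)" and fine: "(\<lambda>t. g1 t \<inter> (g2 t \<inter> ball t (d t))) fine p"
    using fine_division_exists[OF gauge_Int[OF g1 gauge_Int[OF g2 g3]]] by blast
  have f1: "g1 fine p" and f2: "g2 fine p" and f3: "(\<lambda>t. ball t (d t)) fine p"
    using fine by (auto simp: fine_def)
  note ptag = tagged_division_ofD[OF p]
  have p': "p tagged_partial_division_of (cbox a b)" using p by (simp add: tagged_division_of_def)
  have K: "(case z of (t,K) \<Rightarrow> W (Sup K) - W (Inf K)) \<le>
      (case z of (t,K) \<Rightarrow> ?c K *\<^sub>R h0 t + e * ?c K + norm (?c K *\<^sub>R m0 t - integral K m0))"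
    if zp: "z \<in> p" for z
  proof -
    obtain t K where z: "z = (t,K)" by force
    obtain u v where uv: "K = cbox u v" using ptag(4)[of t K] zp z by blast
    have tK: "t \<in> K" using ptag(2) that z by auto
    have uvle: "u \<le> t" "t \<le> v" using tK uv by auto
    have sub: "K \<subseteq> {a..b}" using ptag(3) that z by auto
    have ab': "a \<le> u" "v \<le> b" using sub uvle uv by auto
    have SI: "Sup K = v" "Inf K = u" "?c K = v - u" using uv uvle by auto
    have ball: "K \<subseteq> ball t (d t)" using f3 that z by (auto simp: fine_def)
    have close: "t - u < d t" "v - t < d t"
      using subsetD[OF ball, of u] subsetD[OF ball, of v] uv uvle by (auto simp: dist_real_def)
    show ?thesis
    proof (cases "t \<in> N")
      case False
      then have "W v - W u \<le> (h t + e) * (v - u)"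
        using d'[of t u v] ab' uvle close by auto
      also have "\<dots> = ?c K *\<^sub>R h0 t + e * ?c K"
        by (simp add: h0_def False SI(3) distrib_right mult.commute ring_distribs del: measure_lborel_cbox_eq content_real_if content_real)
      finally show ?thesis using SI z by (smt (verit) case_prod_conv norm_ge_zero)
    next
      \<comment> \<open>At a tag in \<open>N\<close> the value of \<open>m0\<close> is
        \<open>0\<close>, so the increment of \<open>W\<close> over \<open>K\<close> is at most the
        Henstock error of \<open>m0\<close> there.\<close>
      case True
      have "W v - W u \<le> integral K m"
        using Wm[of u v] ab' uvle uv by auto
      also have "\<dots> \<le> norm (?c K *\<^sub>R m0 t - integral K m0)"
        using True m0(2) by (simp add: m0_def)
      moreover have "0 \<le> e * ?c K" using e by simp
      ultimately show ?thesis using SI z True by (simp add: h0_def)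
    qed
  qed
  have "W b - W a = (\<Sum>(t,K)\<in>p. W (Sup K) - W (Inf K))"
    using additive_tagged_division_1[OF ab, of p W] p by simp
  also have "\<dots> \<le> (\<Sum>(t,K)\<in>p. ?c K *\<^sub>R h0 t + e * ?c K + norm (?c K *\<^sub>R m0 t - integral K m0))"
    by (rule sum_mono) (use K in blast)
  also have "\<dots> = (\<Sum>(t,K)\<in>p. ?c K *\<^sub>R h0 t) + (\<Sum>(t,K)\<in>p. e * ?c K)
      + (\<Sum>(t,K)\<in>p. norm (?c K *\<^sub>R m0 t - integral K m0))"
    by (simp add: sum.distrib case_prod_unfold)
  also have "(\<Sum>(t,K)\<in>p. e * ?c K) = e * (b - a)"
    using additive_content_tagged_division[OF p] ab
    by (simp add: case_prod_unfold sum_distrib_left[symmetric])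
  also have "(\<Sum>(t,K)\<in>p. norm (?c K *\<^sub>R m0 t - integral K m0)) \<le> e"
    using g1'[OF p' f1] by simp
  also have "(\<Sum>(t,K)\<in>p. ?c K *\<^sub>R h0 t) \<le> integral {a..b} h + e"
    using g2'[OF p f2] by (simp add: abs_less_iff real_norm_def)
  finally have "W b - W a \<le> integral {a..b} h + e * (b - a + 2)"
    by (simp add: algebra_simps)
  then show "W b - W a \<le> integral {a..b} h + e0"
    using ab by (simp add: e_def)
qed

lemma integrable_on_interval_locally:
  fixes f :: "real \<Rightarrow> 'b::banach"
  assumes ab: "a \<le> b"
    and loc: "\<And>t. t \<in> {a..b} \<Longrightarrow>
      \<exists>e>0. \<forall>u v. a \<le> u \<and> u \<le> t \<and> t \<le> v \<and> v \<le> b \<and> v - u < e \<longrightarrow> f integrable_on {u..v}"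
  shows "f integrable_on {a..b}"
proof -
  define lo hi where "lo = a" and "hi = b"
  have "lo \<le> a \<and> b \<le> hi \<longrightarrow> f integrable_on {a..b}"
    using ab
  proof (induction rule: Bolzano)
    case (trans u v w)
    then show ?case using Henstock_Kurzweil_Integration.integrable_combine[of u v w f] by auto
  next
    case (local x)
    then show ?case using loc[of x] unfolding lo_def hi_def by (metis atLeastAtMost_iff)
  qed
  then show ?thesis by (simp add: lo_def hi_def)
qed

lemma integral_increment:
  fixes f :: "real \<Rightarrow> 'b::banach"
  assumes "f integrable_on {a..b}" "a \<le> s" "s \<le> t" "t \<le> b"
  shows "integral {a..t} f - integral {a..s} f = integral {s..t} f"
  using Henstock_Kurzweil_Integration.integral_combine[of a s t f] assms
    integrable_subinterval_real[of f a b a t] by (auto simp: algebra_simps)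

text \<open>Henstock's lemma makes the intervals on which the difference quotients stay away from
  \<open>f t\<close> small in total; the exceptional set is covered by them in the sense of Vitali.\<close>

lemma indefinite_integral_has_vector_derivative_ae:
  fixes f :: "real \<Rightarrow> 'b::euclidean_space"
  assumes f: "f integrable_on {a..b}"
  shows "negligible {t \<in> {a<..<b}. \<not> ((\<lambda>x. integral {a..x} f) has_vector_derivative f t) (at t)}"
proof -
  define F where "F x = integral {a..x} f" for x
  \<comment> \<open>\<open>E n\<close> collects the failures of tolerance \<open>1 / Suc n\<close>
    on arbitrarily short intervals around \<open>t\<close>; a point outside all of these sets has
    derivative \<open>f t\<close>.\<close>
  define E where "E n = {t \<in> {a<..<b}. \<forall>d>0. \<exists>u v. a \<le> u \<and> u \<le> t \<and> t \<le> v \<and> v \<le> b \<and> u < v \<and> v - u < d \<and>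
      norm (F v - F u - (v - u) *\<^sub>R f t) > (v - u) / Suc n}" for n :: nat
  have Fd: "F v - F u = integral {u..v} f" if "a \<le> u" "u \<le> v" "v \<le> b" for u v
    using integral_increment[OF f that] by (simp add: F_def)
  let ?c = "measure lborel" and ?\<mu> = "measure lebesgue"
  have neg: "negligible (E n)" for n
    unfolding negligible_outer_le
  proof (intro allI impI)
    fix e :: real assume "0 < e"
    \<comment> \<open>A bad interval is shorter than \<open>Suc n\<close> times its Henstock error,
      whence the denominator.\<close>
    define e1 where "e1 = e / Suc n"
    have e1: "0 < e1" using \<open>0 < e\<close> by (simp add: e1_def)
    obtain g where g: "gauge g" and g': "\<And>p. \<lbrakk>p tagged_partial_division_of (cbox a b); g fine p\<rbrakk> \<Longrightarrow>
             sum (\<lambda>(x,k). norm(?c k *\<^sub>R f x - integral k f)) p < e1"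
      using Henstock_lemma[of f a b e1] f e1 by auto
    have "\<exists>d>0. ball t d \<subseteq> g t" for t
      using g by (metis gauge_def openE)
    then obtain d where d: "\<And>t. 0 < d t" and dg: "\<And>t. ball t (d t) \<subseteq> g t" by metis
    define K where "K = {(t,u,v). t \<in> {a<..<b} \<and> a \<le> u \<and> u \<le> t \<and> t \<le> v \<and> v \<le> b \<and> u < v \<and> v - u < d t \<and>
      norm (F v - F u - (v - u) *\<^sub>R f t) > (v - u) / Suc n}"
    \<comment> \<open>Vitali's theorem is about balls, so each interval is encoded by its midpoint
      and half-length, independently of where its tag \<open>t\<close> lies.\<close>
    define c where "c = (\<lambda>(t::real,u::real,v::real). (u + v) / 2)"
    define r where "r = (\<lambda>(t::real,u::real,v::real). (v - u) / 2)"
    let ?B = "\<lambda>i. cball (c i) (r i)"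
    have cb: "?B (t,u,v) = {u..v}" for t u v
      by (simp add: c_def r_def cball_eq_atLeastAtMost field_simps)
    obtain C where C: "countable C" "C \<subseteq> K"
      and disj: "pairwise (\<lambda>i j. disjnt (?B i) (?B j)) C"
      and negE: "negligible (E n - (\<Union>i\<in>C. ?B i))"
    proof (rule Vitali_covering_theorem_cballs[of K r "E n" c])
      show "0 < r i" if "i \<in> K" for i using that by (auto simp: K_def r_def)
      show "\<exists>i. i \<in> K \<and> x \<in> ?B i \<and> r i < \<delta>" if x: "x \<in> E n" and "0 < \<delta>" for x \<delta>
      proof -
        have "0 < min (d x) \<delta>" using d \<open>0 < \<delta>\<close> by simp
        then obtain u v where uv: "a \<le> u" "u \<le> x" "x \<le> v" "v \<le> b" "u < v" "v - u < min (d x) \<delta>"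
          "norm (F v - F u - (v - u) *\<^sub>R f x) > (v - u) / Suc n"
          using x unfolding E_def by blast
        have "(x,u,v) \<in> K" using uv x by (auto simp: K_def E_def)
        moreover have "x \<in> ?B (x,u,v)" using uv by (simp add: cb)
        moreover have "r (x,u,v) < \<delta>" using uv by (simp add: r_def)
        ultimately show ?thesis by (intro exI[of _ "(x,u,v)"] conjI)
      qed
    qed
    \<comment> \<open>Disjointness turns finitely many bad intervals into a tagged partial division
      finer than \<open>g\<close>, to which Henstock's lemma applies; the countable union is then
      exhausted by finite ones.\<close>
    have fin: "?\<mu> (\<Union>i\<in>D. ?B i) \<le> e" if D: "D \<subseteq> C" "finite D" for D
    proof -
      define p where "p = (\<lambda>(t,u,v). (t,{u..v})) ` D"
      have DK: "D \<subseteq> K" using D C by auto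
      have inj: "inj_on (\<lambda>(t,u,v). (t,{u..v})) D"
        using DK by (auto simp: inj_on_def K_def)
      have int0: "interior {u..v} \<inter> interior {u'..v'} = {}"
        if "(t,u,v) \<in> D" "(t',u',v') \<in> D" "(t,{u..v}) \<noteq> (t',{u'..v'})" for t u v t' u' v'
      proof -
        have "(t,u,v) \<noteq> (t',u',v')" using that by auto
        then have "disjnt {u..v} {u'..v'}"
          using disj that D unfolding pairwise_def by (metis cb subsetD)
        moreover have "interior {u..v} \<inter> interior {u'..v'} \<subseteq> {u..v} \<inter> {u'..v'}"
          by (intro Int_mono interior_subset)
        ultimately show ?thesis by (simp add: disjnt_def)
      qed
      have "p tagged_partial_division_of (cbox a b)"
        unfolding tagged_partial_division_of_def
      proof (intro conjI allI impI; (elim conjE)?)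
        show "finite p" using D by (simp add: p_def)
      next
        fix x k assume "(x,k) \<in> p"
        then obtain u v where "(x,u,v) \<in> D" and k: "k = {u..v}" by (auto simp: p_def)
        then have "(x,u,v) \<in> K" using DK by blast
        then have "a \<le> u" "u \<le> x" "x \<le> v" "v \<le> b" by (auto simp: K_def)
        then show "x \<in> k" "k \<subseteq> cbox a b" "\<exists>a b. k = cbox a b"
          using k by (auto intro: exI[of _ u] exI[of _ v])
      next
        fix x1 k1 x2 k2 assume "(x1,k1) \<in> p" "(x2,k2) \<in> p" and ne: "(x1,k1) \<noteq> (x2,k2)"
        then obtain u1 v1 u2 v2 where "(x1,u1,v1) \<in> D" "k1 = {u1..v1}" "(x2,u2,v2) \<in> D" "k2 = {u2..v2}"
          by (auto simp: p_def)
        then show "interior k1 \<inter> interior k2 = {}" using int0 ne by metis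
      qed
      moreover have "g fine p"
      proof -
        have "{u..v} \<subseteq> g t" if "(t,u,v) \<in> D" for t u v
        proof -
          have "(t,u,v) \<in> K" using that DK by auto
          then have "{u..v} \<subseteq> ball t (d t)" by (auto simp: K_def dist_real_def)
          then show ?thesis using dg by blast
        qed
        then show ?thesis by (auto simp: fine_def p_def)
      qed
      ultimately have less: "sum (\<lambda>(x,k). norm(?c k *\<^sub>R f x - integral k f)) p < e1" by (rule g')
      have "?\<mu> (\<Union>i\<in>D. ?B i) \<le> (\<Sum>i\<in>D. ?\<mu> (?B i))"
        by (rule measure_UNION_le) (use D in auto)
      also have "\<dots> = (\<Sum>(t,u,v)\<in>D. v - u)"
        using DK by (intro sum.cong refl) (auto simp: cb K_def)
      also have "\<dots> \<le> (\<Sum>(t,u,v)\<in>D. Suc n * norm (?c {u..v} *\<^sub>R f t - integral {u..v} f))"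
      proof (rule sum_mono)
        fix i assume "i \<in> D"
        obtain t u v where i: "i = (t,u,v)" by (metis prod_cases3)
        have "(t,u,v) \<in> K" using \<open>i \<in> D\<close> i DK by auto
        then have *: "a \<le> u" "u < v" "v \<le> b" "(v - u) / Suc n < norm (F v - F u - (v - u) *\<^sub>R f t)"
          by (auto simp: K_def)
        then have "(v - u) \<le> Suc n * norm (?c {u..v} *\<^sub>R f t - integral {u..v} f)"
          using Fd[of u v] by (simp add: field_simps norm_minus_commute)
        then show "(case i of (t,u,v) \<Rightarrow> v - u) \<le> (case i of (t,u,v) \<Rightarrow>
           Suc n * norm (?c {u..v} *\<^sub>R f t - integral {u..v} f))" using i by simp
      qed
      also have "\<dots> = Suc n * sum (\<lambda>(x,k). norm(?c k *\<^sub>R f x - integral k f)) p"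
        unfolding p_def by (subst sum.reindex[OF inj]) (simp add: sum_distrib_left case_prod_unfold)
      also have "\<dots> \<le> Suc n * e1" using less by (intro mult_left_mono) auto
      finally show ?thesis by (simp add: e1_def)
    qed
    let ?U = "\<Union>i\<in>C. ?B i"
    have sub: "?U \<subseteq> cbox a b" using C(2) by (auto simp: K_def cb)
    have U: "?U \<in> sets lebesgue" using C(1) by (intro sets.countable_UN'') auto
    have Ul: "?U \<in> lmeasurable"
      using sub U by (metis bounded_cbox bounded_subset bounded_set_imp_lmeasurable)
    have "?\<mu> ?U \<le> e"
    proof (rule field_le_epsilon)
      fix e' :: real assume "0 < e'"
      obtain D' where "D' \<subseteq> ?B ` C" "finite D'"
        and D': "?\<mu> (\<Union>(?B ` C)) - e' < ?\<mu> (\<Union>D')"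
      proof (rule measure_countable_Union_approachable[of "?B ` C" e' e])
        fix D'' assume "D'' \<subseteq> ?B ` C" "finite D''"
        then obtain D where "D \<subseteq> C" "finite D" "D'' = ?B ` D"
          by (meson finite_subset_image)
        then show "?\<mu> (\<Union>D'') \<le> e" using fin by blast
      qed (use C \<open>0 < e'\<close> in auto)
      then obtain D where "D \<subseteq> C" "finite D" "D' = ?B ` D"
        by (meson finite_subset_image)
      then show "?\<mu> ?U \<le> e + e'" using fin[of D] D' by simp
    qed
    moreover have "?\<mu> (?U \<union> (E n - ?U)) = ?\<mu> ?U"
      using U negE by (intro measure_Un_null_set) (auto simp: negligible_iff_null_sets)
    moreover have "?U \<union> (E n - ?U) \<in> lmeasurable"
      using Ul negligible_imp_measurable[OF negE] by (rule fmeasurable.Un)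
    ultimately show "\<exists>T. E n \<subseteq> T \<and> T \<in> lmeasurable \<and> ?\<mu> T \<le> e"
      by (intro exI[of _ "?U \<union> (E n - ?U)"]) auto
  qed
  have "negligible (\<Union>n. E n)" using neg by (intro negligible_countable_Union) auto
  then show ?thesis
  proof (rule negligible_subset, clarify)
    fix t assume t: "t \<in> {a<..<b}" and nd: "\<not> ((\<lambda>x. integral {a..x} f) has_vector_derivative f t) (at t)"
    show "t \<in> (\<Union>n. E n)"
    proof (rule ccontr)
      assume "t \<notin> (\<Union>n. E n)"
      then have *: "\<exists>d>0. \<forall>u v. a \<le> u \<and> u \<le> t \<and> t \<le> v \<and> v \<le> b \<and> u < v \<and> v - u < d \<longrightarrow>
        norm (F v - F u - (v - u) *\<^sub>R f t) \<le> (v - u) / Suc n" for n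
      proof -
        have "t \<notin> E n" using \<open>t \<notin> (\<Union>n. E n)\<close> by blast
        then show ?thesis using t unfolding E_def mem_Collect_eq by (metis linorder_not_less)
      qed
      have "(F has_derivative (\<lambda>h. h *\<^sub>R f t)) (at t)"
        unfolding has_derivative_at_alt
      proof (intro conjI allI impI)
        show "bounded_linear (\<lambda>h. h *\<^sub>R f t)" by (rule bounded_linear_scaleR_left)
        fix \<epsilon> :: real assume "0 < \<epsilon>"
        then obtain n where n: "1 / Suc n < \<epsilon>" using nat_approx_posE by blast
        obtain d where d: "d > 0" and d': "\<And>u v. a \<le> u \<Longrightarrow> u \<le> t \<Longrightarrow> t \<le> v \<Longrightarrow> v \<le> b \<Longrightarrow> u < v \<Longrightarrow> v - u < d \<Longrightarrow>
          norm (F v - F u - (v - u) *\<^sub>R f t) \<le> (v - u) / Suc n" using *[of n] by metis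
        have "norm (F y - F t - (y - t) *\<^sub>R f t) \<le> \<epsilon> * norm (y - t)"
          if y: "norm (y - t) < min d (min (t - a) (b - t))" for y
        proof -
          have ne: "norm (F y - F t - (y - t) *\<^sub>R f t) \<le> norm (y - t) / Suc n"
          proof (cases y t rule: linorder_cases)
            case less
            have "F y - F t - (y - t) *\<^sub>R f t = - (F t - F y - (t - y) *\<^sub>R f t)"
              by (simp add: algebra_simps)
            then have "norm (F y - F t - (y - t) *\<^sub>R f t) = norm (F t - F y - (t - y) *\<^sub>R f t)"
              by (simp only: norm_minus_cancel)
            then show ?thesis using d'[of y t] less y t by (auto simp: abs_if)
          next
            case greater
            then show ?thesis using d'[of t y] y t by (auto simp: abs_if)
          qed simp
          also have "\<dots> = 1 / Suc n * norm (y - t)" by simp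
          also have "\<dots> \<le> \<epsilon> * norm (y - t)" using n by (intro mult_right_mono) auto
          finally show ?thesis .
        qed
        then show "\<exists>d>0. \<forall>y. norm (y - t) < d \<longrightarrow> norm (F y - F t - (y - t) *\<^sub>R f t) \<le> \<epsilon> * norm (y - t)"
          using d t by (intro exI[of _ "min d (min (t - a) (b - t))"]) auto
      qed
      then show False using nd by (simp add: has_vector_derivative_def F_def[abs_def])
    qed
  qed
qed

text \<open>Subtract the first-order expansions at \<open>u\<close> and \<open>v\<close>; the errors
  add up to \<open>e * (v - u)\<close> because \<open>t\<close> lies between the two points.\<close>

lemma straddle:
  fixes f :: "real \<Rightarrow> 'b::real_normed_vector"
  assumes "(f has_vector_derivative w) (at t)" "0 < e"
  shows "\<exists>d>0. \<forall>u v. u \<le> t \<and> t \<le> v \<and> t - u < d \<and> v - t < d \<longrightarrow> norm (f v - f u - (v - u) *\<^sub>R w) \<le> e * (v - u)"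
proof -
  obtain d where d: "0 < d" and d': "\<And>y. norm (y - t) < d \<Longrightarrow> norm (f y - f t - (y - t) *\<^sub>R w) \<le> e * norm (y - t)"
    using assms unfolding has_vector_derivative_def has_derivative_at_alt by metis
  have "norm (f v - f u - (v - u) *\<^sub>R w) \<le> e * (v - u)" if "u \<le> t" "t \<le> v" "t - u < d" "v - t < d" for u v
  proof -
    have "f v - f u - (v - u) *\<^sub>R w = (f v - f t - (v - t) *\<^sub>R w) - (f u - f t - (u - t) *\<^sub>R w)"
      by (simp add: algebra_simps)
    also have "norm \<dots> \<le> e * norm (v - t) + e * norm (u - t)"
      by (rule order_trans[OF norm_triangle_ineq4]) (intro add_mono d', use that in auto)
    also have "\<dots> = e * (v - u)" using that by (simp add: algebra_simps)
    finally show ?thesis .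
  qed
  then show ?thesis using d by blast
qed

section \<open>Caratheodory integral equations with a right-hand side continuous in the
  state\<close>

lemma caratheodory_measurable:
  fixes F :: "'x \<Rightarrow> 'c::{metric_space, second_countable_topology} \<Rightarrow> 'b::{real_normed_vector, second_countable_topology}"
  assumes meas: "\<And>z. (\<lambda>t. F t z) \<in> borel_measurable M"
    and cont: "\<And>t. t \<in> space M \<Longrightarrow> continuous_on UNIV (F t)"
    and y: "y \<in> borel_measurable M"
  shows "(\<lambda>t. F t (y t)) \<in> borel_measurable M"
proof -
  \<comment> \<open>Along a simple function the composite is a finite sum of measurable functions
    \<open>F t c\<close> cut off to level sets; continuity in the state carries measurability to the
    limit.\<close>
  obtain s where s: "\<And>i. simple_function M (s i)" and lim: "\<And>t. t \<in> space M \<Longrightarrow> (\<lambda>i. s i t) \<longlonglongrightarrow> y t"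
    using borel_measurable_implies_sequence_metric[OF y, of undefined] by blast
  show ?thesis
  proof (rule borel_measurable_LIMSEQ_metric)
    fix i
    have "(\<lambda>t. \<Sum>c\<in>s i ` space M. indicator (s i -` {c} \<inter> space M) t *\<^sub>R F t c) \<in> borel_measurable M"
      using simple_functionD(2)[OF s[of i]] by (intro borel_measurable_sum borel_measurable_scaleR borel_measurable_indicator meas) auto
    also have "?this \<longleftrightarrow> (\<lambda>t. F t (s i t)) \<in> borel_measurable M"
    proof (rule measurable_cong)
      fix t assume t: "t \<in> space M"
      have "(\<Sum>c\<in>s i ` space M. indicator (s i -` {c} \<inter> space M) t *\<^sub>R F t c) =
        (\<Sum>c\<in>s i ` space M. if c = s i t then F t c else 0)"
        using t by (intro sum.cong) (auto simp: indicator_def)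
      also have "\<dots> = F t (s i t)" using t simple_functionD(1)[OF s[of i]] by simp
      finally show "(\<Sum>c\<in>s i ` space M. indicator (s i -` {c} \<inter> space M) t *\<^sub>R F t c) = F t (s i t)" .
    qed
    finally show "(\<lambda>t. F t (s i t)) \<in> borel_measurable M" .
  next
    fix t assume t: "t \<in> space M"
    show "(\<lambda>i. F t (s i t)) \<longlonglongrightarrow> F t (y t)"
      using cont[OF t] lim[OF t] by (auto intro: continuous_on_tendsto_compose)
  qed
qed

text \<open>Tonelli's method: with the delay \<open>h\<close>, the Picard iterates are stationary on \<open>{..a + j * h}\<close>
  from the \<open>j\<close>-th one on, so finitely many iterations solve the delayed equation exactly.\<close>

lemma delayed_integral_equation:
  fixes F :: "real \<Rightarrow> 'b::euclidean_space \<Rightarrow> 'b"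
  assumes h: "0 < h"
    and m: "m integrable_on {a..b}"
    and meas: "\<And>z. (\<lambda>t. F t z) \<in> borel_measurable (lebesgue_on {a..b})"
    and cont: "\<And>t. t \<in> {a..b} \<Longrightarrow> continuous_on UNIV (F t)"
    and bnd: "\<And>t z. t \<in> {a..b} \<Longrightarrow> norm (F t z) \<le> m t"
  shows "\<exists>y. continuous_on {..b} y \<and> (\<forall>t\<le>a. y t = \<eta>) \<and>
    (\<lambda>s. F s (y (s - h))) integrable_on {a..b} \<and>
    (\<forall>t\<le>b. y t = \<eta> + integral {a..t} (\<lambda>s. F s (y (s - h))))"
proof -
  define P where "P y t = \<eta> + integral {a..t} (\<lambda>s. F s (y (s - h)))" for y t
  define Y where "Y j = (P ^^ j) (\<lambda>_. \<eta>)" for j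
  have YS: "Y (Suc j) = P (Y j)" for j by (simp add: Y_def)
  have int: "(\<lambda>s. F s (y (s - h))) integrable_on {a..b}" if "continuous_on {..b} y" for y
  proof (rule measurable_bounded_by_integrable_imp_integrable[OF _ m])
    have "continuous_on {a..b} (\<lambda>s. y (s - h))"
      by (rule continuous_on_compose2[OF that]) (use h in \<open>auto intro!: continuous_intros\<close>)
    then have ym: "(\<lambda>s. y (s - h)) \<in> borel_measurable (lebesgue_on {a..b})"
      by (rule continuous_imp_measurable_on_sets_lebesgue) auto
    show "(\<lambda>s. F s (y (s - h))) \<in> borel_measurable (lebesgue_on {a..b})"
      by (rule caratheodory_measurable[where F = F and y = "\<lambda>s. y (s - h)", OF meas _ ym]) (use cont in auto)
  qed (use bnd in auto)
  have Pa: "P y t = \<eta>" if "t \<le> a" for y t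
    using that by (cases "t = a") (auto simp: P_def)
  have Pcont: "continuous_on {..b} (P y)" if "continuous_on {..b} y" for y
  proof (cases "a \<le> b")
    case True
    have "continuous_on ({..a} \<union> {a..b}) (P y)"
    proof (rule continuous_on_closed_Un)
      show "continuous_on {..a} (P y)"
        by (rule continuous_on_eq[of _ "\<lambda>_. \<eta>"]) (auto simp: Pa)
      show "continuous_on {a..b} (P y)"
        unfolding P_def by (intro continuous_intros indefinite_integral_continuous_1 int that)
    qed auto
    moreover have "{..a} \<union> {a..b} = {..b}" using True by auto
    ultimately show ?thesis by simp
  next
    case False
    then show ?thesis
      by (auto simp: Pa intro!: continuous_on_eq[OF continuous_on_const[of _ \<eta>]])
  qed
  have Ycont: "continuous_on {..b} (Y j)" for j
    by (induction j) (auto simp: YS Pcont, simp add: Y_def)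
  have stat: "Y (Suc j) t = Y j t" if "t \<le> a + j * h" for j t
    using that
  proof (induction j arbitrary: t)
    case 0
    then show ?case by (simp add: YS Pa) (simp add: Y_def)
  next
    case (Suc j)
    \<comment> \<open>For \<open>s \<le> t \<le> a + Suc j * h\<close> the delayed time
      \<open>s - h\<close> is at most \<open>a + j * h\<close>, where the induction hypothesis
      applies.\<close>
    have "integral {a..t} (\<lambda>s. F s (Y (Suc j) (s - h))) = integral {a..t} (\<lambda>s. F s (Y j (s - h)))"
      using Suc by (intro integral_cong) (auto simp: algebra_simps)
    then show ?case by (simp add: YS[of "Suc j"] YS[of j] P_def)
  qed
  obtain j :: nat where "(b - a) / h \<le> j" using real_arch_simple by blast
  then have j: "b \<le> a + j * h" using h by (simp add: field_simps)
  have "Y j t = P (Y j) t" if "t \<le> b" for t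
    using stat[of t j] j that by (simp add: YS)
  moreover have "Y j t = \<eta>" if "t \<le> a" for t
    using that by (cases j) (simp add: Y_def, simp add: YS Pa)
  ultimately show ?thesis
    using Ycont int[OF Ycont] by (intro exI[of _ "Y j"]) (auto simp: P_def)
qed

text \<open>Solutions with delays tending to \<open>0\<close> are equicontinuous, since their
  increments are dominated by those of the integral of \<open>m\<close>. A uniform limit of a
  subsequence satisfies the equation without delay by dominated convergence.\<close>

theorem caratheodory_existence:
  fixes F :: "real \<Rightarrow> 'b::euclidean_space \<Rightarrow> 'b"
  assumes ab: "a < b"
    and m: "m integrable_on {a..b}"
    and meas: "\<And>z. (\<lambda>t. F t z) \<in> borel_measurable (lebesgue_on {a..b})"
    and cont: "\<And>t. t \<in> {a..b} \<Longrightarrow> continuous_on UNIV (F t)"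
    and bnd: "\<And>t z. t \<in> {a..b} \<Longrightarrow> norm (F t z) \<le> m t"
  shows "\<exists>y. continuous_on {a..b} y \<and> (\<lambda>s. F s (y s)) integrable_on {a..b} \<and>
    (\<forall>t\<in>{a..b}. y t = \<eta> + integral {a..t} (\<lambda>s. F s (y s)))"
proof -
  define h where "h n = (b - a) / Suc n" for n :: nat
  have h: "0 < h n" for n using ab by (simp add: h_def)
  define Q where "Q n y \<longleftrightarrow> continuous_on {..b} y \<and> (\<forall>t\<le>a. y t = \<eta>) \<and>
    (\<lambda>s. F s (y (s - h n))) integrable_on {a..b} \<and>
    (\<forall>t\<le>b. y t = \<eta> + integral {a..t} (\<lambda>s. F s (y (s - h n))))" for n y
  have "\<exists>y. Q n y" for n
    unfolding Q_def by (rule delayed_integral_equation[OF h m meas cont bnd])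
  then obtain Y where "\<And>n. Q n (Y n)" by metis
  then have Ya: "\<And>n t. t \<le> a \<Longrightarrow> Y n t = \<eta>"
    and Yi: "\<And>n. (\<lambda>s. F s (Y n (s - h n))) integrable_on {a..b}"
    and Y: "\<And>n t. t \<le> b \<Longrightarrow> Y n t = \<eta> + integral {a..t} (\<lambda>s. F s (Y n (s - h n)))"
    unfolding Q_def by blast+
  define \<mu> where "\<mu> t = integral {a..t} m" for t
  have \<mu>c: "continuous_on {a..b} \<mu>"
    unfolding \<mu>_def by (rule indefinite_integral_continuous_1[OF m])
  have \<mu>d: "\<mu> t - \<mu> s = integral {s..t} m" if "a \<le> s" "s \<le> t" "t \<le> b" for s t
    using integral_increment[OF m that] by (simp add: \<mu>_def)
  have Yd: "norm (Y n t - Y n s) \<le> \<mu> t - \<mu> s" if st: "a \<le> s" "s \<le> t" "t \<le> b" for n s t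
  proof -
    let ?G = "\<lambda>s. F s (Y n (s - h n))"
    have "Y n t - Y n s = integral {s..t} ?G"
      using integral_increment[OF Yi st] st by (simp add: Y[of t n] Y[of s n])
    also have "norm \<dots> \<le> integral {s..t} m"
      using st bnd by (intro integral_norm_bound_integral integrable_subinterval_real[OF Yi] integrable_subinterval_real[OF m]) auto
    finally show ?thesis using \<mu>d[OF st] by simp
  qed
  have Yabs: "norm (Y n t - Y n s) \<le> \<bar>\<mu> t - \<mu> s\<bar>" if "s \<in> {a..b}" "t \<in> {a..b}" for n s t
  proof (cases "s \<le> t")
    case True
    then show ?thesis using Yd[of s t n] that by auto
  next
    case False
    then show ?thesis using Yd[of t s n] that by (auto simp: norm_minus_commute)
  qed
  obtain g k where gc: "continuous_on {a..b} g" and k: "strict_mono (k :: nat \<Rightarrow> nat)"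
    and unif: "\<And>e. 0 < e \<Longrightarrow> \<exists>N. \<forall>n x. n \<ge> N \<and> x \<in> {a..b} \<longrightarrow> norm (Y (k n) x - g x) < e"
  proof (rule Arzela_Ascoli[of "{a..b}" Y "norm \<eta> + \<mu> b"])
    fix n x assume x: "x \<in> {a..b}"
    have "norm (Y n x) \<le> norm (Y n a) + norm (Y n x - Y n a)" by norm
    also have "\<dots> \<le> norm \<eta> + \<mu> x" using Yd[of a x n] x Ya[of a n] by (simp add: \<mu>_def)
    also have "\<mu> x \<le> \<mu> b" using order_trans[OF norm_ge_zero Yd[of x b n]] x by simp
    finally show "norm (Y n x) \<le> norm \<eta> + \<mu> b" by simp
  next
    fix x e :: real assume "x \<in> {a..b}" "0 < e"
    then obtain d where "0 < d" and d: "\<And>y. y \<in> {a..b} \<Longrightarrow> dist y x < d \<Longrightarrow> dist (\<mu> y) (\<mu> x) < e"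
      using \<mu>c unfolding continuous_on_iff by metis
    then show "\<exists>d>0. \<forall>n y. y \<in> {a..b} \<and> norm (x - y) < d \<longrightarrow> norm (Y n x - Y n y) < e"
    proof (intro exI[of _ d] conjI allI impI \<open>0 < d\<close>)
      fix n y assume y: "y \<in> {a..b} \<and> norm (x - y) < d"
      have "norm (Y n x - Y n y) \<le> \<bar>\<mu> x - \<mu> y\<bar>" using Yabs[of y x n] y \<open>x \<in> {a..b}\<close> by simp
      also have "\<dots> < e" using d[of y] y by (simp add: dist_real_def abs_minus_commute)
      finally show "norm (Y n x - Y n y) < e" .
    qed
  qed auto
  have lim: "(\<lambda>n. Y (k n) x) \<longlonglongrightarrow> g x" if "x \<in> {a..b}" for x
    using unif that unfolding LIMSEQ_iff by blast
  have "(\<lambda>n. h n) \<longlonglongrightarrow> 0"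
    unfolding h_def using tendsto_mult[OF tendsto_const LIMSEQ_inverse_real_of_nat, of "b - a"]
    by (simp add: divide_inverse)
  then have h0: "(\<lambda>n. h (k n)) \<longlonglongrightarrow> 0"
    using LIMSEQ_subseq_LIMSEQ[OF _ k] by (auto simp: o_def)
  have delay: "(\<lambda>n. Y (k n) (x - h (k n))) \<longlonglongrightarrow> g x" if x: "x \<in> {a..b}" for x
  proof -
    \<comment> \<open>Delayed times may fall to the left of \<open>a\<close>, where \<open>Y\<close>
      is constantly \<open>\<eta>\<close>; clamping them to \<open>a\<close> keeps the value and
      brings them into the range of the estimate \<open>Yabs\<close>.\<close>
    define q where "q n = max a (x - h (k n))" for n
    have q: "q n \<in> {a..b}" for n using x h[of "k n"] ab by (auto simp: q_def)
    have "q \<longlonglongrightarrow> max a (x - 0)" unfolding q_def by (intro tendsto_intros h0)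
    then have "q \<longlonglongrightarrow> x" using x by (simp add: max_def)
    then have "(\<lambda>n. \<mu> (q n)) \<longlonglongrightarrow> \<mu> x"
      using \<mu>c q x by (auto intro: continuous_on_tendsto_compose)
    then have "(\<lambda>n. \<bar>\<mu> (q n) - \<mu> x\<bar>) \<longlonglongrightarrow> 0" by (auto intro!: tendsto_eq_intros)
    then have "(\<lambda>n. Y (k n) (q n) - Y (k n) x) \<longlonglongrightarrow> 0"
      by (rule Lim_null_comparison[rotated]) (use Yabs[OF x q] in auto)
    from tendsto_add[OF this lim[OF x]] have "(\<lambda>n. Y (k n) (q n)) \<longlonglongrightarrow> g x" by simp
    moreover have "Y (k n) (q n) = Y (k n) (x - h (k n))" for n
      by (simp add: q_def max_def Ya)
    ultimately show ?thesis by simp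
  qed
  have FL: "(\<lambda>n. F s (Y (k n) (s - h (k n)))) \<longlonglongrightarrow> F s (g s)" if "s \<in> {a..b}" for s
    using cont[OF that] delay[OF that] by (auto intro: continuous_on_tendsto_compose)
  have dom: "(\<lambda>s. F s (g s)) integrable_on {a..t}"
    "(\<lambda>n. integral {a..t} (\<lambda>s. F s (Y (k n) (s - h (k n))))) \<longlonglongrightarrow> integral {a..t} (\<lambda>s. F s (g s))"
    if t: "t \<in> {a..b}" for t
  proof -
    have 1: "(\<lambda>s. F s (Y (k n) (s - h (k n)))) integrable_on {a..t}" for n
      using t by (intro integrable_subinterval_real[OF Yi]) auto
    have 2: "m integrable_on {a..t}" using t by (intro integrable_subinterval_real[OF m]) auto
    have 3: "norm (F s (Y (k n) (s - h (k n)))) \<le> m s" if "s \<in> {a..t}" for n s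
      using bnd that t by auto
    have 4: "(\<lambda>n. F s (Y (k n) (s - h (k n)))) \<longlonglongrightarrow> F s (g s)" if "s \<in> {a..t}" for s
      using FL that t by auto
    show "(\<lambda>s. F s (g s)) integrable_on {a..t}"
      by (rule dominated_convergence(1)[OF 1 2 3 4])
    show "(\<lambda>n. integral {a..t} (\<lambda>s. F s (Y (k n) (s - h (k n))))) \<longlonglongrightarrow> integral {a..t} (\<lambda>s. F s (g s))"
      by (rule dominated_convergence(2)[OF 1 2 3 4])
  qed
  have "g t = \<eta> + integral {a..t} (\<lambda>s. F s (g s))" if t: "t \<in> {a..b}" for t
  proof (rule LIMSEQ_unique[OF lim[OF t]])
    have "(\<lambda>n. \<eta> + integral {a..t} (\<lambda>s. F s (Y (k n) (s - h (k n))))) \<longlonglongrightarrow> \<eta> + integral {a..t} (\<lambda>s. F s (g s))"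
      by (intro tendsto_intros dom t)
    then show "(\<lambda>n. Y (k n) t) \<longlonglongrightarrow> \<eta> + integral {a..t} (\<lambda>s. F s (g s))"
      using Y t by auto
  qed
  then show ?thesis using gc dom(1)[of b] ab by auto
qed

section \<open>Null sets and the essential bound of an input\<close>

lemma AE_lebesgue_iff_negligible: "(AE t in lebesgue. P t) \<longleftrightarrow> negligible {t :: real. \<not> P t}"
proof
  assume "AE t in lebesgue. P t"
  then obtain N where "N \<in> null_sets lebesgue" "{t. \<not> P t} \<subseteq> N"
    unfolding eventually_ae_filter by auto
  then show "negligible {t. \<not> P t}" using negligible_iff_null_sets negligible_subset by blast
next
  assume "negligible {t. \<not> P t}"
  then show "AE t in lebesgue. P t"
    unfolding eventually_ae_filter negligible_iff_null_sets by auto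
qed

lemma AE_lebesgue_on_iff_negligible:
  fixes S :: "real set"
  assumes "S \<in> sets lebesgue"
  shows "(AE t in lebesgue_on S. P t) \<longleftrightarrow> negligible {t \<in> S. \<not> P t}"
proof -
  have "(AE t in lebesgue_on S. P t) \<longleftrightarrow> (AE t in lebesgue. t \<in> S \<longrightarrow> P t)"
    using assms by (subst AE_restrict_space_iff) auto
  also have "\<dots> \<longleftrightarrow> negligible {t. \<not> (t \<in> S \<longrightarrow> P t)}" by (rule AE_lebesgue_iff_negligible)
  also have "{t. \<not> (t \<in> S \<longrightarrow> P t)} = {t \<in> S. \<not> P t}" by auto
  finally show ?thesis .
qed

text \<open>\<open>real_of_ereal\<close> sends infinite values to \<open>0\<close>, so the essential
  supremum has to be shown finite before its real value can bound the input.\<close>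

lemma Linf_norm_bound:
  assumes u: "u \<in> Linf" and t0: "0 \<le> t0"
  shows "0 \<le> real_of_ereal (Linf_norm_from t0 u)"
    "negligible {t \<in> {t0..}. \<not> norm (u t) \<le> real_of_ereal (Linf_norm_from t0 u)}"
proof -
  let ?L = "Linf_norm_from t0 u"
  have um: "u \<in> borel_measurable (lebesgue_on {0..})" and fin: "Linf_norm_from 0 u < \<infinity>"
    using u by (auto simp: Linf_def)
  have um': "u \<in> borel_measurable (lebesgue_on {t0..})"
    by (rule measurable_restrict_mono[OF um]) (use t0 in auto)
  have neg: "negligible {t \<in> {a..}. \<not> ereal (norm (u t)) \<le> Linf_norm_from a u}" for a
    using esssup_AE[of "\<lambda>t. ereal (norm (u t))" "lebesgue_on {a..}"]
    by (simp add: AE_lebesgue_on_iff_negligible Linf_norm_from_def)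
  have "?L \<le> Linf_norm_from 0 u"
    unfolding Linf_norm_from_def[of t0]
  proof (rule esssup_I)
    show "(\<lambda>t. ereal (norm (u t))) \<in> borel_measurable (lebesgue_on {t0..})" using um' by measurable
    have "negligible {t \<in> {t0..}. \<not> ereal (norm (u t)) \<le> Linf_norm_from 0 u}"
      by (rule negligible_subset[OF neg[of 0]]) (use t0 in auto)
    then show "AE t in lebesgue_on {t0..}. ereal (norm (u t)) \<le> Linf_norm_from 0 u"
      by (simp add: AE_lebesgue_on_iff_negligible)
  qed
  then have lt: "?L < \<infinity>" using fin by (rule order_le_less_trans)
  \<comment> \<open>A negative essential supremum would be exceeded at every time of a half-line,
    which is not negligible.\<close>
  have ge: "0 \<le> ?L"
  proof (rule ccontr)
    assume "\<not> 0 \<le> ?L"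
    then have "?L < ereal (norm (u t))" for t
      by (metis ereal_less_eq(5) less_le_trans norm_ge_zero not_le)
    then have "{t0<..} \<subseteq> {t \<in> {t0..}. \<not> ereal (norm (u t)) \<le> ?L}" by (auto simp: not_le)
    then have "negligible {t0<..}" by (rule negligible_subset[OF neg])
    moreover have "open {t0<..}" "{t0<..} \<noteq> {}" by auto
    ultimately show False using open_not_negligible by blast
  qed
  obtain r where r: "?L = ereal r" using lt ge by (cases ?L) auto
  show "0 \<le> real_of_ereal ?L" using ge by (rule real_of_ereal_pos)
  show "negligible {t \<in> {t0..}. \<not> norm (u t) \<le> real_of_ereal ?L}"
    using neg[of t0] r by simp
qed

section \<open>Comparison functions\<close>

lemma class_KD:
  assumes "class_K \<alpha>"
  shows "continuous_on {0..} \<alpha>" "\<And>x y. 0 \<le> x \<Longrightarrow> 0 \<le> y \<Longrightarrow> \<alpha> x < \<alpha> y \<longleftrightarrow> x < y"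
    "\<And>x y. 0 \<le> x \<Longrightarrow> 0 \<le> y \<Longrightarrow> \<alpha> x \<le> \<alpha> y \<longleftrightarrow> x \<le> y" "\<And>x. 0 \<le> x \<Longrightarrow> 0 \<le> \<alpha> x" "\<alpha> 0 = 0"
proof -
  show "continuous_on {0..} \<alpha>" and z: "\<alpha> 0 = 0" using assms by (auto simp: class_K_def)
  have sm: "\<alpha> x < \<alpha> y" if "0 \<le> x" "x < y" for x y
    using assms that by (auto simp: class_K_def strict_mono_on_def)
  show lt: "\<alpha> x < \<alpha> y \<longleftrightarrow> x < y" if "0 \<le> x" "0 \<le> y" for x y
    using sm[of x y] sm[of y x] that by (cases x y rule: linorder_cases) auto
  show le: "\<alpha> x \<le> \<alpha> y \<longleftrightarrow> x \<le> y" if "0 \<le> x" "0 \<le> y" for x y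
    using lt[of y x] that by (simp add: not_less[symmetric])
  show "0 \<le> \<alpha> x" if "0 \<le> x" for x using le[of 0 x] that z by simp
qed

text \<open>The left-hand side is strictly increasing in the root, so the sign of
  \<open>a c + t * \<theta> c - \<sigma> s\<close> tells on which side of \<open>c\<close> the root
  lies. Joint continuity follows because this sign is stable under small changes of \<open>s\<close>
  and \<open>t\<close>, monotonicity in \<open>t\<close> because the term with factor
  \<open>t\<close> is nonnegative, and decay because for fixed \<open>c > 0\<close> that term
  eventually exceeds \<open>\<sigma> s\<close>.\<close>

lemma class_KL_root:
  assumes a: "class_K_inf a" and \<theta>: "class_K \<theta>" and \<sigma>: "class_K \<sigma>"
  shows "\<exists>\<beta>. class_KL \<beta> \<and> (\<forall>s\<ge>0. \<forall>t\<ge>0. \<beta> s t \<ge> 0 \<and> a (\<beta> s t) + t * \<theta> (\<beta> s t) = \<sigma> s)"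
proof -
  define k where "k t b = a b + t * \<theta> b" for t b
  have K: "class_K a" using a by (simp add: class_K_inf_def)
  note ca = class_KD(1)[OF K] and c\<theta> = class_KD(1)[OF \<theta>] and c\<sigma> = class_KD(1)[OF \<sigma>]
  note a0 = class_KD(4)[OF K] and \<theta>0 = class_KD(4)[OF \<theta>] and \<sigma>0 = class_KD(4)[OF \<sigma>]
  note z = class_KD(5)[OF K] class_KD(5)[OF \<theta>] class_KD(5)[OF \<sigma>]
  have ma: "a x < a y" and m\<theta>: "\<theta> x < \<theta> y" and m\<sigma>: "\<sigma> x < \<sigma> y" if "0 \<le> x" "x < y" for x y
    using class_KD(2)[OF K] class_KD(2)[OF \<theta>] class_KD(2)[OF \<sigma>] that by auto
  have km: "k t x < k t y" if "0 \<le> t" "0 \<le> x" "x < y" for t x y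
    using ma[of x y] m\<theta>[of x y] that by (simp add: k_def add_less_le_mono mult_left_mono)
  have kc: "continuous_on {0..} (k t)" for t
    unfolding k_def by (intro continuous_intros ca c\<theta>)
  have root: "\<exists>b\<ge>0. k t b = \<sigma> s" if s: "0 \<le> s" and t: "0 \<le> t" for s t
  proof -
    have "eventually (\<lambda>b. \<sigma> s \<le> a b) at_top"
      using a by (auto simp: class_K_inf_def filterlim_at_top)
    then obtain b where b: "0 \<le> b" "\<sigma> s \<le> a b"
      by (metis (mono_tags, lifting) eventually_at_top_linorder linorder_linear order_refl)
    have "\<exists>x. 0 \<le> x \<and> x \<le> b \<and> k t x = \<sigma> s"
    proof (rule IVT')
      show "k t 0 \<le> \<sigma> s" using z \<sigma>0 s by (simp add: k_def)
      show "\<sigma> s \<le> k t b" using b \<theta>0[of b] t by (simp add: k_def add_increasing2)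
      show "continuous_on {0..b} (k t)" by (rule continuous_on_subset[OF kc]) auto
    qed (use b in auto)
    then show ?thesis by blast
  qed
  define \<beta> where "\<beta> s t = (SOME b. 0 \<le> b \<and> k t b = \<sigma> s)" for s t
  have \<beta>: "0 \<le> \<beta> s t" "k t (\<beta> s t) = \<sigma> s" if "0 \<le> s" "0 \<le> t" for s t
    using someI_ex[OF root[OF that, unfolded]] unfolding \<beta>_def by auto
  have less: "\<beta> s t < c" if "0 \<le> s" "0 \<le> t" "0 \<le> c" "\<sigma> s < k t c" for s t c
    using km[of t c "\<beta> s t"] \<beta>[of s t] that by (cases "c = \<beta> s t"; force)
  have greater: "c < \<beta> s t" if "0 \<le> s" "0 \<le> t" "0 \<le> c" "k t c < \<sigma> s" for s t c
    using km[of t "\<beta> s t" c] \<beta>[of s t] that by (cases "c = \<beta> s t"; force)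
  have cont: "continuous_on ({0..} \<times> {0..}) (\<lambda>(s, t). \<beta> s t)"
    unfolding continuous_on_def
  proof
    fix p :: "real \<times> real" assume p: "p \<in> {0..} \<times> {0..}"
    obtain s0 t0 where p0: "p = (s0,t0)" "0 \<le> s0" "0 \<le> t0" using p by (cases p) auto
    define c0 where "c0 = \<beta> s0 t0"
    have "continuous_on ({0..} \<times> {0..}) (\<lambda>p::real \<times> real. k (snd p) c - \<sigma> (fst p))" for c
      unfolding k_def by (intro continuous_intros continuous_on_compose2[OF c\<sigma>]) auto
    then have lim: "((\<lambda>p. k (snd p) c - \<sigma> (fst p)) \<longlongrightarrow> k t0 c - \<sigma> s0) (at p within {0..} \<times> {0..})" for c
      using p p0 unfolding continuous_on_def by fastforce
    have ev: "\<forall>\<^sub>F q in at p within {0..} \<times> {0..}. q \<in> {0..} \<times> {0..}"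
      by (simp add: eventually_at_filter)
    show "((\<lambda>(s, t). \<beta> s t) \<longlongrightarrow> (case p of (s, t) \<Rightarrow> \<beta> s t)) (at p within {0..} \<times> {0..})"
    proof (rule order_tendstoI)
      fix c assume c: "c < (case p of (s, t) \<Rightarrow> \<beta> s t)"
      show "\<forall>\<^sub>F q in at p within {0..} \<times> {0..}. c < (case q of (s, t) \<Rightarrow> \<beta> s t)"
      proof (cases "c < 0")
        case True
        show ?thesis using ev by eventually_elim (use True \<beta> in force)
      next
        case False
        then have "k t0 c - \<sigma> s0 < 0" using km[of t0 c "\<beta> s0 t0"] \<beta>[of s0 t0] p0 c by auto
        from order_tendstoD(2)[OF lim this] ev show ?thesis
          by eventually_elim (use False greater in force)
      qed
    next
      fix c assume c: "(case p of (s, t) \<Rightarrow> \<beta> s t) < c"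
      then have c0: "0 \<le> c" using \<beta>[of s0 t0] p0 by auto
      then have "0 < k t0 c - \<sigma> s0" using km[of t0 "\<beta> s0 t0" c] \<beta>[of s0 t0] p0 c by auto
      from order_tendstoD(1)[OF lim this] ev
      show "\<forall>\<^sub>F q in at p within {0..} \<times> {0..}. (case q of (s, t) \<Rightarrow> \<beta> s t) < c"
        by eventually_elim (use c0 less in force)
    qed
  qed
  have K\<beta>: "class_K (\<lambda>s. \<beta> s t)" if t: "0 \<le> t" for t
    unfolding class_K_def
  proof (intro conjI)
    have "continuous_on {0..} ((\<lambda>(s,t). \<beta> s t) \<circ> (\<lambda>s. (s,t)))"
      by (rule continuous_on_compose) (use t in \<open>auto intro!: continuous_intros continuous_on_subset[OF cont]\<close>)
    then show "continuous_on {0..} (\<lambda>s. \<beta> s t)" by (simp add: o_def)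
    show "strict_mono_on {0..} (\<lambda>s. \<beta> s t)"
    proof (rule strict_mono_onI)
      fix r s :: real assume "r \<in> {0..}" "s \<in> {0..}" "r < s"
      then show "\<beta> r t < \<beta> s t" using less[of r t "\<beta> s t"] \<beta>[of s t] m\<sigma>[of r s] t by auto
    qed
    show "\<beta> 0 t = 0" using \<beta>[of 0 t] km[of t 0 "\<beta> 0 t"] t z by (force simp: k_def)
  qed
  have anti: "antimono_on {0..} (\<beta> s)" if s: "0 \<le> s" for s
  proof (rule monotone_onI)
    fix t t' :: real assume t: "t \<in> {0..}" "t' \<in> {0..}" "t \<le> t'"
    have "k t (\<beta> s t) \<le> k t' (\<beta> s t)"
      using t \<theta>0[OF \<beta>(1)[of s t]] s by (auto simp: k_def intro: mult_right_mono)
    then have "\<not> k t' (\<beta> s t) < \<sigma> s" using \<beta>[of s t] s t by simp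
    then show "\<beta> s t' \<le> \<beta> s t" using km[of t' "\<beta> s t" "\<beta> s t'"] \<beta>[of s t'] \<beta>[of s t] s t by force
  qed
  have lim: "(\<beta> s \<longlongrightarrow> 0) at_top" if s: "0 \<le> s" for s
  proof (rule order_tendstoI)
    fix c :: real assume "c < 0"
    then show "\<forall>\<^sub>F t in at_top. c < \<beta> s t"
      by (intro eventually_mono[OF eventually_ge_at_top[of 0]]) (use \<beta> s in force)
  next
    fix c :: real assume c: "0 < c"
    have pos: "0 < \<theta> c" using m\<theta>[of 0 c] c z by simp
    show "\<forall>\<^sub>F t in at_top. \<beta> s t < c"
      using eventually_ge_at_top[of 0] eventually_gt_at_top[of "\<sigma> s / \<theta> c"]
    proof eventually_elim
      case (elim t)
      then have "\<sigma> s < k t c" using pos a0[of c] c by (simp add: k_def field_simps)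
      then show ?case using less s elim c by auto
    qed
  qed
  show ?thesis
    using cont K\<beta> anti lim \<beta> by (intro exI[of _ \<beta>]) (auto simp: class_KL_def k_def)
qed

text \<open>The slice \<open>t = 0\<close> of \<open>class_KL_root\<close>, with
  \<open>\<sigma>\<close> as a filler for \<open>\<theta>\<close>; in effect \<open>\<gamma>\<close>
  is the inverse of \<open>a\<close> composed with \<open>\<sigma>\<close>.\<close>

lemma class_K_inf_root:
  assumes "class_K_inf a" "class_K \<sigma>"
  shows "\<exists>\<gamma>. class_K \<gamma> \<and> (\<forall>s\<ge>0. \<gamma> s \<ge> 0 \<and> a (\<gamma> s) = \<sigma> s)"
proof -
  obtain \<beta> where \<beta>: "class_KL \<beta>" "\<forall>s\<ge>0. \<forall>t\<ge>0. \<beta> s t \<ge> 0 \<and> a (\<beta> s t) + t * \<sigma> (\<beta> s t) = \<sigma> s"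
    using class_KL_root[OF assms(1,2,2)] by blast
  have "\<beta> s 0 \<ge> 0 \<and> a (\<beta> s 0) = \<sigma> s" if "0 \<le> s" for s
    using \<beta>(2)[rule_format, OF that order_refl] by simp
  then show ?thesis
    by (intro exI[of _ "\<lambda>s. \<beta> s 0"]) (use \<beta>(1) in \<open>auto simp: class_KL_def\<close>)
qed

lemma class_K_id: "class_K (\<lambda>s. s)"
  by (auto simp: class_K_def strict_mono_on_def)

lemma class_K_compose:
  assumes "class_K \<alpha>" "class_K \<alpha>'" shows "class_K (\<lambda>s. \<alpha> (\<alpha>' s))"
  unfolding class_K_def
proof (intro conjI)
  show "continuous_on {0..} (\<lambda>s. \<alpha> (\<alpha>' s))"
    by (rule continuous_on_compose2[OF class_KD(1)[OF assms(1)] class_KD(1)[OF assms(2)]])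
      (use class_KD(4)[OF assms(2)] in auto)
  show "strict_mono_on {0..} (\<lambda>s. \<alpha> (\<alpha>' s))"
    by (rule strict_mono_onI) (use class_KD(2,4)[OF assms(1)] class_KD(2,4)[OF assms(2)] in auto)
  show "\<alpha> (\<alpha>' 0) = 0" using class_KD(5)[OF assms(1)] class_KD(5)[OF assms(2)] by simp
qed

lemma class_K_inf_surj:
  assumes "class_K_inf a" "0 \<le> y"
  shows "\<exists>q\<ge>0. a q = y"
  using class_K_inf_root[OF assms(1) class_K_id] assms(2) by blast

section \<open>Coordinates and the Riemannian norm\<close>

locale riemannian =
  fixes A :: "('a::{t2_space, second_countable_topology}, 'n::finite) chart set"
    and g :: "('a, 'n) metric"
  assumes RM: "riemannian_manifold A g"
begin

abbreviation "transition d c \<equiv> snd d \<circ> chart_inv c"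
abbreviation "dtransition d c x \<equiv> frechet_derivative (snd d \<circ> chart_inv c) (at (snd c x))"
abbreviation "\<rho> \<equiv> riemannian_dist A g"

lemma smooth: "smooth_structure A" and metric: "riemannian_metric A g"
  using RM by (auto simp: riemannian_manifold_def)

lemma
  shows atlas_chart: "c \<in> A \<Longrightarrow> is_chart c"
    and atlas_cover: "(\<Union>c\<in>A. fst c) = UNIV"
    and atlas_compatible: "c \<in> A \<Longrightarrow> d \<in> A \<Longrightarrow> smooth_compatible c d"
  using smooth unfolding smooth_structure_def by blast+

lemma ex_chart: "\<exists>c\<in>A. x \<in> fst c"
  using atlas_cover by blast

context
  fixes c assumes c: "c \<in> A"
begin

lemma chart: "is_chart c"
  using c by (rule atlas_chart)

lemma open_chart: "open (fst c)" and open_chart_im: "open (chart_im c)"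
  using chart by (auto simp: is_chart_def)

lemma chart_inv_chart: "x \<in> fst c \<Longrightarrow> chart_inv c (snd c x) = x"
  using chart by (auto simp: is_chart_def homeomorphism_def)

lemma chart_chart_inv: "z \<in> chart_im c \<Longrightarrow> snd c (chart_inv c z) = z"
  by (rule f_inv_into_f)

lemma chart_inv_in: "z \<in> chart_im c \<Longrightarrow> chart_inv c z \<in> fst c"
  by (rule inv_into_into)

lemma continuous_chart: "continuous_on (fst c) (snd c)"
  and continuous_chart_inv: "continuous_on (chart_im c) (chart_inv c)"
  using chart by (auto simp: is_chart_def homeomorphism_def)

lemma open_image_chart: assumes "open U" shows "open (snd c ` (fst c \<inter> U))"
proof -
  have "snd c ` (fst c \<inter> U) = chart_im c \<inter> chart_inv c -` U"
  proof (intro equalityI subsetI)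
    fix z assume "z \<in> chart_im c \<inter> chart_inv c -` U"
    then show "z \<in> snd c ` (fst c \<inter> U)"
      by (intro image_eqI[of _ _ "chart_inv c z"]) (auto simp: chart_chart_inv chart_inv_in)
  qed (auto simp: chart_inv_chart)
  then show ?thesis
    using continuous_open_preimage[OF continuous_chart_inv open_chart_im assms] by simp
qed

lemma chart_inv_image:
  assumes "Z \<subseteq> chart_im c"
  shows "x \<in> chart_inv c ` Z \<longleftrightarrow> x \<in> fst c \<and> snd c x \<in> Z"
proof
  assume "x \<in> chart_inv c ` Z"
  then show "x \<in> fst c \<and> snd c x \<in> Z" using assms chart_chart_inv chart_inv_in by auto
next
  assume "x \<in> fst c \<and> snd c x \<in> Z"
  then show "x \<in> chart_inv c ` Z" by (intro image_eqI[of _ _ "snd c x"]) (auto simp: chart_inv_chart)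
qed

lemma open_image_chart_inv: assumes "open Z" "Z \<subseteq> chart_im c" shows "open (chart_inv c ` Z)"
proof -
  have "chart_inv c ` Z = fst c \<inter> snd c -` Z" using chart_inv_image[OF assms(2)] by blast
  then show ?thesis
    using continuous_open_preimage[OF continuous_chart open_chart assms(1)] by simp
qed

end

lemma smooth_transition:
  assumes "c \<in> A" "d \<in> A"
  shows "smooth_on (transition d c) (snd c ` (fst c \<inter> fst d))"
  using atlas_compatible[OF assms] by (simp add: smooth_compatible_def)

lemma transition_has_derivative:
  assumes "c \<in> A" "d \<in> A" "x \<in> fst c" "x \<in> fst d"
  shows "(transition d c has_derivative dtransition d c x) (at (snd c x))"
proof -
  have "Ck_on 1 (transition d c) (snd c ` (fst c \<inter> fst d))"
    using smooth_transition[OF assms(1,2)] by (simp add: smooth_on_def)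
  then have "transition d c differentiable (at (snd c x))" using assms by auto
  then show ?thesis by (simp add: frechet_derivative_works)
qed

lemma dtransition_linear:
  assumes "c \<in> A" "d \<in> A" "x \<in> fst c" "x \<in> fst d"
  shows "linear (dtransition d c x)"
  using has_derivative_linear[OF transition_has_derivative[OF assms]] .

lemma continuous_dtransition:
  assumes "c \<in> A" "d \<in> A"
  shows "continuous_on (snd c ` (fst c \<inter> fst d)) (\<lambda>z. frechet_derivative (transition d c) (at z) w)"
proof -
  let ?S = "snd c ` (fst c \<inter> fst d)"
  have "Ck_on 1 (transition d c) ?S"
    using smooth_transition[OF assms] by (simp add: smooth_on_def)
  then have "continuous_on ?S (\<lambda>z. frechet_derivative (transition d c) (at z) i)" if "i \<in> Basis" for i
    using that by auto
  \<comment> \<open>\<open>Ck_on\<close> speaks of derivatives in basis directions only, so the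
    direction \<open>w\<close> is expanded in the basis.\<close>
  then have "continuous_on ?S (\<lambda>z. \<Sum>i\<in>Basis. (w \<bullet> i) *\<^sub>R frechet_derivative (transition d c) (at z) i)"
    by (intro continuous_intros) auto
  then show ?thesis
  proof (rule continuous_on_eq)
    fix z assume "z \<in> ?S"
    then obtain x where "x \<in> fst c" "x \<in> fst d" "z = snd c x" by auto
    then have lin: "linear (frechet_derivative (transition d c) (at z))"
      using dtransition_linear assms by simp
    have "frechet_derivative (transition d c) (at z) w =
        frechet_derivative (transition d c) (at z) (\<Sum>i\<in>Basis. (w \<bullet> i) *\<^sub>R i)"
      by (simp add: euclidean_representation)
    also have "\<dots> = (\<Sum>i\<in>Basis. (w \<bullet> i) *\<^sub>R frechet_derivative (transition d c) (at z) i)"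
      by (simp add: linear_sum[OF lin] linear_cmul[OF lin])
    finally show "(\<Sum>i\<in>Basis. (w \<bullet> i) *\<^sub>R frechet_derivative (transition d c) (at z) i) =
        frechet_derivative (transition d c) (at z) w" by simp
  qed
qed

text \<open>The chain rule, as two coordinate changes compose to the third near
  \<open>snd c x\<close>.\<close>

lemma dtransition_cocycle:
  assumes "c \<in> A" "d \<in> A" "e \<in> A" "x \<in> fst c" "x \<in> fst d" "x \<in> fst e"
  shows "dtransition e d x (dtransition d c x w) = dtransition e c x w"
proof -
  have 1: "(transition d c has_derivative dtransition d c x) (at (snd c x))"
    by (rule transition_has_derivative) fact+
  have "transition d c (snd c x) = snd d x" using assms by (simp add: chart_inv_chart)
  then have 2: "(transition e d has_derivative dtransition e d x) (at (transition d c (snd c x)))"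
    using transition_has_derivative[of d e x] assms by simp
  have "(transition e d \<circ> transition d c has_derivative dtransition e d x \<circ> dtransition d c x) (at (snd c x))"
    by (rule diff_chain_at[OF 1 2])
  then have "(transition e c has_derivative dtransition e d x \<circ> dtransition d c x) (at (snd c x))"
  proof (rule has_derivative_transform_within_open)
    show "open (snd c ` (fst c \<inter> fst d))" using assms by (intro open_image_chart open_chart)
    show "snd c x \<in> snd c ` (fst c \<inter> fst d)" using assms by auto
    show "(transition e d \<circ> transition d c) z = transition e c z" if "z \<in> snd c ` (fst c \<inter> fst d)" for z
      using that assms by (auto simp: chart_inv_chart)
  qed
  then have "dtransition e c x = dtransition e d x \<circ> dtransition d c x" by (rule frechet_derivative_at[symmetric])
  then show ?thesis by simp
qed

lemma dtransition_self:
  assumes "c \<in> A" "x \<in> fst c"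
  shows "dtransition c c x w = w"
proof -
  have "((\<lambda>z. z) has_derivative (\<lambda>z. z)) (at (snd c x))" by (rule has_derivative_ident)
  then have "(transition c c has_derivative (\<lambda>z. z)) (at (snd c x))"
    by (rule has_derivative_transform_within_open[OF _ open_chart_im[OF assms(1)]])
      (use assms in \<open>auto simp: chart_inv_chart\<close>)
  then have "dtransition c c x = (\<lambda>z. z)" by (rule frechet_derivative_at[symmetric])
  then show ?thesis by simp
qed

lemma tangent_of_coords_self:
  "c \<in> A \<Longrightarrow> x \<in> fst c \<Longrightarrow> tangent_of_coords A c x w c = w"
  by (simp add: tangent_of_coords_def dtransition_self)

lemma tangent_of_coords_in:
  assumes "c \<in> A" "x \<in> fst c"
  shows "tangent_of_coords A c x w \<in> tangent_space A x"
  using dtransition_cocycle[OF assms(1) _ _ assms(2)] by (simp add: tangent_space_def tangent_of_coords_def)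

lemma tangent_of_coords_of_tangent:
  assumes "c \<in> A" "x \<in> fst c" "v \<in> tangent_space A x"
  shows "tangent_of_coords A c x (v c) = v"
proof
  fix d
  have v: "\<And>c d. c \<in> A \<Longrightarrow> d \<in> A \<Longrightarrow> x \<in> fst c \<inter> fst d \<Longrightarrow> v d = dtransition d c x (v c)"
    "\<And>d. \<not> (d \<in> A \<and> x \<in> fst d) \<Longrightarrow> v d = 0"
    using assms(3) unfolding tangent_space_def by blast+
  show "tangent_of_coords A c x (v c) d = v d"
    using v(1)[OF assms(1), of d] v(2)[of d] assms(2) by (simp add: tangent_of_coords_def)
qed

lemma tangent_of_coords_change:
  assumes "c \<in> A" "d \<in> A" "x \<in> fst c" "x \<in> fst d"
  shows "tangent_of_coords A d x (dtransition d c x w) = tangent_of_coords A c x w"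
  using dtransition_cocycle[OF assms(1,2) _ assms(3,4)] by (intro ext) (simp add: tangent_of_coords_def)

lemma tangent_of_coords_linear:
  assumes "c \<in> A" "x \<in> fst c"
  shows "tangent_of_coords A c x (a *\<^sub>R v + b *\<^sub>R w) =
    (\<lambda>e. a *\<^sub>R tangent_of_coords A c x v e + b *\<^sub>R tangent_of_coords A c x w e)"
  using linear_add[OF dtransition_linear[OF assms(1) _ assms(2)]] linear_cmul[OF dtransition_linear[OF assms(1) _ assms(2)]]
  by (intro ext) (simp add: tangent_of_coords_def)

section \<open>The Riemannian norm in coordinates\<close>

definition coord_norm :: "('a, 'n) chart \<Rightarrow> real ^ 'n \<Rightarrow> real ^ 'n \<Rightarrow> real"
  where "coord_norm c z w = tangent_norm g (chart_inv c z) (tangent_of_coords A c (chart_inv c z) w)"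

text \<open>The metric pulled back to the chart; on the vectors \<open>axis i 1\<close> it is the
  Gram matrix, whose entries are smooth by \<open>riemannian_metric\<close>.\<close>

definition gram :: "('a, 'n) chart \<Rightarrow> real ^ 'n \<Rightarrow> real ^ 'n \<Rightarrow> real ^ 'n \<Rightarrow> real"
  where "gram c z v w = g (chart_inv c z)
    (tangent_of_coords A c (chart_inv c z) v) (tangent_of_coords A c (chart_inv c z) w)"

lemma coord_norm_gram: "coord_norm c z w = sqrt (gram c z w w)"
  by (simp add: coord_norm_def gram_def tangent_norm_def)

context
  fixes c z assumes c: "c \<in> A" and z: "z \<in> chart_im c"
begin

lemma gram_commute: "gram c z v w = gram c z w v"
  using metric tangent_of_coords_in[OF c chart_inv_in[OF c z]]
  by (simp add: gram_def riemannian_metric_def)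

lemma gram_linear: "gram c z (a *\<^sub>R v + b *\<^sub>R w) u = a * gram c z v u + b * gram c z w u"
  using metric tangent_of_coords_in[OF c chart_inv_in[OF c z]]
  by (simp add: gram_def riemannian_metric_def tangent_of_coords_linear[OF c chart_inv_in[OF c z]])

lemma bilinear_gram: "bilinear (gram c z)"
proof -
  have add: "gram c z (v + w) u = gram c z v u + gram c z w u" for v w u
    using gram_linear[of 1 v 1 w u] by simp
  have scale: "gram c z (a *\<^sub>R v) u = a * gram c z v u" for a v u
    using gram_linear[of a v 0 0 u] by simp
  show ?thesis
    unfolding bilinear_def
  proof (intro conjI allI linearI)
    fix x b1 b2 show "gram c z x (b1 + b2) = gram c z x b1 + gram c z x b2"
      by (simp add: gram_commute[of x] add)
  next
    fix x b and r :: real show "gram c z x (r *\<^sub>R b) = r *\<^sub>R gram c z x b"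
      by (simp add: gram_commute[of x] scale)
  qed (simp_all add: add scale)
qed

lemma gram_expand:
  "gram c z w w = (\<Sum>i\<in>UNIV. \<Sum>j\<in>UNIV. w $ i * w $ j * gram c z (axis i 1) (axis j 1))"
proof -
  have w: "w = (\<Sum>i\<in>UNIV. w $ i *\<^sub>R axis i 1)"
    using basis_expansion[of w] by (simp add: scalar_mult_eq_scaleR)
  have "gram c z w w = gram c z (\<Sum>i\<in>UNIV. w $ i *\<^sub>R axis i 1) (\<Sum>i\<in>UNIV. w $ i *\<^sub>R axis i 1)"
    using w by simp
  also have "\<dots> = (\<Sum>(i,j)\<in>UNIV\<times>UNIV. gram c z (w $ i *\<^sub>R axis i 1) (w $ j *\<^sub>R axis j 1))"
    by (rule bilinear_sum[OF bilinear_gram])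
  also have "\<dots> = (\<Sum>(i,j)\<in>UNIV\<times>UNIV. w $ i * w $ j * gram c z (axis i 1) (axis j 1))"
    by (intro sum.cong refl) (simp add: case_prod_unfold bilinear_lmul[OF bilinear_gram] bilinear_rmul[OF bilinear_gram])
  also have "\<dots> = (\<Sum>i\<in>UNIV. \<Sum>j\<in>UNIV. w $ i * w $ j * gram c z (axis i 1) (axis j 1))"
    by (simp add: sum.cartesian_product)
  finally show ?thesis .
qed

lemma gram_pos: assumes "w \<noteq> 0" shows "0 < gram c z w w"
proof -
  have "tangent_of_coords A c (chart_inv c z) w \<noteq> tangent_zero"
    using tangent_of_coords_self[OF c chart_inv_in[OF c z], of w] assms by (metis)
  then show ?thesis
    using metric tangent_of_coords_in[OF c chart_inv_in[OF c z]]
    by (simp add: gram_def riemannian_metric_def)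
qed

lemma coord_norm_pos: "w \<noteq> 0 \<Longrightarrow> 0 < coord_norm c z w"
  by (simp add: coord_norm_gram gram_pos)

lemma coord_norm_scale: "coord_norm c z (a *\<^sub>R w) = \<bar>a\<bar> * coord_norm c z w"
proof -
  have "gram c z (a *\<^sub>R w) (a *\<^sub>R w) = a\<^sup>2 * gram c z w w"
    by (simp add: bilinear_lmul[OF bilinear_gram] bilinear_rmul[OF bilinear_gram] power2_eq_square)
  then show ?thesis by (simp add: coord_norm_gram real_sqrt_mult)
qed

lemma coord_norm_0: "coord_norm c z 0 = 0"
  using coord_norm_scale[of 0 0] by simp

lemma coord_norm_nonneg: "0 \<le> coord_norm c z w"
  using coord_norm_pos[of w] coord_norm_0 by (cases "w = 0") auto

end

text \<open>Smoothness of the metric is given entry by entry of the Gram matrix;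
  \<open>gram_expand\<close> makes the norm the square root of a polynomial in \<open>w\<close> with
  these continuous coefficients.\<close>

lemma continuous_coord_norm:
  assumes c: "c \<in> A"
  shows "continuous_on (chart_im c \<times> UNIV) (\<lambda>p. coord_norm c (fst p) (snd p))"
proof -
  have "Ck_on 0 (\<lambda>z. gram c z (axis i 1) (axis j 1)) (chart_im c)" for i j
    using metric c unfolding riemannian_metric_def gram_def smooth_on_def by blast
  then have G: "continuous_on (chart_im c) (\<lambda>z. gram c z (axis i 1) (axis j 1))" for i j by simp
  have "continuous_on (chart_im c \<times> UNIV) (\<lambda>p. gram c (fst p) (axis i 1) (axis j 1))" for i j
    by (rule continuous_on_compose2[OF G continuous_on_fst[OF continuous_on_id]]) auto
  then have "continuous_on (chart_im c \<times> (UNIV :: (real ^ 'n) set)) (\<lambda>p. sqrt (\<Sum>i\<in>UNIV. \<Sum>j\<in>UNIV.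
      snd p $ i * snd p $ j * gram c (fst p) (axis i 1) (axis j 1)))"
    by (intro continuous_intros)
  then show ?thesis
    by (rule continuous_on_eq) (use gram_expand[OF c] in \<open>auto simp: coord_norm_gram\<close>)
qed

text \<open>Positive extrema over the compact product of \<open>K\<close> and the unit sphere extend
  to all \<open>w\<close> by homogeneity.\<close>

lemma coord_norm_bounds:
  assumes c: "c \<in> A" and K: "compact K" "K \<subseteq> chart_im c"
  shows "\<exists>\<kappa>>0. \<exists>C>0. \<forall>z\<in>K. \<forall>w. \<kappa> * norm w \<le> coord_norm c z w \<and> coord_norm c z w \<le> C * norm w"
proof (cases "K = {}")
  case False
  let ?S = "K \<times> sphere (0 :: real ^ 'n) 1" and ?f = "\<lambda>p. coord_norm c (fst p) (snd p)"
  have comp: "compact ?S" using K by (intro compact_Times) auto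
  \<comment> \<open>Any unit vector shows that the sphere is nonempty; \<open>undefined\<close> is
    just some index.\<close>
  have "axis undefined 1 \<in> sphere (0 :: real ^ 'n) 1" by simp
  then have ne: "?S \<noteq> {}" using False by blast
  have cont: "continuous_on ?S ?f"
    by (rule continuous_on_subset[OF continuous_coord_norm[OF c]]) (use K in auto)
  obtain p where p: "p \<in> ?S" "\<And>q. q \<in> ?S \<Longrightarrow> ?f p \<le> ?f q"
    using continuous_attains_inf[OF comp ne cont] by blast
  obtain P where P: "P \<in> ?S" "\<And>q. q \<in> ?S \<Longrightarrow> ?f q \<le> ?f P"
    using continuous_attains_sup[OF comp ne cont] by blast
  have pos: "0 < ?f q" if "q \<in> ?S" for q
  proof (rule coord_norm_pos[OF c])
    show "fst q \<in> chart_im c" using that K by auto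
    show "snd q \<noteq> 0" using that by (auto simp: mem_Times_iff)
  qed
  have "?f p * norm w \<le> coord_norm c z w \<and> coord_norm c z w \<le> ?f P * norm w" if z: "z \<in> K" for z w
  proof (cases "w = 0")
    case True
    then show ?thesis using coord_norm_0[OF c, of z] z K by auto
  next
    case False
    let ?w = "w /\<^sub>R norm w"
    have q: "(z, ?w) \<in> ?S" using z False by simp
    have "w = norm w *\<^sub>R ?w" using False by simp
    then have "coord_norm c z w = norm w * coord_norm c z ?w"
      using coord_norm_scale[OF c, of z "norm w" ?w] z K by auto
    then show ?thesis using p(2)[OF q] P(2)[OF q] False by (simp add: mult.commute mult_left_mono)
  qed
  then show ?thesis
    using pos[OF p(1)] pos[OF P(1)] by (intro exI[of _ "?f p"] exI[of _ "?f P"] conjI) auto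
qed (auto intro: exI[of _ 1])

section \<open>Velocity and speed of a curve\<close>

lemma chart_derivative_change:
  assumes cd: "c \<in> A" "d \<in> A" "\<gamma> t \<in> fst c" "\<gamma> t \<in> fst d" and t: "t \<in> I"
    and cont: "continuous (at t within I) \<gamma>"
    and der: "(snd c \<circ> \<gamma> has_vector_derivative w) (at t within I)"
  shows "(snd d \<circ> \<gamma> has_vector_derivative dtransition d c (\<gamma> t) w) (at t within I)"
proof -
  have "(transition d c has_derivative dtransition d c (\<gamma> t)) (at ((snd c \<circ> \<gamma>) t))"
    using transition_has_derivative[OF cd] by simp
  then have "(transition d c \<circ> (snd c \<circ> \<gamma>) has_derivative dtransition d c (\<gamma> t) \<circ> (\<lambda>h. h *\<^sub>R w)) (at t within I)"
    using der unfolding has_vector_derivative_def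
    by (intro diff_chain_within) (auto intro: has_derivative_at_withinI)
  also have "dtransition d c (\<gamma> t) \<circ> (\<lambda>h. h *\<^sub>R w) = (\<lambda>h. h *\<^sub>R dtransition d c (\<gamma> t) w)"
    by (auto simp: linear_cmul[OF dtransition_linear[OF cd]])
  finally have 1: "(transition d c \<circ> (snd c \<circ> \<gamma>) has_vector_derivative dtransition d c (\<gamma> t) w) (at t within I)"
    by (simp only: has_vector_derivative_def)
  \<comment> \<open>Coordinate maps are arbitrary outside their domains, so continuity of
    \<open>\<gamma>\<close> has to keep it in \<open>fst c\<close> near \<open>t\<close>; only there
    is the composite equal to \<open>snd d \<circ> \<gamma>\<close>.\<close>
  have "eventually (\<lambda>s. \<gamma> s \<in> fst c) (at t within I)"
    using cont cd open_chart[of c] unfolding continuous_within by (auto dest: topological_tendstoD)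
  then obtain \<delta> where \<delta>: "0 < \<delta>" "\<And>s. s \<in> I \<Longrightarrow> dist s t < \<delta> \<Longrightarrow> \<gamma> s \<in> fst c"
  proof -
    obtain \<delta> where "0 < \<delta>" and "\<forall>s\<in>I. s \<noteq> t \<and> dist s t < \<delta> \<longrightarrow> \<gamma> s \<in> fst c"
      using \<open>eventually (\<lambda>s. \<gamma> s \<in> fst c) (at t within I)\<close> unfolding eventually_at by blast
    then show thesis using cd(3) that[of \<delta>] by metis
  qed
  show ?thesis
    by (rule has_vector_derivative_transform_within[OF 1 \<delta>(1) t])
      (use \<delta>(2) in \<open>simp add: chart_inv_chart[OF cd(1)]\<close>)
qed

text \<open>Continuity is included because a coordinate map is arbitrary off its domain:
  differentiability of one representation \<open>snd c \<circ> \<gamma>\<close> alone would not make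
  the velocity independent of the chart.\<close>

definition regular_at :: "(real \<Rightarrow> 'a) \<Rightarrow> real \<Rightarrow> bool"
  where "regular_at \<gamma> t \<longleftrightarrow> isCont \<gamma> t \<and> (\<exists>v. has_velocity A \<gamma> t v)"

lemma regular_atI:
  assumes "isCont \<gamma> t" "c \<in> A" "\<gamma> t \<in> fst c" "(snd c \<circ> \<gamma> has_vector_derivative w) (at t)"
  shows "regular_at \<gamma> t"
  using assms unfolding regular_at_def has_velocity_def by blast

lemma has_velocity_chart:
  assumes "isCont \<gamma> t" "has_velocity A \<gamma> t v" "c \<in> A" "\<gamma> t \<in> fst c"
  shows "(snd c \<circ> \<gamma> has_vector_derivative v c) (at t)" "v = tangent_of_coords A c (\<gamma> t) (v c)"
proof -
  obtain d w where d: "d \<in> A" "\<gamma> t \<in> fst d" "(snd d \<circ> \<gamma> has_vector_derivative w) (at t)"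
    "v = tangent_of_coords A d (\<gamma> t) w" using assms(2) unfolding has_velocity_def by blast
  have "v = tangent_of_coords A c (\<gamma> t) (dtransition c d (\<gamma> t) w)"
    using tangent_of_coords_change[of d c] d assms by simp
  then show "v = tangent_of_coords A c (\<gamma> t) (v c)"
    using tangent_of_coords_self assms by metis
  have "v c = dtransition c d (\<gamma> t) w" using d assms by (simp add: tangent_of_coords_def)
  then show "(snd c \<circ> \<gamma> has_vector_derivative v c) (at t)"
    using chart_derivative_change[of d c \<gamma> t UNIV w] d assms by simp
qed

lemma has_velocity_unique:
  assumes "isCont \<gamma> t" "has_velocity A \<gamma> t v" "has_velocity A \<gamma> t v'"
  shows "v = v'"
proof -
  obtain c where c: "c \<in> A" "\<gamma> t \<in> fst c" using ex_chart by blast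
  have "v c = v' c"
    using has_velocity_chart(1)[OF assms(1) _ c] assms(2,3) vector_derivative_unique_at by blast
  then show ?thesis using has_velocity_chart(2)[OF assms(1) _ c] assms(2,3) by metis
qed

lemma velocity_eq: "isCont \<gamma> t \<Longrightarrow> has_velocity A \<gamma> t v \<Longrightarrow> velocity A \<gamma> t = v"
  unfolding velocity_def by (rule the_equality) (auto intro: has_velocity_unique)

definition speed :: "(real \<Rightarrow> 'a) \<Rightarrow> real \<Rightarrow> real"
  where "speed \<gamma> t = tangent_norm g (\<gamma> t) (velocity A \<gamma> t)"

lemma has_velocityI:
  assumes "c \<in> A" "\<gamma> t \<in> fst c" "(snd c \<circ> \<gamma> has_vector_derivative w) (at t)"
  shows "has_velocity A \<gamma> t (tangent_of_coords A c (\<gamma> t) w)"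
  using assms unfolding has_velocity_def by blast

lemma speed_eq:
  assumes "isCont \<gamma> t" "c \<in> A" "\<gamma> t \<in> fst c" "(snd c \<circ> \<gamma> has_vector_derivative w) (at t)"
  shows "speed \<gamma> t = coord_norm c (snd c (\<gamma> t)) w"
  using velocity_eq[OF assms(1) has_velocityI[OF assms(2-4)]] assms
  by (simp add: speed_def coord_norm_def chart_inv_chart)

lemma regular_at_chart:
  assumes "regular_at \<gamma> t" "c \<in> A" "\<gamma> t \<in> fst c"
  obtains w where "(snd c \<circ> \<gamma> has_vector_derivative w) (at t)" "speed \<gamma> t = coord_norm c (snd c (\<gamma> t)) w"
  using assms has_velocity_chart(1) speed_eq unfolding regular_at_def by metis

lemma speed_nonneg: assumes "regular_at \<gamma> t" shows "0 \<le> speed \<gamma> t"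
proof -
  obtain c where c: "c \<in> A" "\<gamma> t \<in> fst c" using ex_chart by blast
  then show ?thesis using regular_at_chart[OF assms c] coord_norm_nonneg[OF c(1), of "snd c (\<gamma> t)"] by (metis imageI)
qed

text \<open>Agreement is required near \<open>t\<close> only, so that the lemma applies to curves
  assembled from reparametrized pieces, away from their break points.\<close>

lemma regular_at_affine:
  assumes reg: "regular_at \<gamma> (m * t + b)" and eq: "eventually (\<lambda>s. \<eta> s = \<gamma> (m * s + b)) (nhds t)"
  shows "regular_at \<eta> t" "speed \<eta> t = \<bar>m\<bar> * speed \<gamma> (m * t + b)"
proof -
  have \<eta>t: "\<eta> t = \<gamma> (m * t + b)" using eventually_nhds_x_imp_x[OF eq] .
  obtain c where c: "c \<in> A" "\<gamma> (m * t + b) \<in> fst c" using ex_chart by blast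
  obtain w where w: "(snd c \<circ> \<gamma> has_vector_derivative w) (at (m * t + b))"
    and sp: "speed \<gamma> (m * t + b) = coord_norm c (snd c (\<gamma> (m * t + b))) w"
    using regular_at_chart[OF reg c] by blast
  have "isCont (\<lambda>s. \<gamma> (m * s + b)) t"
    using reg by (intro continuous_intros isCont_o2[of t "\<lambda>s. m * s + b" \<gamma>]) (auto simp: regular_at_def)
  then have cont: "isCont \<eta> t" using isCont_cong[OF eq] by simp
  have "((\<lambda>s. m * s + b) has_real_derivative m) (at t)" by (auto intro!: derivative_eq_intros)
  then have "((snd c \<circ> \<gamma>) \<circ> (\<lambda>s. m * s + b) has_vector_derivative m *\<^sub>R w) (at t)"
    using w by (intro vector_diff_chain_at) (auto simp: has_real_derivative_iff_has_vector_derivative)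
  moreover have "\<forall>\<^sub>F s in nhds t. s \<in> UNIV \<longrightarrow> ((snd c \<circ> \<gamma>) \<circ> (\<lambda>s. m * s + b)) s = (snd c \<circ> \<eta>) s"
    using eq by (auto elim: eventually_mono)
  ultimately have der: "(snd c \<circ> \<eta> has_vector_derivative m *\<^sub>R w) (at t)"
    using has_vector_derivative_cong_ev[where f = "(snd c \<circ> \<gamma>) \<circ> (\<lambda>s. m * s + b)" and g = "snd c \<circ> \<eta>" and x = t and S = UNIV] \<eta>t
    by simp
  show "regular_at \<eta> t" using regular_atI[OF cont _ _ der] c \<eta>t by simp
  show "speed \<eta> t = \<bar>m\<bar> * speed \<gamma> (m * t + b)"
    using speed_eq[OF cont _ _ der] c \<eta>t coord_norm_scale[OF c(1), of "snd c (\<eta> t)" m w] sp by simp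
qed

section \<open>Lengths of curves and the Riemannian distance\<close>

lemma C1_curve_on_affine:
  assumes \<gamma>: "C1_curve_on A \<gamma> I" and sub: "\<And>t. t \<in> J \<Longrightarrow> m * t + b \<in> I"
    and \<eta>: "\<And>t. t \<in> J \<Longrightarrow> \<eta> t = \<gamma> (m * t + b)"
  shows "C1_curve_on A \<eta> J"
  unfolding C1_curve_on_def
proof (intro conjI ballI)
  let ?h = "\<lambda>t. m * t + b"
  have cont\<gamma>: "continuous_on I \<gamma>" using \<gamma> by (simp add: C1_curve_on_def)
  have hcont: "continuous_on K ?h" for K by (intro continuous_intros)
  have "continuous_on J (\<lambda>t. \<gamma> (?h t))"
    by (rule continuous_on_compose2[OF cont\<gamma> hcont]) (use sub in auto)
  then show "continuous_on J \<eta>" by (rule continuous_on_eq) (simp add: \<eta>)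
  fix c assume "c \<in> A"
  then obtain D where D: "\<And>t. t \<in> I \<inter> \<gamma> -` fst c \<Longrightarrow> ((snd c \<circ> \<gamma>) has_vector_derivative D t) (at t within I)"
    and Dc: "continuous_on (I \<inter> \<gamma> -` fst c) D"
    using \<gamma> unfolding C1_curve_on_def by blast
  show "\<exists>D. (\<forall>t\<in>J \<inter> \<eta> -` fst c. ((snd c \<circ> \<eta>) has_vector_derivative D t) (at t within J)) \<and>
        continuous_on (J \<inter> \<eta> -` fst c) D"
  proof (intro exI[of _ "\<lambda>t. m *\<^sub>R D (?h t)"] conjI ballI)
    fix t assume t: "t \<in> J \<inter> \<eta> -` fst c"
    then have ht: "?h t \<in> I \<inter> \<gamma> -` fst c" using sub \<eta> by auto
    have "?h ` J \<subseteq> I" using sub by auto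
    then have "((snd c \<circ> \<gamma>) has_vector_derivative D (?h t)) (at (?h t) within ?h ` J)"
      using has_vector_derivative_within_subset[OF D[OF ht]] by simp
    moreover have "(?h has_vector_derivative m) (at t within J)"
      by (auto intro!: derivative_eq_intros simp: has_real_derivative_iff_has_vector_derivative[symmetric])
    ultimately have "((snd c \<circ> \<gamma>) \<circ> ?h has_vector_derivative m *\<^sub>R D (?h t)) (at t within J)"
      by (intro vector_diff_chain_within)
    then show "((snd c \<circ> \<eta>) has_vector_derivative m *\<^sub>R D (?h t)) (at t within J)"
      by (rule has_vector_derivative_transform_within[OF _ zero_less_one]) (use t \<eta> in auto)
  next
    show "continuous_on (J \<inter> \<eta> -` fst c) (\<lambda>t. m *\<^sub>R D (?h t))"
      by (intro continuous_intros continuous_on_compose2[OF Dc hcont]) (use sub \<eta> in auto)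
  qed
qed

lemma C1_curve_on_subset: "C1_curve_on A \<gamma> I \<Longrightarrow> J \<subseteq> I \<Longrightarrow> C1_curve_on A \<gamma> J"
  by (rule C1_curve_on_affine[where I = I and \<gamma> = \<gamma> and m = 1 and b = 0]) auto

lemma C1_curve_regular:
  assumes \<gamma>: "C1_curve_on A \<gamma> {a..b}" and t: "t \<in> {a<..<b}"
  shows "regular_at \<gamma> t"
proof -
  obtain c where c: "c \<in> A" "\<gamma> t \<in> fst c" using ex_chart by blast
  then obtain D where "((snd c \<circ> \<gamma>) has_vector_derivative D t) (at t within {a..b})"
    using \<gamma> t unfolding C1_curve_on_def by fastforce
  then have "((snd c \<circ> \<gamma>) has_vector_derivative D t) (at t)"
    using t by (simp add: at_within_Icc_at)
  moreover have "isCont \<gamma> t"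
    using \<gamma> t by (intro continuous_on_interior[of "{a..b}"]) (auto simp: C1_curve_on_def)
  ultimately show ?thesis using regular_atI c by blast
qed

text \<open>The conditional hypothesis admits one-point intervals, which arise when a curve is cut
  at the end of an interval.\<close>

lemma C1_curve_speed_integrable:
  assumes ab: "a \<le> b" and \<gamma>: "a < b \<Longrightarrow> C1_curve_on A \<gamma> {a..b}"
  shows "speed \<gamma> integrable_on {a..b}"
proof (cases "a < b")
  case True
  note \<gamma> = \<gamma>[OF True]
  have cont: "continuous_on {a..b} \<gamma>" using \<gamma> by (simp add: C1_curve_on_def)
  show ?thesis
  proof (rule integrable_on_interval_locally[OF ab])
    fix t assume t: "t \<in> {a..b}"
    obtain c where c: "c \<in> A" "\<gamma> t \<in> fst c" using ex_chart by blast
    obtain D where D: "\<And>t. t \<in> {a..b} \<inter> \<gamma> -` fst c \<Longrightarrow> ((snd c \<circ> \<gamma>) has_vector_derivative D t) (at t within {a..b})"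
      and Dc: "continuous_on ({a..b} \<inter> \<gamma> -` fst c) D"
      using \<gamma> c unfolding C1_curve_on_def by blast
    have "eventually (\<lambda>s. \<gamma> s \<in> fst c) (at t within {a..b})"
      using cont t c open_chart[OF c(1)] unfolding continuous_on_def by (auto dest: topological_tendstoD)
    then obtain e where e: "0 < e" and "\<forall>s\<in>{a..b}. s \<noteq> t \<and> dist s t < e \<longrightarrow> \<gamma> s \<in> fst c"
      unfolding eventually_at by blast
    then have ec: "\<gamma> s \<in> fst c" if "s \<in> {a..b}" "dist s t < e" for s
      using c that by metis
    show "\<exists>e>0. \<forall>u v. a \<le> u \<and> u \<le> t \<and> t \<le> v \<and> v \<le> b \<and> v - u < e \<longrightarrow> speed \<gamma> integrable_on {u..v}"
    proof (intro exI[of _ e] conjI allI impI e)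
      fix u v assume uv: "a \<le> u \<and> u \<le> t \<and> t \<le> v \<and> v \<le> b \<and> v - u < e"
      have sub: "{u..v} \<subseteq> {a..b} \<inter> \<gamma> -` fst c"
        using uv ec by (auto simp: dist_real_def)
      \<comment> \<open>Inside one chart the speed equals this continuous function, except perhaps
        at \<open>u\<close> and \<open>v\<close>: the velocity is two-sided, whereas
        \<open>D\<close> may be one-sided at the ends of \<open>[a, b]\<close>.\<close>
      have "continuous_on {u..v} (\<lambda>s. coord_norm c (fst (snd c (\<gamma> s), D s)) (snd (snd c (\<gamma> s), D s)))"
      proof (rule continuous_on_compose2[OF continuous_coord_norm[OF c(1)]])
        show "continuous_on {u..v} (\<lambda>s. (snd c (\<gamma> s), D s))"
          using sub
          by (intro continuous_on_Pair continuous_on_compose2[OF continuous_chart[OF c(1)]]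
              continuous_on_subset[OF cont] continuous_on_subset[OF Dc]) auto
        show "(\<lambda>s. (snd c (\<gamma> s), D s)) ` {u..v} \<subseteq> chart_im c \<times> UNIV" using sub by auto
      qed
      then have "(\<lambda>s. coord_norm c (snd c (\<gamma> s)) (D s)) integrable_on {u..v}"
        by (simp add: integrable_continuous_real)
      then have "(\<lambda>s. coord_norm c (snd c (\<gamma> s)) (D s)) integrable_on cbox u v" by simp
      then have "speed \<gamma> integrable_on cbox u v"
      proof (rule integrable_spike_interior[rotated])
        fix s assume "s \<in> box u v"
        then have s: "s \<in> {a<..<b}" "s \<in> {a..b} \<inter> \<gamma> -` fst c"
          using uv subsetD[OF sub, of s] by auto
        then have "((snd c \<circ> \<gamma>) has_vector_derivative D s) (at s)"
          using D[OF s(2)] by (simp add: at_within_Icc_at)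
        then show "speed \<gamma> s = coord_norm c (snd c (\<gamma> s)) (D s)"
          using C1_curve_regular[OF \<gamma> s(1)] c s by (intro speed_eq) (auto simp: regular_at_def)
      qed
      then show "speed \<gamma> integrable_on {u..v}" by simp
    qed
  qed
next
  case False
  then have "{a..b} = cbox a a" using ab by auto
  then show ?thesis using integrable_on_refl[of "speed \<gamma>" a] by metis
qed

lemma piecewise_C1_curveE:
  assumes "piecewise_C1_curve A \<gamma>"
  obtains S where "finite S" "0 \<in> S" "1 \<in> S" "continuous_on {0..1} \<gamma>"
    "\<And>t. t \<in> {0..1} - S \<Longrightarrow> regular_at \<gamma> t"
    "speed \<gamma> integrable_on {0..1}"
    "\<And>a b. 0 \<le> a \<Longrightarrow> a < b \<Longrightarrow> b \<le> 1 \<Longrightarrow> {a<..<b} \<inter> S = {} \<Longrightarrow> C1_curve_on A \<gamma> {a..b}"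
proof -
  have cont: "continuous_on {0..1} \<gamma>" using assms by (simp add: piecewise_C1_curve_def path_def)
  obtain S0 where S0: "finite S0"
    "\<And>a b. 0 \<le> a \<Longrightarrow> a < b \<Longrightarrow> b \<le> 1 \<Longrightarrow> {a<..<b} \<inter> S0 = {} \<Longrightarrow> C1_curve_on A \<gamma> {a..b}"
    using assms unfolding piecewise_C1_curve_def by metis
  \<comment> \<open>The ends count as break points, since the two-sided notion
    \<open>regular_at\<close> depends there on values of the curve outside
    \<open>[0, 1]\<close>.\<close>
  define S where "S = insert 0 (insert 1 S0)"
  have S: "finite S" "0 \<in> S" "1 \<in> S" using S0(1) by (auto simp: S_def)
  have pieces: "C1_curve_on A \<gamma> {a..b}" if "0 \<le> a" "a < b" "b \<le> 1" "{a<..<b} \<inter> S = {}" for a b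
    using S0(2)[OF that(1-3)] that(4) by (auto simp: S_def)
  have isol: "\<exists>e>0. \<forall>s. \<bar>s - t\<bar> < e \<and> s \<noteq> t \<longrightarrow> s \<notin> S" for t
  proof -
    have "\<not> t islimpt S" using S(1) by (rule islimpt_finite)
    then show ?thesis by (auto simp: islimpt_approachable dist_real_def)
  qed
  have reg: "regular_at \<gamma> t" if t: "t \<in> {0..1} - S" for t
  proof -
    obtain e where e: "0 < e" and eS: "\<And>s. \<bar>s - t\<bar> < e \<Longrightarrow> s \<noteq> t \<Longrightarrow> s \<notin> S" using isol by metis
    have t01: "0 < t" "t < 1" using t S by (auto simp: less_le)
    define e' where "e' = min e (min t (1 - t))"
    have e': "0 < e'" "e' \<le> e" "e' \<le> t" "e' \<le> 1 - t" using e t01 by (auto simp: e'_def)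
    have "s \<notin> S" if "s \<in> {t - e'<..<t + e'}" for s
      using eS[of s] t e' that by (cases "s = t") (auto simp: abs_less_iff)
    then have "{t - e'<..<t + e'} \<inter> S = {}" by blast
    then have "C1_curve_on A \<gamma> {t - e'..t + e'}" using e' by (intro pieces) auto
    then show ?thesis by (rule C1_curve_regular) (use e' in auto)
  qed
  have "speed \<gamma> integrable_on {0..1}"
  proof (rule integrable_on_interval_locally)
    fix t :: real assume t: "t \<in> {0..1}"
    obtain e where e: "0 < e" and eS: "\<And>s. \<bar>s - t\<bar> < e \<Longrightarrow> s \<noteq> t \<Longrightarrow> s \<notin> S" using isol by metis
    show "\<exists>e>0. \<forall>u v. 0 \<le> u \<and> u \<le> t \<and> t \<le> v \<and> v \<le> 1 \<and> v - u < e \<longrightarrow> speed \<gamma> integrable_on {u..v}"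
    proof (intro exI[of _ e] conjI allI impI e)
      fix u v assume uv: "0 \<le> u \<and> u \<le> t \<and> t \<le> v \<and> v \<le> 1 \<and> v - u < e"
      have "{u<..<t} \<inter> S = {}" "{t<..<v} \<inter> S = {}"
        using uv eS by (fastforce simp: abs_less_iff)+
      then have "speed \<gamma> integrable_on {u..t}" "speed \<gamma> integrable_on {t..v}"
        using uv by (auto intro!: C1_curve_speed_integrable pieces)
      then show "speed \<gamma> integrable_on {u..v}"
        using uv Henstock_Kurzweil_Integration.integrable_combine by blast
    qed
  qed simp
  then show thesis using that S cont reg pieces by blast
qed

lemma curve_length_speed: "curve_length A g \<gamma> = integral {0..1} (speed \<gamma>)"
  unfolding curve_length_def speed_def[abs_def] ..

lemma curve_length_nonneg:
  assumes "piecewise_C1_curve A \<gamma>" shows "0 \<le> curve_length A g \<gamma>"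
proof -
  obtain S where S: "finite S" "\<And>t. t \<in> {0..1} - S \<Longrightarrow> regular_at \<gamma> t" "speed \<gamma> integrable_on {0..1}"
    using piecewise_C1_curveE[OF assms] by metis
  have "(speed \<gamma> has_integral curve_length A g \<gamma>) {0..1}"
    using S(3) by (simp add: curve_length_speed integrable_integral)
  then have "((\<lambda>t. if t \<in> S then 0 else speed \<gamma> t) has_integral curve_length A g \<gamma>) {0..1}"
    by (rule has_integral_spike_finite[OF S(1), rotated]) auto
  then show ?thesis by (rule has_integral_nonneg) (use S(2) speed_nonneg in auto)
qed

text \<open>With \<open>m = -1\<close> this serves reversal, with \<open>m = 2\<close> each half of
  a concatenation. The length is preserved because the speed gains the factor
  \<open>\<bar>m\<bar>\<close> and the parameter interval shrinks by it.\<close>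

lemma piecewise_C1_affine:
  assumes \<gamma>: "piecewise_C1_curve A \<gamma>" and m: "m \<noteq> 0" and pq: "p < q"
    and h: "(\<lambda>t. m * t + b) ` {p..q} = {0..1}" and \<eta>: "\<And>t. t \<in> {p..q} \<Longrightarrow> \<eta> t = \<gamma> (m * t + b)"
  shows "\<exists>S. finite S \<and> p \<in> S \<and> q \<in> S \<and>
      (\<forall>a' b'. p \<le> a' \<and> a' < b' \<and> b' \<le> q \<and> {a'<..<b'} \<inter> S = {} \<longrightarrow> C1_curve_on A \<eta> {a'..b'})"
    "(speed \<eta> has_integral curve_length A g \<gamma>) {p..q}"
proof -
  obtain S where S: "finite S" "\<And>t. t \<in> {0..1} - S \<Longrightarrow> regular_at \<gamma> t" "speed \<gamma> integrable_on {0..1}"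
    "\<And>a b. 0 \<le> a \<Longrightarrow> a < b \<Longrightarrow> b \<le> 1 \<Longrightarrow> {a<..<b} \<inter> S = {} \<Longrightarrow> C1_curve_on A \<gamma> {a..b}"
    using piecewise_C1_curveE[OF \<gamma>] by metis
  let ?h = "\<lambda>t. m * t + b"
  define S' where "S' = insert p (insert q ((\<lambda>s. (s - b) / m) ` S))"
  have fin: "finite S'" using S(1) by (simp add: S'_def)
  have in_S': "t \<in> S'" if "?h t \<in> S" for t
    using that m unfolding S'_def by (intro insertI2 image_eqI[of _ _ "?h t"]) auto
  have h01: "?h t \<in> {0..1}" if "t \<in> {p..q}" for t using h that by blast
  have pieces: "C1_curve_on A \<eta> {a'..b'}" if ab: "p \<le> a'" "a' < b'" "b' \<le> q" "{a'<..<b'} \<inter> S' = {}" for a' b'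
  proof (rule C1_curve_on_affine)
    let ?\<alpha> = "min (?h a') (?h b')" and ?\<beta> = "max (?h a') (?h b')"
    have ne: "?h a' \<noteq> ?h b'" using m ab by simp
    show "C1_curve_on A \<gamma> {?\<alpha>..?\<beta>}"
    proof (rule S(4))
      show "0 \<le> ?\<alpha>" "?\<beta> \<le> 1" using h01[of a'] h01[of b'] ab by auto
      have "min u v < max u v" if "u \<noteq> v" for u v :: real using that by (auto simp: min_def max_def)
      then show "?\<alpha> < ?\<beta>" using ne .
      have "s \<notin> S" if "s \<in> {?\<alpha><..<?\<beta>}" for s
      proof
        assume "s \<in> S"
        then have "(s - b) / m \<in> S'" unfolding S'_def by blast
        moreover have "(s - b) / m \<in> {a'<..<b'}"
        proof (cases "0 < m")
          case True
          then have "?h a' < ?h b'" using ab by simp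
          then show ?thesis using that True by (simp add: field_simps)
        next
          case False
          then have "m < 0" "?h b' < ?h a'" using m ab by auto
          then show ?thesis using that by (simp add: field_simps)
        qed
        ultimately show False using ab(4) by blast
      qed
      then show "{?\<alpha><..<?\<beta>} \<inter> S = {}" by blast
    qed
    show "?h t \<in> {?\<alpha>..?\<beta>}" if "t \<in> {a'..b'}" for t
      using that by (cases "0 \<le> m") (auto simp: min_le_iff_disj le_max_iff_disj mult_left_mono mult_left_mono_neg)
    show "\<eta> t = \<gamma> (?h t)" if "t \<in> {a'..b'}" for t using \<eta> that ab by simp
  qed
  then show "\<exists>S. finite S \<and> p \<in> S \<and> q \<in> S \<and>
      (\<forall>a' b'. p \<le> a' \<and> a' < b' \<and> b' \<le> q \<and> {a'<..<b'} \<inter> S = {} \<longrightarrow> C1_curve_on A \<eta> {a'..b'})"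
    using fin by (intro exI[of _ S']) (auto simp: S'_def)
  have "(speed \<gamma> has_integral curve_length A g \<gamma>) (cbox 0 1)"
    using S(3) by (simp add: curve_length_speed integrable_integral)
  from has_integral_affinity[OF this m, of b]
  have "((\<lambda>t. speed \<gamma> (?h t)) has_integral curve_length A g \<gamma> / \<bar>m\<bar>)
      ((\<lambda>t. (1 / m) *\<^sub>R t + - ((1 / m) *\<^sub>R b)) ` {0..1})" by simp
  moreover have "(\<lambda>t. (1 / m) *\<^sub>R t + - ((1 / m) *\<^sub>R b)) ` {0..1} = {p..q}"
    using m by (simp add: h[symmetric] image_image add_divide_distrib)
  ultimately have "((\<lambda>t. speed \<gamma> (?h t)) has_integral curve_length A g \<gamma> / \<bar>m\<bar>) {p..q}" by simp
  from has_integral_mult_right[OF this, of "\<bar>m\<bar>"]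
  have "((\<lambda>t. \<bar>m\<bar> * speed \<gamma> (?h t)) has_integral curve_length A g \<gamma>) {p..q}" using m by simp
  then show "(speed \<eta> has_integral curve_length A g \<gamma>) {p..q}"
  proof (rule has_integral_spike_finite[OF fin, rotated])
    fix t assume t: "t \<in> {p..q} - S'"
    then have "t \<in> {p<..<q}" by (auto simp: S'_def less_le)
    then have "\<forall>\<^sub>F s in nhds t. s \<in> {p<..<q}" by (intro eventually_nhds_in_open) auto
    then have "\<forall>\<^sub>F s in nhds t. \<eta> s = \<gamma> (?h s)" by (rule eventually_mono) (simp add: \<eta>)
    moreover have "regular_at \<gamma> (?h t)" using t h01 in_S' by (intro S(2)) auto
    ultimately show "speed \<eta> t = \<bar>m\<bar> * speed \<gamma> (?h t)" using regular_at_affine(2) by blast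
  qed
qed

lemma piecewise_C1_reversepath:
  assumes "piecewise_C1_curve A \<gamma>"
  shows "piecewise_C1_curve A (reversepath \<gamma>)" "curve_length A g (reversepath \<gamma>) = curve_length A g \<gamma>"
proof -
  have im: "(\<lambda>t::real. -1 * t + 1) ` {0..1} = {0..1}"
    by (subst image_affinity_atLeastAtMost) auto
  have e: "reversepath \<gamma> t = \<gamma> (-1 * t + 1)" if "t \<in> {0..1}" for t
    by (simp add: reversepath_def)
  note affine = piecewise_C1_affine[OF assms _ zero_less_one im e]
  show "piecewise_C1_curve A (reversepath \<gamma>)"
    using assms affine(1) unfolding piecewise_C1_curve_def by auto
  show "curve_length A g (reversepath \<gamma>) = curve_length A g \<gamma>"
    unfolding curve_length_speed[of "reversepath \<gamma>"] by (rule integral_unique, rule affine(2)) auto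
qed

lemma piecewise_C1_joinpaths:
  assumes 1: "piecewise_C1_curve A \<gamma>1" and 2: "piecewise_C1_curve A \<gamma>2" and j: "pathfinish \<gamma>1 = pathstart \<gamma>2"
  shows "piecewise_C1_curve A (\<gamma>1 +++ \<gamma>2)"
    "curve_length A g (\<gamma>1 +++ \<gamma>2) = curve_length A g \<gamma>1 + curve_length A g \<gamma>2"
proof -
  let ?\<gamma> = "\<gamma>1 +++ \<gamma>2"
  have im1: "(\<lambda>t::real. 2 * t + 0) ` {0..1/2} = {0..1}"
    and im2: "(\<lambda>t::real. 2 * t + -1) ` {1/2..1} = {0..1}"
    by (subst image_affinity_atLeastAtMost; simp)+
  have e1: "?\<gamma> t = \<gamma>1 (2 * t + 0)" if "t \<in> {0..1/2}" for t using that by (simp add: joinpaths_def)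
  have e2: "?\<gamma> t = \<gamma>2 (2 * t + -1)" if "t \<in> {1/2..1}" for t
  proof (cases "t = 1/2")
    case True
    then show ?thesis using j by (simp only: joinpaths_def pathfinish_def pathstart_def) simp
  qed (use that in \<open>auto simp: joinpaths_def\<close>)
  note half1 = piecewise_C1_affine[OF 1 _ _ im1 e1] and half2 = piecewise_C1_affine[OF 2 _ _ im2 e2]
  obtain S1 where S1: "finite S1" "1/2 \<in> S1"
    "\<And>a b. 0 \<le> a \<Longrightarrow> a < b \<Longrightarrow> b \<le> 1/2 \<Longrightarrow> {a<..<b} \<inter> S1 = {} \<Longrightarrow> C1_curve_on A ?\<gamma> {a..b}"
    using half1(1) by auto
  obtain S2 where S2: "finite S2"
    "\<And>a b. 1/2 \<le> a \<Longrightarrow> a < b \<Longrightarrow> b \<le> 1 \<Longrightarrow> {a<..<b} \<inter> S2 = {} \<Longrightarrow> C1_curve_on A ?\<gamma> {a..b}"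
    using half2(1) by auto
  have "C1_curve_on A ?\<gamma> {a..b}" if ab: "0 \<le> a" "a < b" "b \<le> 1" "{a<..<b} \<inter> (S1 \<union> S2) = {}" for a b
  proof (cases "b \<le> 1/2")
    case True
    then show ?thesis using ab by (intro S1(3)) auto
  next
    case False
    \<comment> \<open>As \<open>1/2\<close> is a break point, an interval free of break points lies
      in one half.\<close>
    have "1/2 \<notin> {a<..<b}" using ab(4) S1(2) by blast
    then show ?thesis using ab False by (intro S2(2)) auto
  qed
  then show "piecewise_C1_curve A ?\<gamma>"
    using 1 2 j S1(1) S2(1) unfolding piecewise_C1_curve_def
    by (auto intro!: path_join_imp exI[of _ "S1 \<union> S2"])
  show "curve_length A g ?\<gamma> = curve_length A g \<gamma>1 + curve_length A g \<gamma>2"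
    unfolding curve_length_speed[of ?\<gamma>]
    by (rule integral_unique, rule has_integral_combine[OF _ _ half1(2) half2(2)]) auto
qed

lemma dist_le_curve_length:
  assumes "piecewise_C1_curve A \<gamma>" "pathstart \<gamma> = x" "pathfinish \<gamma> = y"
  shows "\<rho> x y \<le> curve_length A g \<gamma>"
  unfolding riemannian_dist_def
  by (rule cInf_lower) (use assms curve_length_nonneg in \<open>auto intro!: bdd_belowI[of _ 0]\<close>)

section \<open>Lengths of curves against coordinate distance\<close>

lemma chart_segment:
  assumes c: "c \<in> A" and seg: "closed_segment z1 z2 \<subseteq> chart_im c"
    and L: "\<And>z. z \<in> closed_segment z1 z2 \<Longrightarrow> coord_norm c z (z2 - z1) \<le> L"
  defines "\<gamma> \<equiv> \<lambda>t. chart_inv c (z1 + t *\<^sub>R (z2 - z1))"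
  shows "piecewise_C1_curve A \<gamma>" "pathstart \<gamma> = chart_inv c z1" "pathfinish \<gamma> = chart_inv c z2"
    "curve_length A g \<gamma> \<le> L"
proof -
  let ?l = "\<lambda>t. z1 + t *\<^sub>R (z2 - z1)"
  have inseg: "?l t \<in> closed_segment z1 z2" if "t \<in> {0..1}" for t
    using that by (auto simp: in_segment algebra_simps intro!: exI[of _ t])
  then have inc: "?l t \<in> chart_im c" if "t \<in> {0..1}" for t using that seg by blast
  have lder: "(?l has_vector_derivative (z2 - z1)) (at t within I)" for t I
    by (auto intro!: derivative_eq_intros)
  have cont: "continuous_on {0..1} \<gamma>"
    unfolding \<gamma>_def
    by (rule continuous_on_compose2[OF continuous_chart_inv[OF c]]) (use inc in \<open>auto intro!: continuous_intros\<close>)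
  have \<gamma>t: "\<gamma> t \<in> fst c" "snd c (\<gamma> t) = ?l t"
    and cder: "((snd c \<circ> \<gamma>) has_vector_derivative (z2 - z1)) (at t within {0..1})" if t: "t \<in> {0..1}" for t
  proof -
    show "\<gamma> t \<in> fst c" "snd c (\<gamma> t) = ?l t"
      using inc[OF t] by (auto simp: \<gamma>_def chart_inv_in[OF c] chart_chart_inv[OF c])
    show "((snd c \<circ> \<gamma>) has_vector_derivative (z2 - z1)) (at t within {0..1})"
      by (rule has_vector_derivative_transform_within[OF lder zero_less_one])
        (use t inc in \<open>auto simp: \<gamma>_def chart_chart_inv[OF c]\<close>)
  qed
  have C1: "C1_curve_on A \<gamma> {0..1}"
    unfolding C1_curve_on_def
  proof (intro conjI ballI cont)
    fix d assume d: "d \<in> A"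
    let ?D = "\<lambda>t. frechet_derivative (transition d c) (at (?l t)) (z2 - z1)"
    have img: "?l t \<in> snd c ` (fst c \<inter> fst d)" if "t \<in> {0..1} \<inter> \<gamma> -` fst d" for t
      using that \<gamma>t[of t] by (intro image_eqI[of _ _ "\<gamma> t"]) auto
    show "\<exists>D. (\<forall>t\<in>{0..1} \<inter> \<gamma> -` fst d. (snd d \<circ> \<gamma> has_vector_derivative D t) (at t within {0..1})) \<and>
         continuous_on ({0..1} \<inter> \<gamma> -` fst d) D"
    proof (intro exI[of _ ?D] conjI ballI)
      fix t assume t: "t \<in> {0..1} \<inter> \<gamma> -` fst d"
      have "(snd d \<circ> \<gamma> has_vector_derivative dtransition d c (\<gamma> t) (z2 - z1)) (at t within {0..1})"
        using t \<gamma>t cder cont by (intro chart_derivative_change c d) (auto simp: continuous_on_eq_continuous_within)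
      then show "(snd d \<circ> \<gamma> has_vector_derivative ?D t) (at t within {0..1})" using \<gamma>t t by simp
    next
      show "continuous_on ({0..1} \<inter> \<gamma> -` fst d) ?D"
        by (rule continuous_on_compose2[OF continuous_dtransition[OF c d]])
          (use img in \<open>auto intro!: continuous_intros\<close>)
    qed
  qed
  show "piecewise_C1_curve A \<gamma>"
    unfolding piecewise_C1_curve_def path_def
    using cont C1_curve_on_subset[OF C1] by (auto intro!: exI[of _ "{}"])
  show "pathstart \<gamma> = chart_inv c z1" "pathfinish \<gamma> = chart_inv c z2"
    by (auto simp: \<gamma>_def pathstart_def pathfinish_def)
  have sp: "speed \<gamma> t \<le> L" if t: "t \<in> {0<..<1}" for t
  proof -
    have "((snd c \<circ> \<gamma>) has_vector_derivative (z2 - z1)) (at t)"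
      using t cder[of t] by (simp add: at_within_Icc_at)
    then have "speed \<gamma> t = coord_norm c (?l t) (z2 - z1)"
      using speed_eq[OF _ c] C1_curve_regular[OF C1 t] \<gamma>t[of t] t by (simp add: regular_at_def)
    then show ?thesis using L inseg[of t] t by simp
  qed
  have "speed \<gamma> integrable_on cbox 0 1" using C1_curve_speed_integrable[of 0 1 \<gamma>] C1 by simp
  then have "(speed \<gamma> has_integral curve_length A g \<gamma>) (cbox 0 1)"
    by (simp add: curve_length_speed integrable_integral)
  \<comment> \<open>The speeds at \<open>0\<close> and \<open>1\<close> are two-sided and
    uncontrolled; overwriting them by \<open>L\<close> leaves the integral unchanged.\<close>
  then have "((\<lambda>t. if t \<in> {0<..<1} then speed \<gamma> t else L) has_integral curve_length A g \<gamma>) (cbox 0 1)"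
    by (rule has_integral_spike_interior) auto
  moreover have "((\<lambda>_. L) has_integral L) (cbox (0::real) 1)" using has_integral_const_real[of L 0 1] by simp
  ultimately show "curve_length A g \<gamma> \<le> L"
    by (rule has_integral_le) (use sp in auto)
qed

lemma dist_le_segment:
  assumes "c \<in> A" "closed_segment z1 z2 \<subseteq> chart_im c"
    "\<And>z. z \<in> closed_segment z1 z2 \<Longrightarrow> coord_norm c z (z2 - z1) \<le> L"
  shows "\<rho> (chart_inv c z1) (chart_inv c z2) \<le> L"
  using dist_le_curve_length[OF chart_segment(1-3)[OF assms]] chart_segment(4)[OF assms] by simp

text \<open>As long as the curve stays in the ball, its coordinate distance from \<open>q\<close> is at most its length
  divided by \<open>\<kappa>\<close>, which is less than \<open>d\<close>; by compactness of the smaller ball it cannot leave.\<close>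

lemma curve_confined:
  assumes c: "c \<in> A" and q: "q \<in> fst c" and d: "cball (snd c q) d \<subseteq> chart_im c"
    and \<kappa>: "0 < \<kappa>" "\<And>z w. z \<in> cball (snd c q) d \<Longrightarrow> \<kappa> * norm w \<le> coord_norm c z w"
    and \<gamma>: "piecewise_C1_curve A \<gamma>" "pathstart \<gamma> = q" and L: "curve_length A g \<gamma> < \<kappa> * d"
  shows "pathfinish \<gamma> \<in> fst c" "\<kappa> * dist (snd c q) (snd c (pathfinish \<gamma>)) \<le> curve_length A g \<gamma>"
proof -
  obtain S where S: "finite S" "0 \<in> S" "1 \<in> S" "continuous_on {0..1} \<gamma>"
    "\<And>t. t \<in> {0..1} - S \<Longrightarrow> regular_at \<gamma> t" "speed \<gamma> integrable_on {0..1}"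
    using piecewise_C1_curveE[OF \<gamma>(1)] by metis
  have \<gamma>0: "\<gamma> 0 = q" using \<gamma>(2) by (simp add: pathstart_def)
  let ?L = "curve_length A g \<gamma>"
  define sp where "sp t = (if t \<in> S then 0 else speed \<gamma> t)" for t
  have sp_nonneg: "0 \<le> sp t" if "t \<in> {0..1}" for t
    using that S(5) speed_nonneg by (auto simp: sp_def)
  have sp: "(sp has_integral ?L) {0..1}"
    by (rule has_integral_spike_finite[OF S(1), of _ _ "speed \<gamma>"])
      (use S(6) in \<open>auto simp: sp_def curve_length_speed integrable_integral\<close>)
  let ?U = "chart_inv c ` ball (snd c q) d"
  have Uopen: "open ?U" using d by (intro open_image_chart_inv c) auto
  have Usub: "x \<in> fst c \<and> snd c x \<in> ball (snd c q) d" if "x \<in> ?U" for x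
    using that d chart_inv_image[OF c, of "ball (snd c q) d" x] ball_subset_cball[of "snd c q" d] by blast
  have "0 \<le> ?L" by (rule curve_length_nonneg[OF \<gamma>(1)])
  then have dpos: "0 < d" using L \<kappa>(1) by (metis less_le_trans zero_less_mult_pos not_le order_le_less_trans)
  have bound: "\<kappa> * dist (snd c q) (snd c (\<gamma> t)) \<le> ?L" if t: "t \<in> {0..1}" and tU: "\<And>s. s \<in> {0..t} \<Longrightarrow> \<gamma> s \<in> ?U" for t
  proof -
    \<comment> \<open>Break points carry no derivative; the value \<open>0\<close> satisfies the
      bound against \<open>sp\<close>, which vanishes there too.\<close>
    define f' where "f' s = (if s \<in> S then 0 else vector_derivative (snd c \<circ> \<gamma>) (at s))" for s
    have cont: "continuous_on {0..t} (snd c \<circ> \<gamma>)"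
      unfolding o_def
      by (rule continuous_on_compose2[OF continuous_chart[OF c] continuous_on_subset[OF S(4)]])
        (use t tU Usub in auto)
    have der: "(snd c \<circ> \<gamma> has_vector_derivative f' s) (at s)" and ns: "\<kappa> * norm (f' s) \<le> sp s"
      if s: "s \<in> {0..t} - S" for s
    proof -
      have reg: "regular_at \<gamma> s" using s t by (intro S(5)) auto
      have sU: "\<gamma> s \<in> fst c" "snd c (\<gamma> s) \<in> ball (snd c q) d" using Usub tU[of s] s by auto
      obtain w where w: "(snd c \<circ> \<gamma> has_vector_derivative w) (at s)" "speed \<gamma> s = coord_norm c (snd c (\<gamma> s)) w"
        using regular_at_chart[OF reg c sU(1)] by blast
      then have "f' s = w" using s by (simp add: f'_def vector_derivative_at)
      then show "(snd c \<circ> \<gamma> has_vector_derivative f' s) (at s)" "\<kappa> * norm (f' s) \<le> sp s"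
        using w s \<kappa>(2)[of "snd c (\<gamma> s)" w] sU by (auto simp: sp_def)
    qed
    have "(f' has_integral (snd c \<circ> \<gamma>) t - (snd c \<circ> \<gamma>) 0) {0..t}"
      by (rule fundamental_theorem_of_calculus_interior_strong[OF S(1)]) (use t der cont in \<open>auto simp del: o_apply simp: o_def[symmetric]\<close>)
    then have I: "((\<lambda>s. \<kappa> *\<^sub>R f' s) has_integral \<kappa> *\<^sub>R (snd c (\<gamma> t) - snd c q)) {0..t}"
      using has_integral_cmul[of f' _ _ \<kappa>] \<gamma>0 by simp
    have spt: "sp integrable_on {0..t}"
      by (rule integrable_subinterval_real[OF has_integral_integrable[OF sp]]) (use t in auto)
    have "norm (\<kappa> *\<^sub>R (snd c (\<gamma> t) - snd c q)) \<le> integral {0..t} sp"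
      unfolding integral_unique[OF I, symmetric]
    proof (rule integral_norm_bound_integral[OF _ spt])
      show "(\<lambda>s. \<kappa> *\<^sub>R f' s) integrable_on {0..t}" using I by blast
      show "norm (\<kappa> *\<^sub>R f' s) \<le> sp s" if "s \<in> {0..t}" for s
        using ns[of s] that \<kappa>(1) by (cases "s \<in> S") (auto simp: f'_def sp_def)
    qed
    also have "\<dots> \<le> integral {0..1} sp"
      by (rule integral_subset_le) (use t spt has_integral_integrable[OF sp] sp_nonneg in auto)
    also have "\<dots> = ?L" using sp by (rule integral_unique)
    finally show ?thesis using \<kappa>(1) by (simp add: dist_norm norm_minus_commute)
  qed
  have inU: "\<gamma> t \<in> ?U" if t: "t \<in> {0..1}" for t
  proof (rule ccontr)
    assume nt: "\<gamma> t \<notin> ?U"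
    \<comment> \<open>The exit times form a compact set, so there is a first one. Before it the
      curve lies in the image of a smaller closed ball, which is closed in the Hausdorff manifold
      and hence also contains the exit point.\<close>
    define C where "C = {0..1} \<inter> \<gamma> -` (- ?U)"
    have "closed C"
      unfolding C_def using Uopen S(4) by (intro continuous_closed_preimage) auto
    then have "compact C"
      by (metis C_def bounded_closed_interval bounded_Int compact_eq_bounded_closed)
    moreover have "C \<noteq> {}" using t nt by (auto simp: C_def)
    ultimately obtain \<tau> where \<tau>: "\<tau> \<in> C" "\<And>s. s \<in> C \<Longrightarrow> \<tau> \<le> s" using compact_attains_inf by metis
    have "\<gamma> 0 \<in> ?U" using \<gamma>0 dpos q by (intro image_eqI[of _ _ "snd c q"]) (auto simp: chart_inv_chart[OF c])
    then have \<tau>0: "0 < \<tau>" using \<tau>(1) by (cases "\<tau> = 0") (auto simp: C_def)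
    have \<tau>1: "\<tau> \<le> 1" using \<tau>(1) by (auto simp: C_def)
    have before: "\<gamma> s \<in> ?U" if "s \<in> {0..<\<tau>}" for s
    proof (rule ccontr)
      assume "\<gamma> s \<notin> ?U"
      then have "s \<in> C" using that \<tau>1 by (auto simp: C_def)
      then show False using \<tau>(2) that by fastforce
    qed
    let ?K = "chart_inv c ` cball (snd c q) (?L / \<kappa>)"
    have Ld: "?L / \<kappa> < d" using L \<kappa>(1) by (simp add: divide_less_eq mult.commute)
    have Ksub: "cball (snd c q) (?L / \<kappa>) \<subseteq> chart_im c" using Ld d by auto
    have "compact ?K"
      by (rule compact_continuous_image[OF continuous_on_subset[OF continuous_chart_inv[OF c] Ksub]]) auto
    then have "closed ?K" by (rule compact_imp_closed)
    have "\<gamma> s \<in> ?K" if s: "s \<in> {0..<\<tau>}" for s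
    proof (rule image_eqI)
      have "\<kappa> * dist (snd c q) (snd c (\<gamma> s)) \<le> ?L"
        by (rule bound) (use s \<tau>1 before in auto)
      then show "snd c (\<gamma> s) \<in> cball (snd c q) (?L / \<kappa>)"
        using \<kappa>(1) by (simp add: pos_le_divide_eq mult.commute)
      show "\<gamma> s = chart_inv c (snd c (\<gamma> s))" using Usub before[OF s] chart_inv_chart[OF c] by simp
    qed
    then have "{0..<\<tau>} \<subseteq> {0..\<tau>} \<inter> \<gamma> -` ?K" by auto
    moreover have "closed ({0..\<tau>} \<inter> \<gamma> -` ?K)"
      using \<open>closed ?K\<close> \<tau>1 by (intro continuous_closed_preimage continuous_on_subset[OF S(4)]) auto
    ultimately have "closure {0..<\<tau>} \<subseteq> {0..\<tau>} \<inter> \<gamma> -` ?K" by (rule closure_minimal)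
    moreover have "\<tau> \<in> closure {0..<\<tau>}" using \<tau>0 by simp
    ultimately have "\<gamma> \<tau> \<in> ?K" by blast
    moreover have "?K \<subseteq> ?U" using Ld by (intro image_mono) auto
    ultimately show False using \<tau>(1) by (auto simp: C_def)
  qed
  show "pathfinish \<gamma> \<in> fst c" using inU[of 1] Usub by (simp add: pathfinish_def)
  show "\<kappa> * dist (snd c q) (snd c (pathfinish \<gamma>)) \<le> ?L"
    using bound[of 1] inU by (simp add: pathfinish_def)
qed

text \<open>\<open>\<rho>\<close> is an infimum of lengths, which is meaningful only if some curve
  joins the two points.\<close>

definition linked :: "'a \<Rightarrow> 'a \<Rightarrow> bool"
  where "linked x y \<longleftrightarrow> (\<exists>\<gamma>. piecewise_C1_curve A \<gamma> \<and> pathstart \<gamma> = x \<and> pathfinish \<gamma> = y)"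

lemma linked_sym: "linked x y \<Longrightarrow> linked y x"
  unfolding linked_def using piecewise_C1_reversepath(1) by (metis pathstart_reversepath pathfinish_reversepath)

lemma linked_trans: "linked x y \<Longrightarrow> linked y z \<Longrightarrow> linked x z"
  unfolding linked_def using piecewise_C1_joinpaths(1) by (metis pathstart_join pathfinish_join)

lemma chart_cball:
  assumes "c \<in> A" "p \<in> fst c"
  obtains d where "0 < d" "cball (snd c p) d \<subseteq> chart_im c"
  using open_chart_im[OF assms(1)] assms(2) open_contains_cball by blast

lemma linked_chart:
  assumes c: "c \<in> A" and d: "cball z0 d \<subseteq> chart_im c" and z: "z1 \<in> cball z0 d" "z2 \<in> cball z0 d"
  shows "linked (chart_inv c z1) (chart_inv c z2)"
proof -
  have seg: "closed_segment z1 z2 \<subseteq> cball z0 d" using z by (simp add: closed_segment_subset)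
  obtain C where C: "\<And>z w. z \<in> cball z0 d \<Longrightarrow> coord_norm c z w \<le> C * norm w"
    using coord_norm_bounds[OF c compact_cball d] by blast
  show ?thesis
    unfolding linked_def using chart_segment(1-3)[OF c, of z1 z2 "C * norm (z2 - z1)"] C seg d by blast
qed

end

section \<open>The Riemannian distance as a metric compatible with the charts\<close>

locale connected_riemannian = riemannian A g
  for A :: "('a::{t2_space, second_countable_topology}, 'n::finite) chart set" and g +
  assumes conn: "connected (UNIV :: 'a set)"
begin

text \<open>Linkage is an equivalence relation with open classes, because coordinate segments link
  all points of a coordinate ball to its centre; a connected space has a single class.\<close>

lemma linked: "linked x y"
proof (rule connected_equivalence_relation[OF conn, of x y linked])
  fix a :: 'a
  obtain c where c: "c \<in> A" "a \<in> fst c" using ex_chart by blast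
  obtain d where d: "0 < d" "cball (snd c a) d \<subseteq> chart_im c" using chart_cball[OF c] .
  let ?T = "chart_inv c ` ball (snd c a) d"
  have "open ?T" using d by (intro open_image_chart_inv c) auto
  moreover have "a \<in> ?T"
    using d c by (intro image_eqI[of _ _ "snd c a"]) (auto simp: chart_inv_chart)
  moreover have "linked a x" if "x \<in> ?T" for x
  proof -
    obtain z where "z \<in> ball (snd c a) d" "x = chart_inv c z" using \<open>x \<in> ?T\<close> by blast
    then show ?thesis
      using linked_chart[OF c(1) d(2), of "snd c a" z] chart_inv_chart[OF c] d(1) by simp
  qed
  ultimately show "\<exists>T. openin (top_of_set UNIV) T \<and> a \<in> T \<and> (\<forall>x\<in>T. linked a x)" by auto
qed (auto intro: linked_sym linked_trans)

lemma dist_less_curve: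
  assumes "\<rho> x y < L"
  shows "\<exists>\<gamma>. piecewise_C1_curve A \<gamma> \<and> pathstart \<gamma> = x \<and> pathfinish \<gamma> = y \<and> curve_length A g \<gamma> < L"
proof -
  have "{curve_length A g \<gamma> |\<gamma>. piecewise_C1_curve A \<gamma> \<and> pathstart \<gamma> = x \<and> pathfinish \<gamma> = y} \<noteq> {}"
    using linked[of x y] unfolding linked_def by blast
  from cInf_lessD[OF this assms[unfolded riemannian_dist_def]]
  show ?thesis by auto
qed

lemma rdist_nonneg: "0 \<le> \<rho> x y"
proof (rule ccontr)
  assume "\<not> 0 \<le> \<rho> x y"
  then have "\<rho> x y < 0" by simp
  then obtain \<gamma> where "piecewise_C1_curve A \<gamma>" "curve_length A g \<gamma> < 0" using dist_less_curve by blast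
  then show False using curve_length_nonneg by fastforce
qed

lemma rdist_commute_le: "\<rho> x y \<le> \<rho> y x"
proof (rule dense_ge)
  fix L assume "\<rho> y x < L"
  then obtain \<gamma> where \<gamma>: "piecewise_C1_curve A \<gamma>" "pathstart \<gamma> = y" "pathfinish \<gamma> = x" "curve_length A g \<gamma> < L"
    using dist_less_curve by blast
  then show "\<rho> x y \<le> L"
    using dist_le_curve_length[OF piecewise_C1_reversepath(1)[OF \<gamma>(1)], of x y] piecewise_C1_reversepath(2)[OF \<gamma>(1)]
    by simp
qed

lemma rdist_commute: "\<rho> x y = \<rho> y x"
  using rdist_commute_le by (rule antisym) (rule rdist_commute_le)

lemma rdist_triangle: "\<rho> x z \<le> \<rho> x y + \<rho> y z"
proof (rule field_le_epsilon)
  fix e :: real assume "0 < e"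
  then have "\<rho> x y < \<rho> x y + e / 2" "\<rho> y z < \<rho> y z + e / 2" by auto
  obtain \<gamma>1 where 1: "piecewise_C1_curve A \<gamma>1" "pathstart \<gamma>1 = x" "pathfinish \<gamma>1 = y" "curve_length A g \<gamma>1 < \<rho> x y + e / 2"
    using dist_less_curve[OF \<open>\<rho> x y < \<rho> x y + e / 2\<close>] by blast
  obtain \<gamma>2 where 2: "piecewise_C1_curve A \<gamma>2" "pathstart \<gamma>2 = y" "pathfinish \<gamma>2 = z" "curve_length A g \<gamma>2 < \<rho> y z + e / 2"
    using dist_less_curve[OF \<open>\<rho> y z < \<rho> y z + e / 2\<close>] by blast
  have "pathfinish \<gamma>1 = pathstart \<gamma>2" using 1 2 by simp
  note j = piecewise_C1_joinpaths[OF 1(1) 2(1) this]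
  show "\<rho> x z \<le> \<rho> x y + \<rho> y z + e"
    using dist_le_curve_length[OF j(1), of x z] j(2) 1 2 by simp
qed

text \<open>Near-optimal curves from \<open>q\<close> to \<open>q'\<close> are too short to leave
  the coordinate ball, so \<open>curve_confined\<close> bounds their lengths from below, and the
  infimum inherits the bound.\<close>

lemma chart_dist_lower:
  assumes c: "c \<in> A" and q: "q \<in> fst c" and d: "cball (snd c q) d \<subseteq> chart_im c"
    and \<kappa>: "0 < \<kappa>" "\<And>z w. z \<in> cball (snd c q) d \<Longrightarrow> \<kappa> * norm w \<le> coord_norm c z w"
    and less: "\<rho> q q' < \<kappa> * d"
  shows "q' \<in> fst c" "\<kappa> * dist (snd c q) (snd c q') \<le> \<rho> q q'"
proof -
  have *: "q' \<in> fst c \<and> \<kappa> * dist (snd c q) (snd c q') \<le> L" if L: "\<rho> q q' < L" "L \<le> \<kappa> * d" for L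
  proof -
    obtain \<gamma> where \<gamma>: "piecewise_C1_curve A \<gamma>" "pathstart \<gamma> = q" "pathfinish \<gamma> = q'" "curve_length A g \<gamma> < L"
      using dist_less_curve[OF L(1)] by blast
    then show ?thesis using curve_confined[OF c q d \<kappa> \<gamma>(1,2)] L by simp
  qed
  then show "q' \<in> fst c" using less by blast
  show "\<kappa> * dist (snd c q) (snd c q') \<le> \<rho> q q'"
  proof (rule dense_ge_bounded[OF less])
    fix L assume "\<rho> q q' < L" "L < \<kappa> * d"
    then show "\<kappa> * dist (snd c q) (snd c q') \<le> L" using *[of L] by simp
  qed
qed

text \<open>The estimates hold on the ball of radius \<open>2 * d\<close>, so that the ball of radius \<open>d\<close> around each
  point \<open>q\<close> of the ball of radius \<open>d\<close> is still covered.\<close>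

definition comparable :: "('a, 'n) chart \<Rightarrow> 'a \<Rightarrow> real \<Rightarrow> real \<Rightarrow> real \<Rightarrow> bool"
  where "comparable c p d \<kappa> C \<longleftrightarrow> 0 < d \<and> 0 < \<kappa> \<and> 0 < C \<and> cball (snd c p) (2 * d) \<subseteq> chart_im c \<and>
    (\<forall>z\<in>cball (snd c p) (2 * d). \<forall>w. \<kappa> * norm w \<le> coord_norm c z w) \<and>
    (\<forall>z1\<in>cball (snd c p) (2 * d). \<forall>z2\<in>cball (snd c p) (2 * d).
      \<rho> (chart_inv c z1) (chart_inv c z2) \<le> C * dist z1 z2) \<and>
    (\<forall>q\<in>fst c. \<forall>q'. snd c q \<in> cball (snd c p) d \<and> \<rho> q q' < \<kappa> * d \<longrightarrow>
      q' \<in> fst c \<and> \<kappa> * dist (snd c q) (snd c q') \<le> \<rho> q q')"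

lemma comparableD:
  assumes "comparable c p d \<kappa> C"
  shows "0 < d" "0 < \<kappa>" "0 < C" "cball (snd c p) (2 * d) \<subseteq> chart_im c"
    "\<And>z w. z \<in> cball (snd c p) (2 * d) \<Longrightarrow> \<kappa> * norm w \<le> coord_norm c z w"
    "\<And>z1 z2. z1 \<in> cball (snd c p) (2 * d) \<Longrightarrow> z2 \<in> cball (snd c p) (2 * d) \<Longrightarrow>
      \<rho> (chart_inv c z1) (chart_inv c z2) \<le> C * dist z1 z2"
    "\<And>q q'. q \<in> fst c \<Longrightarrow> snd c q \<in> cball (snd c p) d \<Longrightarrow> \<rho> q q' < \<kappa> * d \<Longrightarrow>
      q' \<in> fst c \<and> \<kappa> * dist (snd c q) (snd c q') \<le> \<rho> q q'"
  using assms unfolding comparable_def by blast+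

lemma ex_comparable:
  assumes c: "c \<in> A" "p \<in> fst c" and U: "open U" "p \<in> U"
  shows "\<exists>d \<kappa> C. comparable c p d \<kappa> C \<and> chart_inv c ` cball (snd c p) (2 * d) \<subseteq> U"
proof -
  have "open (snd c ` (fst c \<inter> U))" by (rule open_image_chart[OF c(1) U(1)])
  moreover have "snd c p \<in> snd c ` (fst c \<inter> U)" using c U by blast
  ultimately obtain e where e: "0 < e" "cball (snd c p) e \<subseteq> snd c ` (fst c \<inter> U)"
    using open_contains_cball by blast
  define d where "d = e / 2"
  have d: "0 < d" "cball (snd c p) (2 * d) \<subseteq> snd c ` (fst c \<inter> U)" using e by (auto simp: d_def)
  then have dc: "cball (snd c p) (2 * d) \<subseteq> chart_im c" by blast
  obtain \<kappa> C where \<kappa>: "0 < \<kappa>" "\<And>z w. z \<in> cball (snd c p) (2 * d) \<Longrightarrow> \<kappa> * norm w \<le> coord_norm c z w"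
    and C: "0 < C" "\<And>z w. z \<in> cball (snd c p) (2 * d) \<Longrightarrow> coord_norm c z w \<le> C * norm w"
    using coord_norm_bounds[OF c(1) compact_cball dc] by blast
  have U': "chart_inv c ` cball (snd c p) (2 * d) \<subseteq> U"
    using d(2) chart_inv_chart[OF c(1)] by force
  have upper: "\<rho> (chart_inv c z1) (chart_inv c z2) \<le> C * dist z1 z2"
    if z: "z1 \<in> cball (snd c p) (2 * d)" "z2 \<in> cball (snd c p) (2 * d)" for z1 z2
  proof -
    have seg: "closed_segment z1 z2 \<subseteq> cball (snd c p) (2 * d)" using z by (intro closed_segment_subset) auto
    have eq: "dist z1 z2 = norm (z2 - z1)" by (simp add: dist_norm norm_minus_commute)
    show ?thesis
      unfolding eq by (rule dist_le_segment[OF c(1) order_trans[OF seg dc] C(2)[OF subsetD[OF seg]]])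
  qed
  have lower: "q' \<in> fst c \<and> \<kappa> * dist (snd c q) (snd c q') \<le> \<rho> q q'"
    if q: "q \<in> fst c" "snd c q \<in> cball (snd c p) d" "\<rho> q q' < \<kappa> * d" for q q'
  proof -
    have sub: "cball (snd c q) d \<subseteq> cball (snd c p) (2 * d)"
      using q(2) by (simp add: cball_subset_cball_iff dist_commute)
    have "cball (snd c q) d \<subseteq> chart_im c" using sub dc by blast
    from chart_dist_lower[OF c(1) q(1) this \<kappa>(1) \<kappa>(2)[OF subsetD[OF sub]] q(3)]
    show ?thesis by blast
  qed
  have "comparable c p d \<kappa> C"
    unfolding comparable_def using d(1) \<kappa> C(1) dc upper lower by blast
  then show ?thesis using U' by blast
qed

text \<open>A point close in \<open>\<rho>\<close> is close in coordinates. This is what lets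
  \<open>\<rho>\<close> separate points and makes curves continuous for \<open>\<rho>\<close>
  continuous in the manifold topology.\<close>

lemma open_dist:
  assumes "open U" "p \<in> U"
  obtains e where "0 < e" "\<And>q. \<rho> p q < e \<Longrightarrow> q \<in> U"
proof -
  obtain c where c: "c \<in> A" "p \<in> fst c" using ex_chart by blast
  obtain d \<kappa> C where comp: "comparable c p d \<kappa> C" and U: "chart_inv c ` cball (snd c p) (2 * d) \<subseteq> U"
    using ex_comparable[OF c assms] by blast
  note d = comparableD[OF comp]
  show thesis
  proof (rule that[of "\<kappa> * d"])
    fix q assume q: "\<rho> p q < \<kappa> * d"
    then have *: "q \<in> fst c" "\<kappa> * dist (snd c p) (snd c q) \<le> \<rho> p q" using d(7)[OF c(2)] d(1) by auto
    then have "\<kappa> * dist (snd c p) (snd c q) < \<kappa> * d" using q by simp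
    then have "snd c q \<in> cball (snd c p) (2 * d)" using d(1,2) by simp
    then show "q \<in> U" using U chart_inv_chart[OF c(1) *(1)] by force
  qed (use d in simp)
qed

lemma rdist_self: "\<rho> x x = 0"
proof (rule antisym)
  obtain c where c: "c \<in> A" "x \<in> fst c" using ex_chart by blast
  have "\<rho> (chart_inv c (snd c x)) (chart_inv c (snd c x)) \<le> 0"
    by (rule dist_le_segment[OF c(1)]) (use c coord_norm_0[OF c(1)] in auto)
  then show "\<rho> x x \<le> 0" using chart_inv_chart[OF c] by simp
qed (rule rdist_nonneg)

lemma rdist_zero: "\<rho> x y = 0 \<longleftrightarrow> x = y"
proof
  assume 0: "\<rho> x y = 0"
  show "x = y"
  proof (rule ccontr)
    assume "x \<noteq> y"
    then obtain U where "open U" "x \<in> U" "y \<notin> U" using hausdorff by blast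
    then show False using open_dist[of U x] 0 by metis
  qed
qed (simp add: rdist_self)

sublocale M: Metric_space UNIV \<rho>
  by unfold_locales (auto simp: rdist_nonneg rdist_zero intro: rdist_commute rdist_triangle)

lemma continuous_within_dist:
  assumes "((\<lambda>s. \<rho> (x t) (x s)) \<longlongrightarrow> 0) (at t within I)"
  shows "continuous (at t within I) x"
  unfolding continuous_within
proof (rule topological_tendstoI)
  fix U assume "open U" "x t \<in> U"
  then obtain e where e: "0 < e" "\<And>q. \<rho> (x t) q < e \<Longrightarrow> q \<in> U" using open_dist by metis
  have "\<forall>\<^sub>F s in at t within I. \<rho> (x t) (x s) < e" using order_tendstoD(2)[OF assms e(1)] .
  then show "\<forall>\<^sub>F s in at t within I. x s \<in> U" by (rule eventually_mono) (use e in blast)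
qed

text \<open>The metric derivative is at most the speed: the coordinate segment from
  \<open>x u\<close> to \<open>x v\<close> is no longer than \<open>v - u\<close> times a bound for
  the norms of the difference quotient along it, and by joint continuity these are close to the norm
  of the velocity at \<open>x t\<close>.\<close>

lemma dist_straddle:
  assumes reg: "regular_at x t" and e: "0 < e"
  shows "\<exists>d>0. \<forall>u v. u \<le> t \<and> t \<le> v \<and> t - u < d \<and> v - t < d \<longrightarrow> \<rho> (x u) (x v) \<le> (speed x t + e) * (v - u)"
proof -
  obtain c where c: "c \<in> A" "x t \<in> fst c" using ex_chart by blast
  obtain w where w: "(snd c \<circ> x has_vector_derivative w) (at t)" and sp: "speed x t = coord_norm c (snd c (x t)) w"
    using regular_at_chart[OF reg c] by blast
  let ?z = "snd c (x t)"
  obtain r where r: "0 < r" "cball ?z r \<subseteq> chart_im c" using chart_cball[OF c] .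
  have op: "open (chart_im c \<times> (UNIV :: (real ^ 'n) set))" by (intro open_Times open_chart_im c) auto
  have "isCont (\<lambda>p. coord_norm c (fst p) (snd p)) (?z, w)"
    using continuous_coord_norm[OF c(1)] c op by (auto simp: continuous_on_eq_continuous_at)
  then obtain \<eta> where \<eta>: "0 < \<eta>" "\<And>p. dist p (?z, w) < \<eta> \<Longrightarrow>
      dist (coord_norm c (fst p) (snd p)) (coord_norm c ?z w) < e"
    using e unfolding continuous_at_eps_delta by (metis fst_conv snd_conv)
  have near: "coord_norm c z w' \<le> coord_norm c ?z w + e" if "dist z ?z < \<eta> / 2" "norm (w' - w) < \<eta> / 2" for z w'
  proof -
    have "dist (z, w') (?z, w) \<le> dist z ?z + dist w' w"
      unfolding dist_Pair_Pair by (rule sqrt_sum_squares_le_sum) auto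
    then have "dist (z, w') (?z, w) < \<eta>" using that by (simp add: dist_norm[of w' w])
    then show ?thesis using \<eta>(2)[of "(z, w')"] by (simp add: dist_real_def abs_less_iff)
  qed
  obtain d1 where d1: "0 < d1" "\<And>u v. u \<le> t \<Longrightarrow> t \<le> v \<Longrightarrow> t - u < d1 \<Longrightarrow> v - t < d1 \<Longrightarrow>
      norm ((snd c \<circ> x) v - (snd c \<circ> x) u - (v - u) *\<^sub>R w) \<le> \<eta> / 4 * (v - u)"
    using straddle[OF w, of "\<eta> / 4"] \<eta>(1) by auto
  \<comment> \<open>The ball has to fit both into the chart and into the region where
    \<open>near\<close> controls the norm.\<close>
  define b where "b = min r (\<eta> / 3)"
  have b: "0 < b" "b \<le> r" "b < \<eta> / 2" using r \<eta> by (auto simp: b_def)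
  have bc: "ball ?z b \<subseteq> chart_im c" using b r(2) by (auto simp: subset_iff)
  note xB = chart_inv_image[OF c(1) bc]
  have xt: "x t \<in> chart_inv c ` ball ?z b" using b c by (simp add: xB)
  then have "\<forall>\<^sub>F s in at t. x s \<in> chart_inv c ` ball ?z b"
    using reg open_image_chart_inv[OF c(1) open_ball bc] unfolding regular_at_def isCont_def
    by (auto dest: topological_tendstoD)
  then obtain d2 where d2: "0 < d2" "\<And>s. dist s t < d2 \<Longrightarrow> x s \<in> chart_inv c ` ball ?z b"
    using xt unfolding eventually_at by (metis UNIV_I)
  show ?thesis
  proof (intro exI[of _ "min d1 d2"] conjI allI impI)
    show "0 < min d1 d2" using d1 d2 by simp
    fix u v assume uv: "u \<le> t \<and> t \<le> v \<and> t - u < min d1 d2 \<and> v - t < min d1 d2"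
    show "\<rho> (x u) (x v) \<le> (speed x t + e) * (v - u)"
    proof (cases "u = v")
      case True
      then show ?thesis by (simp add: rdist_self)
    next
      case False
      then have pos: "0 < v - u" using uv by simp
      have xu: "x u \<in> fst c" "snd c (x u) \<in> ball ?z b" and xv: "x v \<in> fst c" "snd c (x v) \<in> ball ?z b"
        using d2(2)[of u] d2(2)[of v] uv unfolding xB by (auto simp: dist_real_def)
      let ?w = "(1 / (v - u)) *\<^sub>R (snd c (x v) - snd c (x u))"
      have wd: "snd c (x v) - snd c (x u) = (v - u) *\<^sub>R ?w" using pos by simp
      have "norm ((v - u) *\<^sub>R ?w - (v - u) *\<^sub>R w) \<le> \<eta> / 4 * (v - u)"
        using d1(2)[of u v] uv wd by simp
      then have "(v - u) * norm (?w - w) \<le> (v - u) * (\<eta> / 4)"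
        using pos by (simp only: scaleR_diff_right[symmetric] norm_scaleR) (simp add: mult.commute)
      then have "norm (?w - w) \<le> \<eta> / 4" using pos by (simp only: mult_le_cancel_left_pos)
      then have wn: "norm (?w - w) < \<eta> / 2" using \<eta>(1) by simp
      have seg: "closed_segment (snd c (x u)) (snd c (x v)) \<subseteq> ball ?z b"
        using xu xv by (intro closed_segment_subset) auto
      have "\<rho> (chart_inv c (snd c (x u))) (chart_inv c (snd c (x v))) \<le> (speed x t + e) * (v - u)"
      proof (rule dist_le_segment[OF c(1)])
        show "closed_segment (snd c (x u)) (snd c (x v)) \<subseteq> chart_im c" using seg r(2) b by (auto simp: subset_iff)
        fix z assume "z \<in> closed_segment (snd c (x u)) (snd c (x v))"
        then have z: "z \<in> ball ?z b" using seg by blast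
        then have zc: "z \<in> chart_im c" using r(2) b by auto
        have "coord_norm c z (snd c (x v) - snd c (x u)) = (v - u) * coord_norm c z ?w"
          using coord_norm_scale[OF c(1) zc, of "v - u" ?w] wd pos by simp
        also have "\<dots> \<le> (v - u) * (speed x t + e)"
          using near[of z ?w] z b wn pos sp by (intro mult_left_mono) (auto simp: dist_commute)
        finally show "coord_norm c z (snd c (x v) - snd c (x u)) \<le> (speed x t + e) * (v - u)"
          by (simp add: mult.commute)
      qed
      then show ?thesis using xu xv chart_inv_chart[OF c(1)] by simp
    qed
  qed
qed

section \<open>Lyapunov functions along solutions\<close>

text \<open>Passage from Lebesgue set integrals to the gauge integrals used in the
  estimates.\<close>

lemma abs_continuous_curveE:
  assumes "abs_continuous_curve A g x a b"
  obtains m where "m integrable_on {a..b}"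
    "\<And>s t. a \<le> s \<Longrightarrow> s \<le> t \<Longrightarrow> t \<le> b \<Longrightarrow> \<rho> (x s) (x t) \<le> integral {s..t} m"
proof -
  obtain m where m: "set_integrable lebesgue {a..b} m"
    and le: "\<And>s t. a \<le> s \<Longrightarrow> s \<le> t \<Longrightarrow> t \<le> b \<Longrightarrow> \<rho> (x s) (x t) \<le> (LINT \<tau>:{s..t}|lebesgue. m \<tau>)"
    using assms unfolding abs_continuous_curve_def by metis
  show thesis
  proof (rule that)
    show "m integrable_on {a..b}" by (rule set_lebesgue_integral_eq_integral(1)[OF m])
    fix s t assume st: "a \<le> s" "s \<le> t" "t \<le> b"
    have "set_integrable lebesgue {s..t} m" by (rule set_integrable_subset[OF m]) (use st in auto)
    then show "\<rho> (x s) (x t) \<le> integral {s..t} m"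
      using le[OF st] set_lebesgue_integral_eq_integral(2) by metis
  qed
qed

text \<open>The bounds are increments of an indefinite integral, which is continuous.\<close>

lemma tendsto_integral_increments:
  fixes e :: "real \<Rightarrow> 'b::real_normed_vector"
  assumes m: "m integrable_on {a..b}" and t: "t \<in> {a..b}" and \<delta>: "0 < \<delta>"
    and e: "\<And>s. a \<le> s \<Longrightarrow> s \<le> t \<Longrightarrow> t - s < \<delta> \<Longrightarrow> norm (e s) \<le> integral {s..t} m"
      "\<And>s. t \<le> s \<Longrightarrow> s \<le> b \<Longrightarrow> s - t < \<delta> \<Longrightarrow> norm (e s) \<le> integral {t..s} m"
  shows "(e \<longlongrightarrow> 0) (at t within {a..b})"
proof -
  define \<mu> where "\<mu> s = integral {a..s} m" for s
  have "continuous_on {a..b} \<mu>" unfolding \<mu>_def by (rule indefinite_integral_continuous_1[OF m])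
  then have "(\<mu> \<longlongrightarrow> \<mu> t) (at t within {a..b})" using t by (simp add: continuous_on_def)
  then have "((\<lambda>s. \<bar>\<mu> s - \<mu> t\<bar>) \<longlongrightarrow> \<bar>\<mu> t - \<mu> t\<bar>) (at t within {a..b})" by (intro tendsto_intros)
  then have lim: "((\<lambda>s. \<bar>\<mu> s - \<mu> t\<bar>) \<longlongrightarrow> 0) (at t within {a..b})" by simp
  have "norm (e s) \<le> \<bar>\<mu> s - \<mu> t\<bar>" if "s \<in> {a..b}" "\<bar>s - t\<bar> < \<delta>" for s
    using e[of s] integral_increment[OF m, of s t] integral_increment[OF m, of t s] that t
    by (cases "s \<le> t") (auto simp: \<mu>_def)
  then have "\<forall>\<^sub>F s in at t within {a..b}. norm (e s) \<le> \<bar>\<mu> s - \<mu> t\<bar>"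
    unfolding eventually_at using \<delta> by (auto simp: dist_real_def)
  then show ?thesis using lim by (rule Lim_null_comparison)
qed

lemma tendsto_rdist:
  fixes x :: "real \<Rightarrow> 'a"
  assumes m: "m integrable_on {a..b}"
    "\<And>s t. a \<le> s \<Longrightarrow> s \<le> t \<Longrightarrow> t \<le> b \<Longrightarrow> \<rho> (x s) (x t) \<le> integral {s..t} m"
    and t: "t \<in> {a..b}"
  shows "((\<lambda>s. \<rho> (x t) (x s)) \<longlongrightarrow> 0) (at t within {a..b})"
proof (rule tendsto_integral_increments[OF m(1) t zero_less_one])
  fix s assume "a \<le> s" "s \<le> t"
  then show "norm (\<rho> (x t) (x s)) \<le> integral {s..t} m"
    using m(2)[of s t] t rdist_nonneg[of "x t" "x s"] rdist_commute[of "x t" "x s"] by simp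
qed (use m(2) t rdist_nonneg in auto)

lemma abs_continuous_curve_continuous:
  assumes "abs_continuous_curve A g x a b"
  shows "continuous_on {a..b} x"
proof -
  obtain m where m: "m integrable_on {a..b}"
    "\<And>s t. a \<le> s \<Longrightarrow> s \<le> t \<Longrightarrow> t \<le> b \<Longrightarrow> \<rho> (x s) (x t) \<le> integral {s..t} m"
    using abs_continuous_curveE[OF assms] by blast
  show ?thesis
    unfolding continuous_on_eq_continuous_within
    by (intro ballI continuous_within_dist tendsto_rdist[OF m])
qed

abbreviation orbital_derivative :: "(real \<Rightarrow> 'a \<Rightarrow> real) \<Rightarrow> real \<Rightarrow> 'a \<Rightarrow> ('a, 'n) tangent \<Rightarrow> real"
  where "orbital_derivative V t y v \<equiv>
    vector_derivative (\<lambda>s. V s y) (at t within {0..}) + differential A (V t) y v"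

text \<open>The chain rule, with the total derivative split into its time and space directions. As
  \<open>t\<close> is positive, derivatives within \<open>{0..}\<close> are two-sided.\<close>

lemma time_space_derivative:
  assumes V: "C1_time_space A V" and t: "0 < t" and cont: "isCont x t" and vel: "has_velocity A x t v"
  shows "((\<lambda>s. V s (x s)) has_vector_derivative
    (orbital_derivative V t (x t) v)) (at t)"
proof -
  \<comment> \<open>The very chart that \<open>differential\<close> selects, so that both terms of
    the orbital derivative are read off from one total derivative.\<close>
  define c where "c = (SOME c. c \<in> A \<and> x t \<in> fst c)"
  have "c \<in> A \<and> x t \<in> fst c" unfolding c_def by (rule someI_ex) (use ex_chart in blast)
  then have c: "c \<in> A" "x t \<in> fst c" by auto
  let ?S = "{0..} \<times> chart_im c" and ?F = "\<lambda>(s, z). V s (chart_inv c z)" and ?z = "snd c (x t)"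
  obtain D where D: "\<And>p. p \<in> ?S \<Longrightarrow> (?F has_derivative blinfun_apply (D p)) (at p within ?S)"
    using V c unfolding C1_time_space_def by blast
  let ?D = "blinfun_apply (D (t, ?z))"
  have "open ({0::real<..} \<times> chart_im c)" by (intro open_Times open_chart_im c) auto
  then have "at (t, ?z) within ?S = at (t, ?z)"
    using t c by (intro at_within_open_subset[of _ "{0<..} \<times> chart_im c"]) auto
  then have der: "(?F has_derivative ?D) (at (t, ?z))"
    using D[of "(t, ?z)"] t c by simp
  have vc: "(snd c \<circ> x has_derivative (\<lambda>h. h *\<^sub>R v c)) (at t)"
    using has_velocity_chart(1)[OF cont vel c] by (simp add: has_vector_derivative_def)
  have curve: "((\<lambda>s. (s, snd c (x s))) has_derivative (\<lambda>h. (h, h *\<^sub>R v c))) (at t)"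
    using has_derivative_Pair[OF has_derivative_ident vc] by (simp add: o_def)
  have 1: "((\<lambda>s. ?F (s, snd c (x s))) has_derivative (\<lambda>h. ?D (h, h *\<^sub>R v c))) (at t)"
    using diff_chain_at[OF curve der] by (simp add: o_def)
  have "\<forall>\<^sub>F s in at t. x s \<in> fst c"
    using cont c open_chart[OF c(1)] unfolding isCont_def by (auto dest: topological_tendstoD)
  then have "\<forall>\<^sub>F s in at t. ?F (s, snd c (x s)) = V s (x s)"
    by (rule eventually_mono) (simp add: chart_inv_chart[OF c(1)])
  then have W: "((\<lambda>s. V s (x s)) has_derivative (\<lambda>h. ?D (h, h *\<^sub>R v c))) (at t)"
    by (rule has_derivative_transform_eventually[OF 1]) (use c in \<open>auto simp: chart_inv_chart\<close>)
  have "((\<lambda>s. (s, ?z)) has_derivative (\<lambda>h. (h, 0))) (at t)"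
    by (intro has_derivative_Pair has_derivative_ident has_derivative_const)
  from diff_chain_at[OF this der]
  have "((\<lambda>s. V s (x t)) has_derivative (\<lambda>h. ?D (h, 0))) (at t)"
    by (simp add: o_def chart_inv_chart[OF c])
  also have "(\<lambda>h. ?D (h, 0)) = (\<lambda>h. h *\<^sub>R ?D (1, 0))"
  proof
    fix h :: real
    have "(h, 0 :: real ^ 'n) = h *\<^sub>R (1, 0)" by simp
    then show "?D (h, 0) = h *\<^sub>R ?D (1, 0)" by (simp only: blinfun.scaleR_right)
  qed
  finally have "((\<lambda>s. V s (x t)) has_vector_derivative ?D (1, 0)) (at t)"
    by (simp add: has_vector_derivative_def)
  then have Vt: "vector_derivative (\<lambda>s. V s (x t)) (at t within {0..}) = ?D (1, 0)"
    using at_within_open_subset[of t "{0<..}" "{0..}"] t by (simp add: vector_derivative_at subset_iff)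
  have "((\<lambda>z. (t, z)) has_derivative (\<lambda>w. (0, w))) (at ?z)"
    by (intro has_derivative_Pair has_derivative_ident has_derivative_const)
  from diff_chain_at[OF this der]
  have "(V t \<circ> chart_inv c has_derivative (\<lambda>w. ?D (0, w))) (at ?z)"
    by (simp add: o_def)
  then have "frechet_derivative (V t \<circ> chart_inv c) (at ?z) = (\<lambda>w. ?D (0, w))"
    by (rule frechet_derivative_at[symmetric])
  then have Vx: "differential A (V t) (x t) v = ?D (0, v c)"
    unfolding differential_def Let_def c_def[symmetric] by simp
  have "?D (h, h *\<^sub>R v c) = h *\<^sub>R (?D (1, 0) + ?D (0, v c))" for h
  proof -
    have "(h, h *\<^sub>R v c) = h *\<^sub>R ((1, 0) + (0, v c))" by simp
    then show ?thesis by (simp only: blinfun.scaleR_right blinfun.add_right)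
  qed
  then show ?thesis
    using W by (simp add: has_vector_derivative_def Vt Vx)
qed

text \<open>A continuous derivative is bounded near \<open>(t, z0)\<close>, and the mean value
  inequality applies on the convex product of a time interval and a ball.\<close>

lemma time_space_locally_Lipschitz:
  assumes V: "C1_time_space A V" and c: "c \<in> A" "z0 \<in> chart_im c" and t: "0 \<le> t"
  shows "\<exists>r>0. \<exists>K\<ge>0. cball z0 r \<subseteq> chart_im c \<and> (\<forall>s s' z z'. 0 \<le> s \<and> 0 \<le> s' \<and> \<bar>s - t\<bar> < r \<and> \<bar>s' - t\<bar> < r \<and>
    dist z z0 < r \<and> dist z' z0 < r \<longrightarrow>
    \<bar>V s (chart_inv c z) - V s' (chart_inv c z')\<bar> \<le> K * (\<bar>s - s'\<bar> + dist z z'))"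
proof -
  let ?S = "{0..} \<times> chart_im c" and ?F = "\<lambda>(s, z). V s (chart_inv c z)"
  obtain D where D: "\<And>p. p \<in> ?S \<Longrightarrow> (?F has_derivative blinfun_apply (D p)) (at p within ?S)"
    and Dc: "continuous_on ?S D"
    using V c unfolding C1_time_space_def by blast
  have p: "(t, z0) \<in> ?S" using t c by auto
  obtain r1 where r1: "0 < r1" "\<And>p. p \<in> ?S \<Longrightarrow> dist p (t, z0) < r1 \<Longrightarrow> dist (D p) (D (t, z0)) < 1"
    using Dc p unfolding continuous_on_iff by (metis zero_less_one)
  obtain r2 where r2: "0 < r2" "cball z0 r2 \<subseteq> chart_im c"
    using open_chart_im[OF c(1)] c(2) open_contains_cball by blast
  define r where "r = min (r1 / 2) r2"
  have r: "0 < r" "r \<le> r1 / 2" "r \<le> r2" using r1 r2 by (auto simp: r_def)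
  define K where "K = norm (D (t, z0)) + 1"
  let ?B = "({0..} \<inter> ball t r) \<times> ball z0 r"
  have sub: "?B \<subseteq> ?S" using r2 r by auto
  have conv: "convex ?B" by (intro convex_Times convex_Int) auto
  have near: "onorm (blinfun_apply (D p)) \<le> K" if "p \<in> ?B" for p
  proof -
    have "dist p (t, z0) \<le> dist (fst p) t + dist (snd p) z0"
      by (cases p) (auto simp: dist_Pair_Pair intro: sqrt_sum_squares_le_sum)
    also have "\<dots> < r1" using that r by (auto simp: dist_commute)
    finally have "dist (D p) (D (t, z0)) < 1" using r1(2) that sub by blast
    then have "norm (D p) \<le> K" unfolding K_def dist_norm by norm
    then show ?thesis by (simp add: norm_blinfun.rep_eq)
  qed
  have "\<bar>V s (chart_inv c z) - V s' (chart_inv c z')\<bar> \<le> K * (\<bar>s - s'\<bar> + dist z z')"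
    if "0 \<le> s" "0 \<le> s'" "\<bar>s - t\<bar> < r" "\<bar>s' - t\<bar> < r" "dist z z0 < r" "dist z' z0 < r" for s s' z z'
  proof -
    have "(s, z) \<in> ?B" "(s', z') \<in> ?B" using that by (auto simp: dist_commute dist_real_def)
    then have "norm (?F (s, z) - ?F (s', z')) \<le> K * norm ((s, z) - (s', z'))"
      by (intro differentiable_bound[OF conv has_derivative_subset[OF D[OF subsetD[OF sub]] sub] near])
    also have "\<dots> \<le> K * (\<bar>s - s'\<bar> + dist z z')"
      by (intro mult_left_mono)
        (auto simp: K_def norm_Pair dist_norm intro: order_trans[OF sqrt_sum_squares_le_sum_abs])
    finally show ?thesis by simp
  qed
  then show ?thesis using r r2(2) by (intro exI[of _ r] conjI exI[of _ K]) (auto simp: K_def)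
qed

text \<open>The Lipschitz estimate bounds the increment by elapsed time plus coordinate
  displacement, and the latter is at most \<open>\<rho>\<close> divided by \<open>\<kappa>\<close>.
  The integrand \<open>M\<close> depends on the chart and constants at \<open>t\<close>, so global
  statements have to be patched from short intervals.\<close>

lemma time_space_curve_increments:
  assumes V: "C1_time_space A V" and a: "0 \<le> a" and x: "abs_continuous_curve A g x a b" and t: "t \<in> {a..b}"
  shows "\<exists>e>0. \<exists>M. M integrable_on {a..b} \<and> (\<forall>s s'. a \<le> s \<and> s \<le> s' \<and> s' \<le> b \<and> \<bar>s - t\<bar> < e \<and> \<bar>s' - t\<bar> < e \<longrightarrow>
    \<bar>V s' (x s') - V s (x s)\<bar> \<le> integral {s..s'} M)"
proof -
  obtain m where m: "m integrable_on {a..b}"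
    "\<And>s t. a \<le> s \<Longrightarrow> s \<le> t \<Longrightarrow> t \<le> b \<Longrightarrow> \<rho> (x s) (x t) \<le> integral {s..t} m"
    using abs_continuous_curveE[OF x] by blast
  obtain c where c: "c \<in> A" "x t \<in> fst c" using ex_chart by blast
  let ?z = "snd c (x t)"
  have "?z \<in> chart_im c" "0 \<le> t" using c t a by auto
  from time_space_locally_Lipschitz[OF V c(1) this]
  obtain r K where r: "0 < r" "cball ?z r \<subseteq> chart_im c" and K: "0 \<le> K" "\<And>s s' z z'. 0 \<le> s \<Longrightarrow> 0 \<le> s' \<Longrightarrow> \<bar>s - t\<bar> < r \<Longrightarrow> \<bar>s' - t\<bar> < r \<Longrightarrow>
    dist z ?z < r \<Longrightarrow> dist z' ?z < r \<Longrightarrow>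
    \<bar>V s (chart_inv c z) - V s' (chart_inv c z')\<bar> \<le> K * (\<bar>s - s'\<bar> + dist z z')" by metis
  have U: "open (chart_inv c ` ball ?z r)" using r by (intro open_image_chart_inv c) (auto simp: subset_iff)
  have "x t \<in> chart_inv c ` ball ?z r"
    using r c by (intro image_eqI[of _ _ ?z]) (auto simp: chart_inv_chart)
  from ex_comparable[OF c U this]
  obtain d \<kappa> C where comp: "comparable c (x t) d \<kappa> C" by blast
  note d = comparableD[OF comp]
  \<comment> \<open>Points within \<open>\<epsilon>\<close> of \<open>x t\<close> are less than
    \<open>\<kappa> * d\<close> apart, so that \<open>comparable\<close> applies between them, and
    their coordinates lie in the ball of radius \<open>d\<close> as well as in the Lipschitz ball of
    radius \<open>r\<close>.\<close>
  define \<epsilon> where "\<epsilon> = \<kappa> * min d (r / 2) / 2"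
  have \<epsilon>: "0 < \<epsilon>" "2 * \<epsilon> \<le> \<kappa> * d" "\<epsilon> < \<kappa> * d" "\<epsilon> / \<kappa> \<le> d" "\<epsilon> / \<kappa> < r"
    using d(1,2) r(1) by (auto simp: \<epsilon>_def min_def field_simps)
  have "((\<lambda>s. \<rho> (x t) (x s)) \<longlongrightarrow> 0) (at t within {a..b})"
    by (rule tendsto_rdist[OF m t])
  then have "\<forall>\<^sub>F s in at t within {a..b}. \<rho> (x t) (x s) < \<epsilon>" using \<epsilon>(1) by (rule order_tendstoD)
  then obtain e0 where e0: "0 < e0" "\<And>s. s \<in> {a..b} \<Longrightarrow> s \<noteq> t \<Longrightarrow> dist s t < e0 \<Longrightarrow> \<rho> (x t) (x s) < \<epsilon>"
    unfolding eventually_at by blast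
  have xs: "\<rho> (x t) (x s) < \<epsilon>" if "s \<in> {a..b}" "\<bar>s - t\<bar> < e0" for s
    using e0(2)[of s] that \<epsilon>(1) by (cases "s = t") (auto simp: rdist_self dist_real_def)
  have loc: "x s \<in> fst c \<and> dist ?z (snd c (x s)) \<le> \<epsilon> / \<kappa>" if s: "s \<in> {a..b}" "\<bar>s - t\<bar> < e0" for s
  proof -
    have "x s \<in> fst c \<and> \<kappa> * dist ?z (snd c (x s)) \<le> \<rho> (x t) (x s)"
      by (rule d(7)[OF c(2)]) (use xs[OF s] \<epsilon> d in auto)
    then show ?thesis using xs[OF s] d(2) by (simp add: pos_le_divide_eq mult.commute)
  qed
  define M where "M s = K * (1 + m s / \<kappa>)" for s
  have M: "M integrable_on {u..v}" "integral {u..v} M = K * ((v - u) + integral {u..v} m / \<kappa>)"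
    if "a \<le> u" "u \<le> v" "v \<le> b" for u v
  proof -
    have mi: "(m has_integral integral {u..v} m) {u..v}"
      by (rule integrable_integral[OF integrable_subinterval_real[OF m(1)]]) (use that in auto)
    have "((\<lambda>s. 1 + m s / \<kappa>) has_integral ((v - u) + integral {u..v} m / \<kappa>)) {u..v}"
      using that by (intro has_integral_add has_integral_divide mi) (use has_integral_const_real[of "1::real" u v] in auto)
    then have "(M has_integral K * ((v - u) + integral {u..v} m / \<kappa>)) {u..v}"
      unfolding M_def by (rule has_integral_mult_right)
    then show "M integrable_on {u..v}" "integral {u..v} M = K * ((v - u) + integral {u..v} m / \<kappa>)"
      by (auto simp: integral_unique)
  qed
  show ?thesis
  proof (intro exI[of _ "min e0 r"] exI[of _ M] conjI allI impI)
    show "0 < min e0 r" using e0 r by simp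
    show "M integrable_on {a..b}" using M(1)[of a b] t by simp
    fix s s' assume ss: "a \<le> s \<and> s \<le> s' \<and> s' \<le> b \<and> \<bar>s - t\<bar> < min e0 r \<and> \<bar>s' - t\<bar> < min e0 r"
    have 1: "x s \<in> fst c" "dist ?z (snd c (x s)) \<le> \<epsilon> / \<kappa>" and 2: "x s' \<in> fst c" "dist ?z (snd c (x s')) \<le> \<epsilon> / \<kappa>"
      using loc[of s] loc[of s'] ss by auto
    have "\<rho> (x s) (x s') \<le> \<rho> (x s) (x t) + \<rho> (x t) (x s')" by (rule rdist_triangle)
    also have "\<dots> < 2 * \<epsilon>" using xs[of s] xs[of s'] ss rdist_commute[of "x s" "x t"] by auto
    finally have "\<rho> (x s) (x s') < \<kappa> * d" using \<epsilon> by simp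
    then have "\<kappa> * dist (snd c (x s)) (snd c (x s')) \<le> \<rho> (x s) (x s')"
      using d(7)[OF 1(1)] 1(2) \<epsilon>(4) by auto
    also have "\<dots> \<le> integral {s..s'} m" using m(2) ss by blast
    finally have D: "dist (snd c (x s)) (snd c (x s')) \<le> integral {s..s'} m / \<kappa>"
      using d(2) by (simp add: pos_le_divide_eq mult.commute)
    have "\<bar>V s' (chart_inv c (snd c (x s'))) - V s (chart_inv c (snd c (x s)))\<bar>
        \<le> K * (\<bar>s' - s\<bar> + dist (snd c (x s')) (snd c (x s)))"
      by (rule K(2)) (use ss a 1(2) 2(2) \<epsilon>(5) in \<open>auto simp: dist_commute\<close>)
    also have "\<dots> \<le> K * ((s' - s) + integral {s..s'} m / \<kappa>)"
      using K(1) D ss by (intro mult_left_mono) (auto simp: dist_commute)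
    also have "\<dots> = integral {s..s'} M" using M(2) ss by simp
    finally show "\<bar>V s' (x s') - V s (x s)\<bar> \<le> integral {s..s'} M"
      using 1 2 chart_inv_chart[OF c(1)] by simp
  qed
qed

lemma time_space_curve_continuous:
  assumes V: "C1_time_space A V" and a: "0 \<le> a" and x: "abs_continuous_curve A g x a b"
  shows "continuous_on {a..b} (\<lambda>s. V s (x s))"
  unfolding continuous_on_def
proof
  fix t assume t: "t \<in> {a..b}"
  obtain e M where e: "0 < e" and M: "M integrable_on {a..b}" "\<And>s s'. a \<le> s \<Longrightarrow> s \<le> s' \<Longrightarrow> s' \<le> b \<Longrightarrow> \<bar>s - t\<bar> < e \<Longrightarrow> \<bar>s' - t\<bar> < e \<Longrightarrow>
    \<bar>V s' (x s') - V s (x s)\<bar> \<le> integral {s..s'} M"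
    using time_space_curve_increments[OF V a x t] by metis
  have "((\<lambda>s. V s (x s) - V t (x t)) \<longlongrightarrow> 0) (at t within {a..b})"
    by (rule tendsto_integral_increments[OF M(1) t e])
      (use M(2)[of _ t] M(2)[of t] t e in \<open>auto simp: abs_minus_commute\<close>)
  then show "((\<lambda>s. V s (x s)) \<longlongrightarrow> V t (x t)) (at t within {a..b})"
    by (simp add: LIM_zero_iff)
qed

text \<open>On short intervals \<open>AC_increment_le_integral\<close> applies with the constant
  integrand \<open>k\<close> and the local majorant \<open>M\<close>; \<open>Bolzano\<close> adds up
  the pieces.\<close>

lemma time_space_curve_decrease:
  assumes V: "C1_time_space A V" and a: "0 \<le> a" and ab: "a \<le> b" and x: "abs_continuous_curve A g x a b"
    and N: "negligible N"
    and vel: "\<And>t. t \<in> {a<..<b} - N \<Longrightarrow> has_velocity A x t (v t)"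
    and k: "\<And>t. t \<in> {a<..<b} - N \<Longrightarrow>
      orbital_derivative V t (x t) (v t) \<le> k"
  shows "V b (x b) - V a (x a) \<le> k * (b - a)"
proof -
  define lo hi where "lo = a" and "hi = b"
  have cont: "continuous_on {lo..hi} x" unfolding lo_def hi_def by (rule abs_continuous_curve_continuous[OF x])
  \<comment> \<open>Velocities are given in the open interval only, so its ends join the exceptional
    set.\<close>
  have N': "negligible (N \<union> {lo, hi})" by (intro negligible_Un N) (simp add: negligible_finite)
  have str: "\<exists>d>0. \<forall>u v. u \<le> t \<and> t \<le> v \<and> t - u < d \<and> v - t < d \<longrightarrow>
        V v (x v) - V u (x u) \<le> (k + e) * (v - u)" if t: "t \<in> {lo..hi} - (N \<union> {lo, hi})" and e: "0 < e" for t e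
  proof -
    have t': "t \<in> {a<..<b} - N" "0 < t" using t a by (auto simp: lo_def hi_def)
    then have "isCont x t" using cont by (intro continuous_on_interior[OF cont]) (auto simp: lo_def hi_def)
    from straddle[OF time_space_derivative[OF V t'(2) this vel[OF t'(1)]] e]
    obtain d where d: "0 < d" "\<And>u w. u \<le> t \<Longrightarrow> t \<le> w \<Longrightarrow> t - u < d \<Longrightarrow> w - t < d \<Longrightarrow>
      norm (V w (x w) - V u (x u) - (w - u) *\<^sub>R (orbital_derivative V t (x t) (v t))) \<le> e * (w - u)"
      by metis
    show ?thesis
    proof (intro exI[of _ d] conjI allI impI d)
      fix u w assume uw: "u \<le> t \<and> t \<le> w \<and> t - u < d \<and> w - t < d"
      let ?w = "orbital_derivative V t (x t) (v t)"
      have "V w (x w) - V u (x u) - (w - u) * ?w \<le> e * (w - u)"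
        using d(2)[of u w] uw by (simp add: abs_le_iff)
      moreover have "(w - u) * ?w \<le> (w - u) * k" using k[OF t'(1)] uw by (intro mult_left_mono) auto
      ultimately show "V w (x w) - V u (x u) \<le> (k + e) * (w - u)" by (simp add: algebra_simps)
    qed
  qed
  have "lo \<le> a \<and> b \<le> hi \<longrightarrow> V b (x b) - V a (x a) \<le> k * (b - a)"
    using ab
  proof (induction rule: Bolzano)
    case (trans u v w)
    then show ?case by (auto simp: algebra_simps)
  next
    case (local t)
    then have "t \<in> {lo..hi}" by (simp add: lo_def hi_def)
    then obtain e M where e: "0 < e" and M: "M integrable_on {lo..hi}" "\<And>s s'. lo \<le> s \<Longrightarrow> s \<le> s' \<Longrightarrow> s' \<le> hi \<Longrightarrow> \<bar>s - t\<bar> < e \<Longrightarrow> \<bar>s' - t\<bar> < e \<Longrightarrow>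
        \<bar>V s' (x s') - V s (x s)\<bar> \<le> integral {s..s'} M"
      using time_space_curve_increments[OF V a x] unfolding lo_def hi_def by metis
    show ?case
    proof (intro exI[of _ e] conjI allI impI e)
      fix u w assume uw: "u \<le> t \<and> t \<le> w \<and> w - u < e" "lo \<le> u \<and> w \<le> hi"
      have "V w (x w) - V u (x u) \<le> integral {u..w} (\<lambda>_. k)"
      proof (rule AC_increment_le_integral[where m = M, OF _ _ _ N'])
        show "u \<le> w" using uw by simp
        show "M integrable_on {u..w}" by (rule integrable_subinterval_real[OF M(1)]) (use uw in auto)
        show "V t (x t) - V s (x s) \<le> integral {s..t} M" if "u \<le> s" "s \<le> t" "t \<le> w" for s t
        proof -
          have "\<bar>V t (x t) - V s (x s)\<bar> \<le> integral {s..t} M"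
            by (rule M(2)) (use that uw in auto)
          then show ?thesis by simp
        qed
        show "\<exists>d>0. \<forall>ua v. u \<le> ua \<and> ua \<le> t \<and> t \<le> v \<and> v \<le> w \<and> t - ua < d \<and> v - t < d \<longrightarrow>
          V v (x v) - V ua (x ua) \<le> (k + e) * (v - ua)" if "t \<in> {u..w} - (N \<union> {lo, hi})" "0 < e" for t e
          using str[of t e] that uw by auto
      qed auto
      also have "\<dots> = k * (w - u)" using uw by simp
      finally show "V w (x w) - V u (x u) \<le> k * (w - u)" .
    qed
  qed
  then show ?thesis by (simp add: lo_def hi_def)
qed

section \<open>Decay along solutions and the gain functions\<close>

lemma solution_decay:
  fixes f :: "('a, 'n, 'm::finite) control_system"
  assumes Lyap: "ISS_Lyapunov A g xs f V \<alpha>1 \<alpha>2 \<alpha>3 \<alpha>4" and K: "class_K_inf \<alpha>2"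
    and t0: "0 \<le> t0" and sol: "is_solution A g f u t0 T x"
    and r: "0 \<le> r" "negligible {t \<in> {t0..}. \<not> norm (u t) \<le> r}"
    and t: "t0 \<le> t" "ereal t < T" and big: "\<alpha>2 (\<alpha>4 r) < V t (x t)"
  shows "\<exists>q\<ge>0. V t (x t) = \<alpha>2 q \<and> \<alpha>2 q + (t - t0) * \<alpha>3 q \<le> \<alpha>2 (\<rho> (x t0) xs)"
proof -
  have V: "C1_time_space A V" and K3: "class_K \<alpha>3" and K4: "class_K \<alpha>4" and K2: "class_K \<alpha>2" and K1: "class_K \<alpha>1"
    and V1: "\<And>t y. 0 \<le> t \<Longrightarrow> \<alpha>1 (\<rho> y xs) \<le> V t y"
    and V2: "\<And>t y. 0 \<le> t \<Longrightarrow> V t y \<le> \<alpha>2 (\<rho> y xs)"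
    and dV: "\<And>t y u. 0 \<le> t \<Longrightarrow> \<alpha>4 (norm u) \<le> \<rho> y xs \<Longrightarrow>
        orbital_derivative V t y (f t y u) \<le> - \<alpha>3 (\<rho> y xs)"
    using Lyap unfolding ISS_Lyapunov_def by blast+
  define N where "N = {s. \<not> (t0 < s \<and> ereal s < T \<longrightarrow> has_velocity A x s (f s (x s) (u s)))} \<union> {s \<in> {t0..}. \<not> norm (u s) \<le> r}"
  have N: "negligible N"
    unfolding N_def using sol r by (intro negligible_Un) (auto simp: is_solution_def AE_lebesgue_iff_negligible)
  have ac: "abs_continuous_curve A g x a b" if "t0 \<le> a" "a \<le> b" "b \<le> t" for a b
  proof -
    have "ereal b < T" using that t(2) by (meson ereal_less_eq(3) le_less_trans)
    then show ?thesis using sol that by (simp add: is_solution_def)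
  qed
  have \<alpha>4r: "0 \<le> \<alpha>4 r" using class_KD(4)[OF K4 r(1)] .
  \<comment> \<open>Used with \<open>k = 0\<close> for monotonicity and with \<open>k = q\<close>
    for decay at a linear rate.\<close>
  have decr: "V b (x b) - V a (x a) \<le> (- \<alpha>3 k) * (b - a)"
    if ab: "t0 \<le> a" "a \<le> b" "b \<le> t" and k: "0 \<le> k" "\<And>s. s \<in> {a<..<b} \<Longrightarrow> k \<le> \<rho> (x s) xs \<and> \<alpha>4 r \<le> \<rho> (x s) xs" for a b k
  proof (rule time_space_curve_decrease[OF V _ ab(2) ac[OF ab] N])
    show "0 \<le> a" using ab t0 by simp
    fix s assume s: "s \<in> {a<..<b} - N"
    have "ereal s < T" using s ab t(2) by (meson DiffD1 ereal_less_eq(3) greaterThanLessThan_iff le_less_trans less_imp_le order_trans)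
    then show "has_velocity A x s (f s (x s) (u s))" using s ab by (auto simp: N_def)
    have ns: "norm (u s) \<le> r" using s ab by (auto simp: N_def)
    have "\<alpha>4 (norm (u s)) \<le> \<rho> (x s) xs"
      using class_KD(3)[OF K4, of "norm (u s)" r] ns r(1) k(2)[of s] s by auto
    then have "orbital_derivative V s (x s) (f s (x s) (u s)) \<le> - \<alpha>3 (\<rho> (x s) xs)"
      using s ab t0 by (intro dV) auto
    also have "\<dots> \<le> - \<alpha>3 k" using class_KD(3)[OF K3 k(1) rdist_nonneg, of "x s" xs] k(2)[of s] s by auto
    finally show "orbital_derivative V s (x s) (f s (x s) (u s)) \<le> - \<alpha>3 k" .
  qed
  have mono: "V t (x t) \<le> V \<tau> (x \<tau>)" if \<tau>: "\<tau> \<in> {t0..t}" for \<tau>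
  proof (rule ccontr)
    assume less: "\<not> V t (x t) \<le> V \<tau> (x \<tau>)"
    \<comment> \<open>Suppose the value at \<open>\<tau>\<close> were lower. After the last time
      \<open>\<sigma>\<close> with value at most \<open>y\<close> the function exceeds the threshold
      \<open>\<alpha>2 (\<alpha>4 r)\<close>, so it cannot increase from \<open>\<sigma>\<close> to
      \<open>t\<close>; yet it would have to rise from at most \<open>y\<close> to above
      \<open>y\<close>.\<close>
    define y where "y = max (\<alpha>2 (\<alpha>4 r)) (V \<tau> (x \<tau>))"
    have y: "y < V t (x t)" using less big by (simp add: y_def)
    have cont: "continuous_on {\<tau>..t} (\<lambda>s. V s (x s))"
      by (rule time_space_curve_continuous[OF V _ ac]) (use \<tau> t0 in auto)
    define S where "S = {\<tau>..t} \<inter> (\<lambda>s. V s (x s)) -` {..y}"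
    have "closed S" unfolding S_def by (rule continuous_closed_preimage[OF cont]) auto
    then have "compact S"
      by (metis S_def bounded_closed_interval bounded_Int compact_eq_bounded_closed)
    moreover have "\<tau> \<in> S" using \<tau> by (auto simp: S_def y_def)
    ultimately obtain \<sigma> where \<sigma>: "\<sigma> \<in> S" "\<And>s. s \<in> S \<Longrightarrow> s \<le> \<sigma>" using compact_attains_sup by (metis empty_iff)
    have \<sigma>': "\<tau> \<le> \<sigma>" "\<sigma> \<le> t" "V \<sigma> (x \<sigma>) \<le> y" using \<sigma>(1) by (auto simp: S_def)
    have "V t (x t) - V \<sigma> (x \<sigma>) \<le> (- \<alpha>3 0) * (t - \<sigma>)"
    proof (rule decr)
      fix s assume s: "s \<in> {\<sigma><..<t}"
      then have "s \<notin> S" using \<sigma>(2)[of s] by auto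
      then have "y < V s (x s)" using s \<sigma>' by (auto simp: S_def)
      then have "\<alpha>2 (\<alpha>4 r) < V s (x s)" by (simp add: y_def)
      also have "\<dots> \<le> \<alpha>2 (\<rho> (x s) xs)" using s \<sigma>' \<tau> t0 by (intro V2) auto
      finally have "\<alpha>4 r < \<rho> (x s) xs" using class_KD(2)[OF K2 \<alpha>4r rdist_nonneg] by blast
      then show "0 \<le> \<rho> (x s) xs \<and> \<alpha>4 r \<le> \<rho> (x s) xs" by (simp add: rdist_nonneg)
    qed (use \<sigma>' \<tau> in auto)
    then show False using y \<sigma>' class_KD(5)[OF K3] by simp
  qed
  have "0 \<le> V t (x t)" using V1[of t "x t"] class_KD(4)[OF K1 rdist_nonneg[of "x t" xs]] t t0 by simp
  \<comment> \<open>\<open>q\<close> is the inverse of \<open>\<alpha>2\<close> at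
    \<open>V t (x t)\<close>; by \<open>mono\<close> it bounds the distance to \<open>xs\<close>
    from below throughout the interior of \<open>[t0, t]\<close>.\<close>
  then obtain q where q: "0 \<le> q" "\<alpha>2 q = V t (x t)" using class_K_inf_surj[OF K] by blast
  have qr: "\<alpha>4 r < q" using big q class_KD(2)[OF K2 \<alpha>4r q(1)] by simp
  have "V t (x t) - V t0 (x t0) \<le> (- \<alpha>3 q) * (t - t0)"
  proof (rule decr)
    fix s assume s: "s \<in> {t0<..<t}"
    have "\<alpha>2 q \<le> V s (x s)" using mono[of s] s q by simp
    also have "\<dots> \<le> \<alpha>2 (\<rho> (x s) xs)" using s t0 by (intro V2) auto
    finally have "q \<le> \<rho> (x s) xs" using class_KD(3)[OF K2 q(1) rdist_nonneg] by blast
    then show "q \<le> \<rho> (x s) xs \<and> \<alpha>4 r \<le> \<rho> (x s) xs" using qr by simp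
  qed (use t q in auto)
  then show ?thesis
    using q V2[of t0 "x t0"] t0 by (intro exI[of _ q]) (auto simp: algebra_simps)
qed

text \<open>\<open>\<iota>\<close> is the inverse of \<open>\<alpha>2\<close> composed with
  \<open>\<alpha>1\<close>. With \<open>\<alpha>1 p = \<alpha>2 q\<close>, hence
  \<open>\<iota> p = q\<close>, the inequality of \<open>solution_decay\<close> reads
  \<open>\<alpha>1 p + (t - t0) * \<alpha>3 (\<iota> p) \<le> \<alpha>2 (\<rho> (x t0) xs)\<close>.
  Its left-hand side increases with \<open>p\<close>, so \<open>p\<close> is at most the root
  \<open>\<beta>\<close>. If the current value of \<open>V\<close> is at most
  \<open>\<alpha>2 (\<alpha>4 r)\<close>, the distance is bounded by \<open>\<gamma>\<close>, the
  inverse of \<open>\<alpha>1\<close> composed with \<open>\<alpha>2\<close> and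
  \<open>\<alpha>4\<close>. Each case uses one summand, the other being nonnegative.\<close>

lemma ISS_gains:
  fixes f :: "('a, 'n, 'm::finite) control_system"
  assumes Lyap: "ISS_Lyapunov A g xs f V \<alpha>1 \<alpha>2 \<alpha>3 \<alpha>4" and Kinf: "class_K_inf \<alpha>1" "class_K_inf \<alpha>2"
  shows "\<exists>\<beta> \<gamma>. class_KL \<beta> \<and> class_K \<gamma> \<and> (\<forall>t0\<ge>0. \<forall>u\<in>Linf. \<forall>T x t. is_solution A g f u t0 T x \<and> t0 \<le> t \<and> ereal t < T \<longrightarrow>
    \<rho> (x t) xs \<le> \<beta> (\<rho> (x t0) xs) (t - t0) + \<gamma> (real_of_ereal (Linf_norm_from t0 u)))"
proof -
  have K: "class_K \<alpha>1" "class_K \<alpha>2" "class_K \<alpha>3" "class_K \<alpha>4"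
    and V1: "\<And>t y. 0 \<le> t \<Longrightarrow> \<alpha>1 (\<rho> y xs) \<le> V t y"
    using Lyap unfolding ISS_Lyapunov_def by blast+
  obtain \<iota> where \<iota>: "class_K \<iota>" "\<And>s. 0 \<le> s \<Longrightarrow> 0 \<le> \<iota> s \<and> \<alpha>2 (\<iota> s) = \<alpha>1 s"
    using class_K_inf_root[OF Kinf(2) K(1)] by blast
  obtain \<beta> where \<beta>: "class_KL \<beta>" and \<beta>': "\<And>s t. 0 \<le> s \<Longrightarrow> 0 \<le> t \<Longrightarrow> 0 \<le> \<beta> s t \<and> \<alpha>1 (\<beta> s t) + t * \<alpha>3 (\<iota> (\<beta> s t)) = \<alpha>2 s"
    using class_KL_root[OF Kinf(1) class_K_compose[OF K(3) \<iota>(1)] K(2)] by blast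
  obtain \<gamma> where \<gamma>: "class_K \<gamma>" and \<gamma>': "\<And>s. 0 \<le> s \<Longrightarrow> 0 \<le> \<gamma> s \<and> \<alpha>1 (\<gamma> s) = \<alpha>2 (\<alpha>4 s)"
    using class_K_inf_root[OF Kinf(1) class_K_compose[OF K(2,4)]] by blast
  have est: "\<rho> (x t) xs \<le> \<beta> (\<rho> (x t0) xs) (t - t0) + \<gamma> (real_of_ereal (Linf_norm_from t0 u))"
    if t0: "0 \<le> t0" and u: "u \<in> Linf" and sol: "is_solution A g f u t0 T x" and t: "t0 \<le> t" "ereal t < T" for t0 u T x t
  proof -
    define r where "r = real_of_ereal (Linf_norm_from t0 u)"
    note r = Linf_norm_bound[OF u t0, folded r_def]
    let ?b = "\<beta> (\<rho> (x t0) xs) (t - t0)"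
    have b: "0 \<le> ?b" "\<alpha>1 ?b + (t - t0) * \<alpha>3 (\<iota> ?b) = \<alpha>2 (\<rho> (x t0) xs)"
      using \<beta>'[of "\<rho> (x t0) xs" "t - t0"] t rdist_nonneg by auto
    have V: "\<alpha>1 (\<rho> (x t) xs) \<le> V t (x t)" using t t0 by (intro V1) auto
    show ?thesis
    proof (cases "V t (x t) \<le> \<alpha>2 (\<alpha>4 r)")
      case True
      then have "\<alpha>1 (\<rho> (x t) xs) \<le> \<alpha>1 (\<gamma> r)" using V \<gamma>'[OF r(1)] by simp
      then have "\<rho> (x t) xs \<le> \<gamma> r" using class_KD(3)[OF K(1) rdist_nonneg] \<gamma>'[OF r(1)] by blast
      then show ?thesis using b(1) by (simp add: r_def)
    next
      case False
      then obtain q where q: "0 \<le> q" "V t (x t) = \<alpha>2 q" "\<alpha>2 q + (t - t0) * \<alpha>3 q \<le> \<alpha>2 (\<rho> (x t0) xs)"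
        using solution_decay[OF Lyap Kinf(2) t0 sol r t] by auto
      obtain p where p: "0 \<le> p" "\<alpha>1 p = \<alpha>2 q" using class_K_inf_surj[OF Kinf(1)] class_KD(4)[OF K(2) q(1)] by blast
      have "\<alpha>2 (\<iota> p) = \<alpha>2 q" using \<iota>(2)[OF p(1)] p(2) by simp
      then have \<iota>p: "\<iota> p = q" using class_KD(3)[OF K(2)] \<iota>(2)[OF p(1)] q(1) by (metis order_antisym order_refl)
      have "p \<le> ?b"
      proof (rule ccontr)
        assume "\<not> p \<le> ?b"
        then have pb: "?b < p" by simp
        then have "\<alpha>1 ?b < \<alpha>1 p" using class_KD(2)[OF K(1) b(1) p(1)] by simp
        moreover have "\<alpha>3 (\<iota> ?b) \<le> \<alpha>3 (\<iota> p)"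
          using class_KD(3)[OF class_K_compose[OF K(3) \<iota>(1)] b(1) p(1)] pb by simp
        then have "(t - t0) * \<alpha>3 (\<iota> ?b) \<le> (t - t0) * \<alpha>3 (\<iota> p)" using t by (intro mult_left_mono) auto
        ultimately show False using b(2) q(3) p(2) \<iota>p by simp
      qed
      moreover have "\<rho> (x t) xs \<le> p" using class_KD(3)[OF K(1) rdist_nonneg p(1)] V q(2) p(2) by simp
      ultimately show ?thesis using \<gamma>'[OF r(1)] by (simp add: r_def)
    qed
  qed
  show ?thesis by (intro exI[of _ \<beta>] exI[of _ \<gamma>] conjI \<beta> \<gamma>) (use est in blast)
qed

section \<open>Extension of bounded solutions\<close>

lemma has_velocity_cong:
  assumes "has_velocity A x t v" and ev: "\<forall>\<^sub>F s in nhds t. x' s = x s"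
  shows "has_velocity A x' t v"
proof -
  have xt: "x' t = x t" using eventually_nhds_x_imp_x[OF ev] .
  obtain c w where c: "c \<in> A" "x t \<in> fst c" "(snd c \<circ> x has_vector_derivative w) (at t)" "v = tangent_of_coords A c (x t) w"
    using assms(1) unfolding has_velocity_def by blast
  have "\<forall>\<^sub>F s in nhds t. s \<in> UNIV \<longrightarrow> (snd c \<circ> x) s = (snd c \<circ> x') s"
    using ev by (auto elim: eventually_mono)
  then have "(snd c \<circ> x' has_vector_derivative w) (at t)"
    using has_vector_derivative_cong_ev[where f = "snd c \<circ> x" and g = "snd c \<circ> x'" and x = t and S = UNIV] xt c(3)
    by simp
  then show ?thesis using has_velocityI[of c x' t w] c xt by simp
qed

text \<open>The majorant that comes with absolute continuity is replaced by the bound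
  \<open>J\<close> on the speed: the distance from \<open>x a\<close> is absolutely continuous along
  the curve, and \<open>dist_straddle\<close> controls its increments around regular times.\<close>

lemma speed_bound_dist:
  assumes ab: "a \<le> b" and x: "abs_continuous_curve A g x a b" and N: "negligible N" and J: "J integrable_on {a..b}"
    and vel: "\<And>t. t \<in> {a<..<b} - N \<Longrightarrow> \<exists>v. has_velocity A x t v \<and> tangent_norm g (x t) v \<le> J t"
  shows "\<rho> (x a) (x b) \<le> integral {a..b} J"
proof -
  obtain m where m: "m integrable_on {a..b}"
    "\<And>s t. a \<le> s \<Longrightarrow> s \<le> t \<Longrightarrow> t \<le> b \<Longrightarrow> \<rho> (x s) (x t) \<le> integral {s..t} m"
    using abs_continuous_curveE[OF x] by blast
  have cont: "continuous_on {a..b} x" by (rule abs_continuous_curve_continuous[OF x])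
  have N': "negligible (N \<union> {a, b})" by (intro negligible_Un N) (simp add: negligible_finite)
  have tri: "\<rho> (x a) (x t) - \<rho> (x a) (x s) \<le> \<rho> (x s) (x t)" for s t
    using rdist_triangle[of "x a" "x t" "x s"] by simp
  have "\<rho> (x a) (x b) - \<rho> (x a) (x a) \<le> integral {a..b} J"
  proof (rule AC_increment_le_integral[OF ab m(1) _ N' J])
    show "\<rho> (x a) (x t) - \<rho> (x a) (x s) \<le> integral {s..t} m" if "a \<le> s" "s \<le> t" "t \<le> b" for s t
      using tri[of t s] m(2)[OF that] by simp
    fix t e :: real assume t: "t \<in> {a..b} - (N \<union> {a, b})" and e: "0 < e"
    then have t': "t \<in> {a<..<b} - N" by auto
    then have ct: "isCont x t" by (intro continuous_on_interior[OF cont]) auto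
    obtain v where v: "has_velocity A x t v" "tangent_norm g (x t) v \<le> J t" using vel[OF t'] by blast
    have reg: "regular_at x t" using ct v by (auto simp: regular_at_def)
    have sp: "speed x t \<le> J t" using velocity_eq[OF ct v(1)] v(2) by (simp add: speed_def)
    obtain d where d: "0 < d" "\<And>u v. u \<le> t \<Longrightarrow> t \<le> v \<Longrightarrow> t - u < d \<Longrightarrow> v - t < d \<Longrightarrow> \<rho> (x u) (x v) \<le> (speed x t + e) * (v - u)"
      using dist_straddle[OF reg e] by metis
    show "\<exists>d>0. \<forall>u v. a \<le> u \<and> u \<le> t \<and> t \<le> v \<and> v \<le> b \<and> t - u < d \<and> v - t < d \<longrightarrow>
        \<rho> (x a) (x v) - \<rho> (x a) (x u) \<le> (J t + e) * (v - u)"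
    proof (intro exI[of _ d] conjI allI impI d(1))
      fix u v assume uv: "a \<le> u \<and> u \<le> t \<and> t \<le> v \<and> v \<le> b \<and> t - u < d \<and> v - t < d"
      have "\<rho> (x a) (x v) - \<rho> (x a) (x u) \<le> (speed x t + e) * (v - u)"
        using tri[of v u] d(2)[of u v] uv by simp
      also have "\<dots> \<le> (J t + e) * (v - u)" using sp uv by (intro mult_right_mono) auto
      finally show "\<rho> (x a) (x v) - \<rho> (x a) (x u) \<le> (J t + e) * (v - u)" .
    qed
  qed
  then show ?thesis by (simp add: rdist_self)
qed

lemma assumption_A_bound:
  fixes f :: "('a, 'n, 'm::finite) control_system"
  assumes ass: "assumption_A A g xs f" and R: "0 < R" and u: "u \<in> Linf"
  shows "\<exists>I. (\<forall>t. 0 \<le> I t) \<and> (\<forall>b. I integrable_on {0..b}) \<and>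
    negligible {t \<in> {0..}. \<not> (\<forall>y. \<rho> y xs \<le> R \<longrightarrow> tangent_norm g y (f t y (u t)) \<le> I t)}"
proof -
  \<comment> \<open>Assumption (A) asks for a positive bound on the input, hence the summand
    \<open>1\<close>.\<close>
  define r where "r = real_of_ereal (Linf_norm_from 0 u) + 1"
  have r: "0 < r" "negligible {t \<in> {0..}. \<not> norm (u t) \<le> r}"
    using Linf_norm_bound[OF u order_refl] by (auto simp: r_def elim!: negligible_subset)
  have "\<exists>I. (\<forall>b\<ge>0. set_integrable lebesgue {0..b} I) \<and>
        (AE t in lebesgue_on {0..}. \<forall>y w. \<rho> y xs \<le> R \<and> norm w \<le> r \<longrightarrow> tangent_norm g y (f t y w) \<le> I t)"
    using ass R r(1) unfolding assumption_A_def by blast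
  then obtain I where I: "\<And>b. 0 \<le> b \<Longrightarrow> set_integrable lebesgue {0..b} I"
    "AE t in lebesgue_on {0..}. \<forall>y w. \<rho> y xs \<le> R \<and> norm w \<le> r \<longrightarrow> tangent_norm g y (f t y w) \<le> I t"
    by blast
  \<comment> \<open>Absolute values make the majorant nonnegative at every time, also on the null
    set where assumption (A) is silent.\<close>
  have "(\<lambda>t. \<bar>I t\<bar>) integrable_on {0..b}" for b
  proof (cases "0 \<le> b")
    case True
    then show ?thesis using I(1)[OF True] by (simp add: absolutely_integrable_on_def)
  qed (simp add: integrable_on_empty)
  moreover have "negligible {t \<in> {0..}. \<not> (\<forall>y w. \<rho> y xs \<le> R \<and> norm w \<le> r \<longrightarrow> tangent_norm g y (f t y w) \<le> I t)}"
    by (rule iffD1[OF AE_lebesgue_on_iff_negligible, OF _ I(2)]) simp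
  from negligible_Un[OF this r(2)]
  have "negligible {t \<in> {0..}. \<not> (\<forall>y. \<rho> y xs \<le> R \<longrightarrow> tangent_norm g y (f t y (u t)) \<le> \<bar>I t\<bar>)}"
    by (rule negligible_subset) (force intro: order_trans[OF _ abs_ge_self])
  ultimately show ?thesis by (intro exI[of _ "\<lambda>t. \<bar>I t\<bar>"]) auto
qed

text \<open>The existence theorem wants a right-hand side that is continuous and dominated on the
  whole coordinate space at every time. So the vector field is read in the chart after projecting
  the state to a closed ball, and is cut off on a null set of times. On a short interval the
  solution stays in the ball, where the projection is the identity.\<close>

lemma local_solution:
  fixes f :: "('a, 'n, 'm::finite) control_system"
  assumes tan: "\<And>t x u. 0 \<le> t \<Longrightarrow> f t x u \<in> tangent_space A x"
    and ass: "assumption_A A g xs f" and u: "u \<in> Linf" and T: "0 \<le> T"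
  shows "\<exists>b>T. \<exists>z m. z T = p \<and> m integrable_on {T..b} \<and> (\<forall>t. 0 \<le> m t) \<and>
    (\<forall>s t. T \<le> s \<and> s \<le> t \<and> t \<le> b \<longrightarrow> \<rho> (z s) (z t) \<le> integral {s..t} m) \<and>
    negligible {t \<in> {T<..<b}. \<not> has_velocity A z t (f t (z t) (u t))}"
proof -
  obtain c where c: "c \<in> A" "p \<in> fst c" using ex_chart by blast
  obtain d \<kappa> C where comp: "comparable c p d \<kappa> C"
    using ex_comparable[OF c open_UNIV UNIV_I] by blast
  note d = comparableD[OF comp]
  define z0 where "z0 = snd c p"
  let ?B = "cball z0 d"
  have Bc: "?B \<subseteq> chart_im c" using d(1,4) by (auto simp: z0_def)
  have B2: "z \<in> cball (snd c p) (2 * d)" if "z \<in> ?B" for z using that d(1) by (simp add: z0_def)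
  \<comment> \<open>Large enough for the distance ball of radius \<open>R\<close> around
    \<open>xs\<close> to contain the image of \<open>?B\<close>.\<close>
  define R where "R = C * d + \<rho> p xs"
  have R: "0 < R" using d(1,3) rdist_nonneg[of p xs] by (simp add: R_def add_pos_nonneg)
  have inR: "\<rho> (chart_inv c z) xs \<le> R" if z: "z \<in> ?B" for z
  proof -
    have "\<rho> (chart_inv c z) (chart_inv c z0) \<le> C * dist z z0"
      by (rule d(6)) (use B2[OF z] d(1) in \<open>auto simp: z0_def\<close>)
    also have "\<dots> \<le> C * d" using z d(3) by (intro mult_left_mono) (auto simp: dist_commute)
    finally show ?thesis
      using rdist_triangle[of "chart_inv c z" xs p] by (simp add: R_def z0_def chart_inv_chart[OF c])
  qed
  obtain I where I: "\<And>t. 0 \<le> I t" "\<And>b. I integrable_on {0..b}"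
    and negI: "negligible {t \<in> {0..}. \<not> (\<forall>y. \<rho> y xs \<le> R \<longrightarrow> tangent_norm g y (f t y (u t)) \<le> I t)}"
    using assumption_A_bound[OF ass R u] by blast
  define N where "N = {t \<in> {0..}. \<not> (\<forall>y. \<rho> y xs \<le> R \<longrightarrow> tangent_norm g y (f t y (u t)) \<le> I t)}"
  have N: "negligible N" unfolding N_def by (rule negI)
  have Nm: "- N \<in> sets lebesgue"
    using negligible_imp_sets[OF N] by (simp add: Compl_in_sets_lebesgue)
  define pr where "pr = closest_point ?B"
  have prB: "pr z \<in> ?B" for z
    unfolding pr_def by (rule closest_point_in_set) (use d(1) in auto)
  have prcont: "continuous_on UNIV pr"
    unfolding pr_def by (rule continuous_on_closest_point) (use d(1) in auto)
  \<comment> \<open>The indicator removes the times at which the bound \<open>I\<close> fails, so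
    that \<open>bnd\<close> holds at all times; almost everywhere the equation is unchanged.\<close>
  define F where "F t z = indicat_real (- N) t *\<^sub>R f t (chart_inv c (pr z)) (u t) c" for t z
  define m where "m t = I t / \<kappa>" for t
  have m0: "0 \<le> m t" for t using I(1) d(2) by (simp add: m_def)
  have mi: "m integrable_on {T..b}" for b
    unfolding m_def using T by (intro integrable_on_divide integrable_subinterval_real[OF I(2)[of b]]) auto
  have bnd: "norm (F t z) \<le> m t" if t: "0 \<le> t" for t z
  proof (cases "t \<in> N")
    case True
    then show ?thesis using m0 by (simp add: F_def)
  next
    case False
    let ?y = "chart_inv c (pr z)"
    have y: "?y \<in> fst c" "pr z \<in> chart_im c" using prB[of z] Bc chart_inv_in[OF c(1)] by auto
    have "\<kappa> * norm (f t ?y (u t) c) \<le> coord_norm c (pr z) (f t ?y (u t) c)"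
      by (rule d(5)[OF B2[OF prB]])
    also have "\<dots> = tangent_norm g ?y (f t ?y (u t))"
      unfolding coord_norm_def using tangent_of_coords_of_tangent[OF c(1) y(1) tan[OF t]] by simp
    also have "\<dots> \<le> I t" using False t inR[OF prB] unfolding N_def by auto
    finally have "norm (f t ?y (u t) c) \<le> m t" using d(2) by (simp add: m_def pos_le_divide_eq mult.commute)
    then show ?thesis using False by (simp add: F_def)
  qed
  have Fcont: "continuous_on UNIV (F t)" if t: "0 \<le> t" for t
  proof -
    have loc: "\<forall>z\<in>chart_im c. \<exists>e>0. \<exists>L. L-lipschitz_on (cball z e \<inter> chart_im c) (\<lambda>y. f t (chart_inv c y) (u t) c)"
      using ass t c unfolding assumption_A_def by blast
    have "continuous_on (chart_im c) (\<lambda>y. f t (chart_inv c y) (u t) c)"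
    proof (rule continuous_at_imp_continuous_on, rule ballI)
      fix z assume z: "z \<in> chart_im c"
      then obtain e L where e: "0 < e" and L: "L-lipschitz_on (cball z e \<inter> chart_im c) (\<lambda>y. f t (chart_inv c y) (u t) c)"
        using loc by blast
      have "continuous_on (ball z e \<inter> chart_im c) (\<lambda>y. f t (chart_inv c y) (u t) c)"
        by (rule continuous_on_subset[OF lipschitz_on_continuous_on[OF L]]) auto
      moreover have "open (ball z e \<inter> chart_im c)" "z \<in> ball z e \<inter> chart_im c"
        using e z open_chart_im[OF c(1)] by auto
      ultimately show "isCont (\<lambda>y. f t (chart_inv c y) (u t) c) z"
        by (simp add: continuous_on_eq_continuous_at)
    qed
    then have "continuous_on UNIV (\<lambda>z. f t (chart_inv c (pr z)) (u t) c)"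
      by (rule continuous_on_compose2[OF _ prcont]) (use prB Bc in auto)
    then show ?thesis unfolding F_def by (intro continuous_intros)
  qed
  have Fmeas: "(\<lambda>t. F t z) \<in> borel_measurable (lebesgue_on {T..b})" for z b
  proof -
    define q where "q = chart_inv c (pr z)"
    have y: "q \<in> fst c" unfolding q_def using prB[of z] Bc chart_inv_in[OF c(1)] by auto
    have um: "u \<in> borel_measurable (lebesgue_on {0..})" using u by (simp add: Linf_def)
    have "(\<lambda>t. f t q w c) \<in> borel_measurable (lebesgue_on {0..})" for w
      using ass c(1) y unfolding assumption_A_def by blast
    moreover have "continuous_on UNIV (\<lambda>w. f t q w c)" if "0 \<le> t" for t
      using ass c(1) y that unfolding assumption_A_def by blast
    ultimately have "(\<lambda>t. f t q (u t) c) \<in> borel_measurable (lebesgue_on {0..})"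
      by (intro caratheodory_measurable[where F = "\<lambda>t w. f t q w c" and y = u, OF _ _ um]) auto
    then have "(\<lambda>t. f t q (u t) c) \<in> borel_measurable (lebesgue_on {T..b})"
      by (rule measurable_restrict_mono) (use T in auto)
    moreover have "indicat_real (- N) \<in> borel_measurable (lebesgue_on {T..b})"
      by (intro measurable_restrict_space1 borel_measurable_indicator Nm)
    ultimately show ?thesis unfolding F_def q_def by (intro borel_measurable_scaleR)
  qed
  define \<mu> where "\<mu> t = integral {T..t} m" for t
  have "continuous_on {T..T + 1} \<mu>" unfolding \<mu>_def by (rule indefinite_integral_continuous_1[OF mi])
  then obtain \<delta> where \<delta>: "0 < \<delta>" "\<And>t. t \<in> {T..T + 1} \<Longrightarrow> dist t T < \<delta> \<Longrightarrow> dist (\<mu> t) (\<mu> T) < d"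
    using d(1) unfolding continuous_on_iff by (metis add_increasing2 atLeastAtMost_iff order_refl zero_le_one)
  \<comment> \<open>So short that the integral of \<open>m\<close> is at most \<open>d\<close>, the
    radius of \<open>?B\<close>.\<close>
  define b where "b = T + min (\<delta> / 2) 1"
  have b: "T < b" "b \<le> T + 1" "b - T < \<delta>" using \<delta>(1) by (auto simp: b_def)
  have \<mu>d: "\<mu> t \<le> d" if "t \<in> {T..b}" for t
    using \<delta>(2)[of t] that b by (auto simp: dist_real_def \<mu>_def)
  obtain y where yc: "continuous_on {T..b} y" and Gi: "(\<lambda>s. F s (y s)) integrable_on {T..b}"
    and y: "\<And>t. t \<in> {T..b} \<Longrightarrow> y t = z0 + integral {T..t} (\<lambda>s. F s (y s))"
  proof -
    have "\<exists>y. continuous_on {T..b} y \<and> (\<lambda>s. F s (y s)) integrable_on {T..b} \<and>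
        (\<forall>t\<in>{T..b}. y t = z0 + integral {T..t} (\<lambda>s. F s (y s)))"
      by (rule caratheodory_existence[OF b(1) mi Fmeas]) (use Fcont bnd T in auto)
    then show thesis using that by blast
  qed
  let ?G = "\<lambda>s. F s (y s)"
  have yd: "norm (y t - y s) \<le> integral {s..t} m" if st: "T \<le> s" "s \<le> t" "t \<le> b" for s t
  proof -
    have "y t - y s = integral {s..t} ?G"
      using integral_increment[OF Gi st] st by (simp add: y[of t] y[of s])
    also have "norm \<dots> \<le> integral {s..t} m"
      using st T bnd by (intro integral_norm_bound_integral integrable_subinterval_real[OF Gi] integrable_subinterval_real[OF mi[of b]]) auto
    finally show ?thesis .
  qed
  have yT: "y T = z0" using y[of T] b(1) by simp
  have yB: "y t \<in> ?B" if "t \<in> {T..b}" for t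
    using yd[of T t] \<mu>d[OF that] that yT by (auto simp: dist_norm norm_minus_commute \<mu>_def)
  define z where "z t = chart_inv c (y t)" for t
  have zT: "z T = p" by (simp add: z_def yT z0_def chart_inv_chart[OF c])
  have zdist: "\<rho> (z s) (z t) \<le> integral {s..t} (\<lambda>s. C * m s)" if st: "T \<le> s" "s \<le> t" "t \<le> b" for s t
  proof -
    have "\<rho> (z s) (z t) \<le> C * dist (y s) (y t)"
      unfolding z_def by (intro d(6) B2 yB) (use st in auto)
    also have "\<dots> \<le> C * integral {s..t} m"
      using yd[OF st] d(3) by (intro mult_left_mono) (auto simp: dist_norm norm_minus_commute)
    finally show ?thesis by simp
  qed
  have zv: "has_velocity A z t (f t (z t) (u t))"
    if t: "T < t" "t < b" "t \<notin> N" and der: "((\<lambda>x. integral {T..x} ?G) has_vector_derivative ?G t) (at t)" for t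
  proof -
    have "((\<lambda>x. z0 + integral {T..x} ?G) has_vector_derivative 0 + ?G t) (at t)"
      by (intro has_vector_derivative_add has_vector_derivative_const der)
    then have "(snd c \<circ> z has_vector_derivative 0 + ?G t) (at t)"
    proof (rule has_vector_derivative_transform_within_open[of _ _ _ "{T<..<b}"])
      fix s assume s: "s \<in> {T<..<b}"
      then have "y s \<in> chart_im c" using yB[of s] Bc by auto
      then show "z0 + integral {T..s} ?G = (snd c \<circ> z) s"
        using y[of s] s by (simp add: z_def chart_chart_inv[OF c(1)])
    qed (use t in auto)
    moreover have yt: "y t \<in> ?B" using yB t by auto
    then have zt: "z t \<in> fst c" using Bc chart_inv_in[OF c(1)] by (auto simp: z_def)
    moreover have "0 + ?G t = f t (z t) (u t) c"
      using t closest_point_self[OF yt] by (simp add: F_def z_def pr_def)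
    ultimately have "has_velocity A z t (tangent_of_coords A c (z t) (f t (z t) (u t) c))"
      using has_velocityI[of c z t] c(1) by metis
    then show ?thesis using tangent_of_coords_of_tangent[OF c(1) zt tan] t T by simp
  qed
  have "negligible ({t \<in> {T<..<b}. \<not> ((\<lambda>x. integral {T..x} ?G) has_vector_derivative ?G t) (at t)} \<union> N)"
    by (intro negligible_Un N indefinite_integral_has_vector_derivative_ae Gi)
  then have vel: "negligible {t \<in> {T<..<b}. \<not> has_velocity A z t (f t (z t) (u t))}"
    by (rule negligible_subset) (use zv in auto)
  show ?thesis
  proof (intro exI[of _ b] exI[of _ z] exI[of _ "\<lambda>t. C * m t"] conjI allI impI)
    show "(\<lambda>t. C * m t) integrable_on {T..b}" by (intro integrable_on_mult_right mi)
    show "0 \<le> C * m t" for t using m0 d(3) by simp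
    show "\<rho> (z s) (z t) \<le> integral {s..t} (\<lambda>t. C * m t)" if "T \<le> s \<and> s \<le> t \<and> t \<le> b" for s t
      using zdist that by blast
  qed (fact b(1) zT vel)+
qed

text \<open>The speed bound is integrable up to \<open>T\<close>, so distances between states are
  bounded by increments of a function continuous at \<open>T\<close>; along times tending to
  \<open>T\<close> the states form a Cauchy sequence. The limit is recorded as a distance estimate
  up to \<open>T\<close>, which is what gluing requires.\<close>

lemma bounded_solution_limit:
  fixes f :: "('a, 'n, 'm::finite) control_system"
  assumes compl: "complete_riemannian A g"
    and ass: "assumption_A A g xs f" and u: "u \<in> Linf" and t0: "0 \<le> t0" "t0 < T"
    and sol: "is_solution A g f u t0 (ereal T) x"
    and bounded: "\<And>t. t0 \<le> t \<Longrightarrow> t < T \<Longrightarrow> \<rho> (x t) xs \<le> R"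
  shows "\<exists>p J. J integrable_on {t0..T} \<and> (\<forall>t. 0 \<le> J t) \<and>
    (\<forall>s t. t0 \<le> s \<and> s \<le> t \<and> t < T \<longrightarrow> \<rho> (x s) (x t) \<le> integral {s..t} J) \<and>
    (\<forall>s. t0 \<le> s \<and> s < T \<longrightarrow> \<rho> (x s) p \<le> integral {s..T} J)"
proof -
  have R: "0 < \<bar>R\<bar> + 1" by simp
  obtain J where J: "\<And>t. 0 \<le> J t" "\<And>b. J integrable_on {0..b}"
    and negJ: "negligible {t \<in> {0..}. \<not> (\<forall>y. \<rho> y xs \<le> \<bar>R\<bar> + 1 \<longrightarrow> tangent_norm g y (f t y (u t)) \<le> J t)}"
    using assumption_A_bound[OF ass R u] by blast
  have Ji: "J integrable_on {a..b}" if "0 \<le> a" for a b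
    using that by (intro integrable_subinterval_real[OF J(2)[of b]]) auto
  define N where "N = {s. \<not> (t0 < s \<and> ereal s < ereal T \<longrightarrow> has_velocity A x s (f s (x s) (u s)))} \<union>
    {t \<in> {0..}. \<not> (\<forall>y. \<rho> y xs \<le> \<bar>R\<bar> + 1 \<longrightarrow> tangent_norm g y (f t y (u t)) \<le> J t)}"
  have N: "negligible N"
    unfolding N_def using sol by (intro negligible_Un negJ) (simp add: is_solution_def AE_lebesgue_iff_negligible)
  have d: "\<rho> (x s) (x t) \<le> integral {s..t} J" if st: "t0 \<le> s" "s \<le> t" "t < T" for s t
  proof (rule speed_bound_dist[OF st(2) _ N Ji])
    show "abs_continuous_curve A g x s t" using sol st by (simp add: is_solution_def)
    fix \<tau> assume \<tau>: "\<tau> \<in> {s<..<t} - N"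
    then have "has_velocity A x \<tau> (f \<tau> (x \<tau>) (u \<tau>))" using st by (auto simp: N_def)
    moreover have "\<rho> (x \<tau>) xs \<le> \<bar>R\<bar> + 1" using bounded[of \<tau>] \<tau> st by auto
    then have "tangent_norm g (x \<tau>) (f \<tau> (x \<tau>) (u \<tau>)) \<le> J \<tau>" using \<tau> st t0 by (auto simp: N_def)
    ultimately show "\<exists>v. has_velocity A x \<tau> v \<and> tangent_norm g (x \<tau>) v \<le> J \<tau>" by blast
  qed (use st t0 in auto)
  define \<mu> where "\<mu> t = integral {t0..t} J" for t
  have \<mu>: "integral {s..t} J = \<mu> t - \<mu> s" if "t0 \<le> s" "s \<le> t" for s t
    using integral_increment[OF Ji that order_refl] t0 by (simp add: \<mu>_def)
  have \<mu>cont: "continuous_on {t0..T} \<mu>"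
    unfolding \<mu>_def by (rule indefinite_integral_continuous_1[OF Ji]) (use t0 in auto)
  define \<tau> where "\<tau> n = T - (T - t0) * inverse (real (Suc n))" for n
  have \<tau>in: "t0 \<le> \<tau> n" "\<tau> n < T" for n
  proof -
    have "(T - t0) * inverse (real (Suc n)) \<le> (T - t0) * 1"
      using t0 by (intro mult_left_mono) (auto simp: field_simps)
    then show "t0 \<le> \<tau> n" by (simp add: \<tau>_def)
    show "\<tau> n < T" using t0 by (simp add: \<tau>_def)
  qed
  have "\<tau> \<longlonglongrightarrow> T - (T - t0) * 0" unfolding \<tau>_def by (intro tendsto_intros LIMSEQ_inverse_real_of_nat)
  then have \<tau>lim: "\<tau> \<longlonglongrightarrow> T" by simp
  have \<mu>lim: "(\<lambda>n. \<mu> (\<tau> n)) \<longlonglongrightarrow> \<mu> T"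
    by (rule continuous_on_tendsto_compose[OF \<mu>cont \<tau>lim]) (use \<tau>in t0 in \<open>auto simp: less_imp_le\<close>)
  have dle: "\<rho> (x (\<tau> i)) (x (\<tau> j)) \<le> \<bar>\<mu> (\<tau> i) - \<mu> (\<tau> j)\<bar>" for i j
    using d[of "\<tau> i" "\<tau> j"] d[of "\<tau> j" "\<tau> i"] \<mu>[of "\<tau> i" "\<tau> j"] \<mu>[of "\<tau> j" "\<tau> i"] \<tau>in[of i] \<tau>in[of j]
      rdist_commute[of "x (\<tau> i)" "x (\<tau> j)"] by (cases "\<tau> i \<le> \<tau> j") auto
  have "M.MCauchy (x \<circ> \<tau>)"
    unfolding M.MCauchy_def
  proof (intro conjI allI impI)
    fix e :: real assume "0 < e"
    then obtain n0 where n0: "\<And>i j. n0 \<le> i \<Longrightarrow> n0 \<le> j \<Longrightarrow> dist (\<mu> (\<tau> i)) (\<mu> (\<tau> j)) < e"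
      using LIMSEQ_imp_Cauchy[OF \<mu>lim] unfolding Cauchy_def by metis
    show "\<exists>N. \<forall>n n'. N \<le> n \<longrightarrow> N \<le> n' \<longrightarrow> \<rho> ((x \<circ> \<tau>) n) ((x \<circ> \<tau>) n') < e"
      using le_less_trans[OF dle n0[unfolded dist_real_def]] by (intro exI[of _ n0]) simp
  qed auto
  then obtain p where "limitin M.mtopology (x \<circ> \<tau>) p sequentially"
    using compl unfolding complete_riemannian_def M.mcomplete_def by blast
  then have p: "\<And>e. 0 < e \<Longrightarrow> \<exists>n0. \<forall>n\<ge>n0. \<rho> (x (\<tau> n)) p < e"
    by (simp add: M.limit_metric_sequentially)
  then have plim: "(\<lambda>n. \<rho> (x (\<tau> n)) p) \<longlonglongrightarrow> 0"
    unfolding LIMSEQ_iff by (simp add: rdist_nonneg)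
  have "\<rho> (x s) p \<le> integral {s..T} J" if s: "t0 \<le> s" "s < T" for s
  proof -
    have "\<forall>\<^sub>F n in sequentially. s < \<tau> n" using \<tau>lim s(2) by (rule order_tendstoD)
    then have "\<forall>\<^sub>F n in sequentially. \<rho> (x s) p \<le> \<mu> (\<tau> n) - \<mu> s + \<rho> (x (\<tau> n)) p"
    proof (rule eventually_mono)
      fix n assume n: "s < \<tau> n"
      have "\<rho> (x s) p \<le> \<rho> (x s) (x (\<tau> n)) + \<rho> (x (\<tau> n)) p" by (rule rdist_triangle)
      then show "\<rho> (x s) p \<le> \<mu> (\<tau> n) - \<mu> s + \<rho> (x (\<tau> n)) p"
        using d[of s "\<tau> n"] \<mu>[of s "\<tau> n"] s n \<tau>in[of n] by simp
    qed
    moreover have "(\<lambda>n. \<mu> (\<tau> n) - \<mu> s + \<rho> (x (\<tau> n)) p) \<longlonglongrightarrow> \<mu> T - \<mu> s + 0"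
      by (intro tendsto_intros \<mu>lim plim)
    ultimately have "\<rho> (x s) p \<le> \<mu> T - \<mu> s + 0"
      by (intro tendsto_lowerbound[of _ _ sequentially]) auto
    then show ?thesis using \<mu>[of s T] s by simp
  qed
  then show ?thesis using J(1) Ji d t0 by (intro exI[of _ p] exI[of _ J]) auto
qed

lemma bounded_solution_extends:
  fixes f :: "('a, 'n, 'm::finite) control_system"
  assumes compl: "complete_riemannian A g"
    and tan: "\<And>t x u. 0 \<le> t \<Longrightarrow> f t x u \<in> tangent_space A x"
    and ass: "assumption_A A g xs f" and u: "u \<in> Linf" and t0: "0 \<le> t0" "t0 < T"
    and sol: "is_solution A g f u t0 (ereal T) x"
    and bounded: "\<And>t. t0 \<le> t \<Longrightarrow> t < T \<Longrightarrow> \<rho> (x t) xs \<le> R"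
  shows "\<exists>T' x'. ereal T < T' \<and> is_solution A g f u t0 T' x' \<and> (\<forall>t. t0 \<le> t \<and> ereal t < ereal T \<longrightarrow> x' t = x t)"
proof -
  from bounded_solution_limit[OF compl ass u t0 sol bounded]
  obtain p J where J: "J integrable_on {t0..T}" "\<And>t. 0 \<le> J t"
    and xd: "\<And>s t. t0 \<le> s \<Longrightarrow> s \<le> t \<Longrightarrow> t < T \<Longrightarrow> \<rho> (x s) (x t) \<le> integral {s..t} J"
    and xp: "\<And>s. t0 \<le> s \<Longrightarrow> s < T \<Longrightarrow> \<rho> (x s) p \<le> integral {s..T} J"
    by blast
  have "0 \<le> T" using t0 by simp
  from local_solution[OF tan ass u this, of p]
  obtain b z m where b: "T < b" and zT: "z T = p" and m: "m integrable_on {T..b}" "\<And>t. 0 \<le> m t"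
    and zd: "\<And>s t. T \<le> s \<Longrightarrow> s \<le> t \<Longrightarrow> t \<le> b \<Longrightarrow> \<rho> (z s) (z t) \<le> integral {s..t} m"
    and zv: "negligible {t \<in> {T<..<b}. \<not> has_velocity A z t (f t (z t) (u t))}" by blast
  \<comment> \<open>At \<open>T\<close> the value is taken from the local solution, since being a
    solution on \<open>[t0, T)\<close> does not constrain \<open>x T\<close>.\<close>
  define x' where "x' t = (if t < T then x t else z t)" for t
  define k where "k t = (if t < T then J t else m t)" for t
  have k0: "0 \<le> k t" for t using J(2) m(2) by (simp add: k_def)
  have kJ: "(k has_integral i) {s..t} \<longleftrightarrow> (J has_integral i) {s..t}" if "t \<le> T" for s t i
    by (rule has_integral_spike_finite_eq[of "{T}"]) (use that in \<open>auto simp: k_def\<close>)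
  have km: "(k has_integral i) {s..t} \<longleftrightarrow> (m has_integral i) {s..t}" if "T \<le> s" for s t i
    by (rule has_integral_cong) (use that in \<open>auto simp: k_def\<close>)
  have kJ': "k integrable_on {s..t} \<longleftrightarrow> J integrable_on {s..t}" "integral {s..t} k = integral {s..t} J" if "t \<le> T" for s t
    using kJ[OF that] by (auto simp: integrable_on_def integral_def)
  have km': "k integrable_on {s..t} \<longleftrightarrow> m integrable_on {s..t}" "integral {s..t} k = integral {s..t} m" if "T \<le> s" for s t
    using km[OF that] by (auto simp: integrable_on_def integral_def)
  have ki: "k integrable_on {t0..b}"
    by (rule Henstock_Kurzweil_Integration.integrable_combine[of t0 T]) (use t0 b J(1) m(1) kJ' km' in auto)
  have ki': "k integrable_on {s..t}" if "t0 \<le> s" "t \<le> b" for s t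
    by (rule integrable_subinterval_real[OF ki]) (use that in auto)
  have kd: "\<rho> (x' s) (x' t) \<le> integral {s..t} k" if st: "t0 \<le> s" "s \<le> t" "t \<le> b" for s t
  proof -
    consider "t < T" | "T \<le> s" | "s < T" "T \<le> t" by linarith
    then show ?thesis
    proof cases
      case 1
      then show ?thesis using st xd kJ' by (simp add: x'_def)
    next
      case 2
      then show ?thesis using st zd km' by (simp add: x'_def)
    next
      case 3
      have "\<rho> (x' s) (x' t) \<le> \<rho> (x s) p + \<rho> p (z t)"
        using 3 rdist_triangle[of "x s" "z t" p] by (simp add: x'_def)
      also have "\<dots> \<le> integral {s..T} J + integral {T..t} m"
        using xp[of s] zd[of T t] st 3 zT by (intro add_mono) auto
      also have "\<dots> = integral {s..T} k + integral {T..t} k" using kJ'(2) km'(2) by simp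
      also have "\<dots> = integral {s..t} k"
        by (rule Henstock_Kurzweil_Integration.integral_combine) (use 3 st ki' in auto)
      finally show ?thesis .
    qed
  qed
  have ac: "abs_continuous_curve A g x' \<alpha> \<beta>" if "t0 \<le> \<alpha>" "\<alpha> \<le> \<beta>" "\<beta> \<le> b" for \<alpha> \<beta>
    unfolding abs_continuous_curve_def
  proof (intro exI[of _ k] conjI allI impI)
    \<comment> \<open>Nonnegativity of \<open>k\<close> upgrades gauge integrability to the Lebesgue
      integrability in the definition of absolute continuity.\<close>
    have *: "set_integrable lebesgue {s..t} k" if "t0 \<le> s" "t \<le> b" for s t
      by (rule nonnegative_absolutely_integrable_1[OF ki'[OF that]]) (rule k0)
    show "set_integrable lebesgue {\<alpha>..\<beta>} k" using * that by simp
    fix s t assume st: "\<alpha> \<le> s \<and> s \<le> t \<and> t \<le> \<beta>"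
    then show "\<rho> (x' s) (x' t) \<le> (LINT \<tau>:{s..t}|lebesgue. k \<tau>)"
      using set_lebesgue_integral_eq_integral(2)[OF *[of s t]] kd[of s t] that by simp
  qed
  have left: "has_velocity A x' t (f t (x' t) (u t))" if "has_velocity A x t (f t (x t) (u t))" "t < T" for t
  proof -
    have "\<forall>\<^sub>F s in nhds t. s < T" using that(2) by (intro eventually_nhds_in_open[of "{..<T}", simplified]) auto
    then have "\<forall>\<^sub>F s in nhds t. x' s = x s" by (rule eventually_mono) (simp add: x'_def)
    then show ?thesis using has_velocity_cong that by (simp add: x'_def)
  qed
  have right: "has_velocity A x' t (f t (x' t) (u t))" if "has_velocity A z t (f t (z t) (u t))" "T < t" for t
  proof -
    have "\<forall>\<^sub>F s in nhds t. T < s" using that(2) by (intro eventually_nhds_in_open[of "{T<..}", simplified]) auto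
    then have "\<forall>\<^sub>F s in nhds t. x' s = z s" by (rule eventually_mono) (simp add: x'_def)
    then show ?thesis using has_velocity_cong that by (simp add: x'_def)
  qed
  have "negligible {t. \<not> (t0 < t \<and> ereal t < ereal T \<longrightarrow> has_velocity A x t (f t (x t) (u t)))}"
    using sol by (simp add: is_solution_def AE_lebesgue_iff_negligible)
  \<comment> \<open>The pieces may meet at a corner, so \<open>T\<close> joins the exceptional
    set.\<close>
  then have "negligible ({t. \<not> (t0 < t \<and> ereal t < ereal T \<longrightarrow> has_velocity A x t (f t (x t) (u t)))} \<union>
      ({t \<in> {T<..<b}. \<not> has_velocity A z t (f t (z t) (u t))} \<union> {T}))"
    using zv by (intro negligible_Un) auto
  then have "negligible {t. \<not> (t0 < t \<and> ereal t < ereal b \<longrightarrow> has_velocity A x' t (f t (x' t) (u t)))}"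
    by (rule negligible_subset) (use left right in force)
  then have "is_solution A g f u t0 (ereal b) x'"
    unfolding is_solution_def AE_lebesgue_iff_negligible using ac by simp
  then show ?thesis using b by (intro exI[of _ "ereal b"] exI[of _ x']) (auto simp: x'_def)
qed

text \<open>The estimate of \<open>ISS_gains\<close> holds for as long as a solution exists, without
  presupposing global existence; it therefore supplies the bound under which a solution with finite
  end time extends.\<close>

lemma globally_ISS_of_Lyapunov:
  fixes f :: "('a, 'n, 'm::finite) control_system"
  assumes compl: "complete_riemannian A g"
    and tan: "\<And>t x u. 0 \<le> t \<Longrightarrow> f t x u \<in> tangent_space A x"
    and ass: "assumption_A A g xs f"
    and Lyap: "ISS_Lyapunov A g xs f V \<alpha>1 \<alpha>2 \<alpha>3 \<alpha>4" and Kinf: "class_K_inf \<alpha>1" "class_K_inf \<alpha>2"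
  shows "globally_ISS A g xs f"
proof -
  obtain \<beta> \<gamma> where \<beta>: "class_KL \<beta>" and \<gamma>: "class_K \<gamma>"
    and est: "\<And>t0 u T x t. 0 \<le> t0 \<Longrightarrow> u \<in> Linf \<Longrightarrow> is_solution A g f u t0 T x \<Longrightarrow> t0 \<le> t \<Longrightarrow> ereal t < T \<Longrightarrow>
      \<rho> (x t) xs \<le> \<beta> (\<rho> (x t0) xs) (t - t0) + \<gamma> (real_of_ereal (Linf_norm_from t0 u))"
    using ISS_gains[OF Lyap Kinf] by blast
  have global: "T = \<infinity>" if t0: "0 \<le> t0" and u: "u \<in> Linf" and max: "is_maximal_solution A g f u t0 T x" for t0 u T x
  proof (rule ccontr)
    assume "T \<noteq> \<infinity>"
    moreover have "ereal t0 < T" using max by (simp add: is_maximal_solution_def)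
    ultimately obtain T' where T': "T = ereal T'" "t0 < T'" by (cases T) auto
    have sol: "is_solution A g f u t0 (ereal T') x" using max T' by (simp add: is_maximal_solution_def)
    \<comment> \<open>\<open>\<beta>\<close> is nonincreasing in time, so its value at elapsed time
      \<open>0\<close> bounds the whole trajectory.\<close>
    let ?R = "\<beta> (\<rho> (x t0) xs) 0 + \<gamma> (real_of_ereal (Linf_norm_from t0 u))"
    have "\<rho> (x t) xs \<le> ?R" if t: "t0 \<le> t" "t < T'" for t
    proof -
      have "antimono_on {0..} (\<beta> (\<rho> (x t0) xs))" using \<beta> rdist_nonneg by (simp add: class_KL_def)
      then have "\<beta> (\<rho> (x t0) xs) (t - t0) \<le> \<beta> (\<rho> (x t0) xs) 0" by (rule monotone_onD) (use t in auto)
      then show ?thesis using est[OF t0 u sol, of t] t by simp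
    qed
    from bounded_solution_extends[OF compl tan ass u t0 T'(2) sol this]
    show False using max T'(1) unfolding is_maximal_solution_def by blast
  qed
  show ?thesis
    unfolding globally_ISS_def
  proof (intro exI[of _ \<beta>] exI[of _ \<gamma>] conjI ballI allI impI \<beta> \<gamma>)
    fix t0 u T x assume *: "0 \<le> t0" "u \<in> Linf" "is_maximal_solution A g f u t0 T x"
    then show T: "T = \<infinity>" by (rule global)
    fix t assume "t0 \<le> t"
    then show "\<rho> (x t) xs \<le> \<beta> (\<rho> (x t0) xs) (t - t0) + \<gamma> (real_of_ereal (Linf_norm_from t0 u))"
      using est[OF *(1,2), of T x t] *(3) T by (simp add: is_maximal_solution_def)
  qed
qed

end

theorem corollary2p1:
  fixes A :: "('a::{t2_space, second_countable_topology}, 'n::finite) chart set"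
    and g :: "('a, 'n) metric"
    and f :: "('a, 'n, 'm::finite) control_system"
    and xs :: 'a
    and V :: "real \<Rightarrow> 'a \<Rightarrow> real"
    and \<alpha>1 \<alpha>2 \<alpha>3 \<alpha>4 :: "real \<Rightarrow> real"
  assumes "riemannian_manifold A g"
    and "connected (UNIV :: 'a set)"
    and "complete_riemannian A g"
    and "\<And>t x u. t \<ge> 0 \<Longrightarrow> f t x u \<in> tangent_space A x"
    and "\<And>t. t \<ge> 0 \<Longrightarrow> f t xs 0 = tangent_zero"
    and "assumption_A A g xs f"
    and "ISS_Lyapunov A g xs f V \<alpha>1 \<alpha>2 \<alpha>3 \<alpha>4"
    and "class_K_inf \<alpha>1"
    and "class_K_inf \<alpha>2"
  shows "globally_ISS A g xs f"
proof -
  interpret connected_riemannian A g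
    by unfold_locales (fact assms)+
  show ?thesis by (rule globally_ISS_of_Lyapunov) (fact assms)+
qed

end
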